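(* Let $R$ be a commutative ring and let $(C,d,\nabla_C,\{E^{k,1}\}_{k\ge 1})$ be a homotopy G-coalgebra over $R$ with $E^{k,1}=0$ for all $k\ge2$. If $O_2$ is zero, i.e. if $E^{1,1}-\tau E^{1,1}=0$ (where $\tau$ is the signed interchange of the two factors of $\widetilde C\otimes\widetilde C$), then $O_n=0$ for all $n\ge2$.
   Context: Conventions. The Koszul sign rule is used and $s^{-1}$ lowers degree by $1$. $\overline C$ is the kernel of the counit of a coaugmented coalgebra $C$, with reduced coproduct $\overline\nabla(c)=\nabla(c)-c\otimes1-1\otimes c$, and $\widetilde C:=s^{-1}\overline C$. $C$ is $1$-reduced if it is coaugmented, zero in negative degrees, $C_0\cong R$ and $C_1=0$. The cobar construction is $\Omega C=(T(\widetilde C),d_\Omega)$ with $d_\Omega$ the derivation determined by $d_\Omega(s^{-1}c)=-s^{-1}dc+(s^{-1}\otimes s^{-1})\overline\nabla_C(c)$. Homotopy G-coalgebra: a $1$-reduced DG-coalgebra $(C,d,\nabla_C)$ with a map $\nabla:\Omega C\to\Omega C\otimes\Omega C$ making $\Omega C$ a coassociative counital DG-bialgebra such that the components $E^{i,j}:\widetilde C\to\widetilde C^{\otimes i}\otimes\widetilde C^{\otimes j}$ of $\nabla|_{\widetilde C}$ vanish for $i\ge1$, $j\ge2$. Thus $\nabla(x)=x\otimes1+1\otimes x+\sum_{k\ge1}E^{k,1}(x)$ for $x\in\widetilde C$. Obstructions: put $F^1=-\mathrm{Id}_{\widetilde C}$ and for $n\ge2$ $$F^n=\sum_{1\le s\le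 n-1}\ \sum_{\substack{n_1+\dots+n_s=n-1\\ n_i\ge1}}(-1)^{s+1}(1^{\otimes n_1+\dots+n_{s-1}}\otimes E^{n_s,1})\cdots(1^{\otimes n_1}\otimes E^{n_2,1})E^{n_1,1}:\widetilde C\to\widetilde C^{\otimes n}.$$ For $n\ge2$ let $$O_n=\sum_{s=1}^n\ \sum_{\substack{n_1+\dots+n_s=n\\ n_i\ge 1}}\rho_{n_1,\dots,n_s}(F^{n_1}\otimes\cdots\otimes F^{n_s})F^s:\widetilde C\to\widetilde C^{\otimes n},$$ where $\rho_{n_1,\dots,n_s}$ reverses the order of the $s$ blocks $\widetilde C^{\otimes n_1},\dots,\widetilde C^{\otimes n_s}$ (keeping the order inside each block), with Koszul sign. In particular $O_2=\pm(E^{1,1}-\tau E^{1,1})$. *)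

theory Defs
  imports "HOL-Algebra.Module" "HOL-Algebra.QuotRing"
begin

section \<open>Graded modules\<close>

text \<open>
  A graded module is an HOL-Algebra module together with its homogeneous submodules, of which it is
  the internal direct sum. The ring fields \<^const>\<open>mult\<close> and \<^const>\<open>one\<close> of the record are used
  only for graded algebras and are unconstrained otherwise.
\<close>

record ('r, 'm) gmodule = "('r, 'm) module" +
  gpart :: "int \<Rightarrow> 'm set"

definition hdecomp :: "('r, 'm) gmodule \<Rightarrow> 'm \<Rightarrow> (int \<Rightarrow> 'm) \<Rightarrow> bool" where
  "hdecomp M x f \<longleftrightarrow>
     (\<forall>n. f n \<in> gpart M n) \<and> finite {n. f n \<noteq> \<zero>\<^bsub>M\<^esub>} \<and> x = (\<Oplus>\<^bsub>M\<^esub> n\<in>{n. f n \<noteq> \<zero>\<^bsub>M\<^esub>}. f n)"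

locale graded_module = module R M for R :: "'r ring" and M :: "('r, 'm) gmodule" +
  assumes gpart_submodule: "submodule (gpart M n) R M"
    and direct_sum: "x \<in> carrier M \<Longrightarrow> \<exists>!f. hdecomp M x f"

definition hcomp :: "('r, 'm) gmodule \<Rightarrow> int \<Rightarrow> 'm \<Rightarrow> 'm" where
  "hcomp M n x = (THE f. hdecomp M x f) n"

definition sg :: "('m, 'z) ring_scheme \<Rightarrow> int \<Rightarrow> 'm \<Rightarrow> 'm" where
  "sg M k x = (if even k then x else \<ominus>\<^bsub>M\<^esub> x)"

text \<open>The linear involution with value \<open>(-1)\<^bsup>|x|\<^esup> x\<close> on homogeneous \<open>x\<close>; it carries the Koszul
  sign of an operator of odd degree moved past \<open>x\<close>.\<close>

definition sgn_inv :: "('r, 'm) gmodule \<Rightarrow> 'm \<Rightarrow> 'm" where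
  "sgn_inv M x = (\<Oplus>\<^bsub>M\<^esub> n\<in>{n. hcomp M n x \<noteq> \<zero>\<^bsub>M\<^esub>}. sg M n (hcomp M n x))"

definition lin_map :: "'r ring \<Rightarrow> ('r, 'm) gmodule \<Rightarrow> ('r, 'n) gmodule \<Rightarrow> ('m \<Rightarrow> 'n) set" where
  "lin_map R M N = {f \<in> carrier M \<rightarrow> carrier N.
     (\<forall>x\<in>carrier M. \<forall>y\<in>carrier M. f (x \<oplus>\<^bsub>M\<^esub> y) = f x \<oplus>\<^bsub>N\<^esub> f y) \<and>
     (\<forall>r\<in>carrier R. \<forall>x\<in>carrier M. f (r \<odot>\<^bsub>M\<^esub> x) = r \<odot>\<^bsub>N\<^esub> f x)}"

definition deg_map ::
  "'r ring \<Rightarrow> ('r, 'm) gmodule \<Rightarrow> ('r, 'n) gmodule \<Rightarrow> int \<Rightarrow> ('m \<Rightarrow> 'n) set" where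
  "deg_map R M N k = {f \<in> lin_map R M N. \<forall>n. f ` gpart M n \<subseteq> gpart N (n + k)}"

definition ground :: "'r ring \<Rightarrow> ('r, 'r) gmodule" where
  "ground R = \<lparr>carrier = carrier R, mult = mult R, one = one R, zero = zero R, add = add R,
     smult = mult R, gpart = (\<lambda>n. if n = 0 then carrier R else {\<zero>\<^bsub>R\<^esub>})\<rparr>"


section \<open>The tensor algebra and tensor powers\<close>

text \<open>
  The free (noncommutative) algebra on a set \<open>S\<close>: finitely supported functions on words over \<open>S\<close>,
  with convolution along concatenation.
\<close>

definition free_alg :: "'r ring \<Rightarrow> 'm set \<Rightarrow> ('r, 'm list \<Rightarrow> 'r) module" where
  "free_alg R S = \<lparr>
     carrier = {p. (\<forall>w. p w \<in> carrier R) \<and> finite {w. p w \<noteq> \<zero>\<^bsub>R\<^esub>} \<and> {w. p w \<noteq> \<zero>\<^bsub>R\<^esub>} \<subseteq> lists S},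
     mult = (\<lambda>p q w. \<Oplus>\<^bsub>R\<^esub> i\<in>{..length w}. p (take i w) \<otimes>\<^bsub>R\<^esub> q (drop i w)),
     one = (\<lambda>w. if w = [] then \<one>\<^bsub>R\<^esub> else \<zero>\<^bsub>R\<^esub>),
     zero = (\<lambda>w. \<zero>\<^bsub>R\<^esub>),
     add = (\<lambda>p q w. p w \<oplus>\<^bsub>R\<^esub> q w),
     smult = (\<lambda>r p w. r \<otimes>\<^bsub>R\<^esub> p w)\<rparr>"

definition word :: "'r ring \<Rightarrow> 'm list \<Rightarrow> 'm list \<Rightarrow> 'r" where
  "word R v = (\<lambda>w. if w = v then \<one>\<^bsub>R\<^esub> else \<zero>\<^bsub>R\<^esub>)"

definition tensor_rels :: "'r ring \<Rightarrow> ('r, 'm) gmodule \<Rightarrow> ('m list \<Rightarrow> 'r) set" where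
  "tensor_rels R M = (let F = free_alg R (carrier M) in
     {word R [x \<oplus>\<^bsub>M\<^esub> y] \<ominus>\<^bsub>F\<^esub> (word R [x] \<oplus>\<^bsub>F\<^esub> word R [y]) | x y. x \<in> carrier M \<and> y \<in> carrier M} \<union>
     {word R [r \<odot>\<^bsub>M\<^esub> x] \<ominus>\<^bsub>F\<^esub> r \<odot>\<^bsub>F\<^esub> word R [x] | r x. r \<in> carrier R \<and> x \<in> carrier M})"

definition tensor_ideal :: "'r ring \<Rightarrow> ('r, 'm) gmodule \<Rightarrow> ('m list \<Rightarrow> 'r) set" where
  "tensor_ideal R M = genideal (free_alg R (carrier M)) (tensor_rels R M)"

text \<open>
  The tensor algebra \<open>T(M)\<close>, with the total grading. Its product is concatenation of tensors, so that
  for maps \<open>f\<close>, \<open>g\<close> with values in \<open>T(M)\<close> the element \<open>f x \<otimes> g y\<close> is the product of \<open>f x\<close> and \<open>g y\<close>.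
\<close>

definition TA :: "'r ring \<Rightarrow> ('r, 'm) gmodule \<Rightarrow> ('r, ('m list \<Rightarrow> 'r) set) gmodule" where
  "TA R M = (let F = free_alg R (carrier M); I = tensor_ideal R M; Q = F Quot I in
     \<lparr>carrier = carrier Q, mult = mult Q, one = one Q, zero = zero Q, add = add Q,
      smult = (\<lambda>r X. \<Union>p\<in>X. I +>\<^bsub>F\<^esub> (r \<odot>\<^bsub>F\<^esub> p)),
      gpart = (\<lambda>n. {X \<in> carrier Q. \<exists>p\<in>X. \<forall>w. p w \<noteq> \<zero>\<^bsub>R\<^esub> \<longrightarrow>
        (\<exists>ds. list_all2 (\<lambda>x k. x \<in> gpart M k) w ds \<and> sum_list ds = n)})\<rparr>)"

text \<open>The elementary tensor \<open>x\<^sub>1 \<otimes> \<dots> \<otimes> x\<^sub>k\<close>.\<close>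

definition tens :: "'r ring \<Rightarrow> ('r, 'm) gmodule \<Rightarrow> 'm list \<Rightarrow> ('m list \<Rightarrow> 'r) set" where
  "tens R M xs = tensor_ideal R M +>\<^bsub>free_alg R (carrier M)\<^esub> word R xs"

text \<open>The tensor power \<open>M\<^bsup>\<otimes>k\<^esup>\<close> is the part of \<open>T(M)\<close> of word length \<open>k\<close>.\<close>

definition tpow :: "'r ring \<Rightarrow> ('r, 'm) gmodule \<Rightarrow> nat \<Rightarrow> ('m list \<Rightarrow> 'r) set set" where
  "tpow R M k = {X \<in> carrier (TA R M). \<exists>p\<in>X. \<forall>w. p w \<noteq> \<zero>\<^bsub>R\<^esub> \<longrightarrow> length w = k}"

text \<open>
  The linear map \<open>T(M) \<rightarrow> N\<close> determined by a function \<open>f\<close> on words that is multilinear on words of each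
  fixed length; the value does not depend on the chosen representative.
\<close>

definition tlift :: "'r ring \<Rightarrow> ('r, 'm) gmodule \<Rightarrow> ('r, 'n) gmodule \<Rightarrow> ('m list \<Rightarrow> 'n)
    \<Rightarrow> ('m list \<Rightarrow> 'r) set \<Rightarrow> 'n" where
  "tlift R M N f X =
     (let p = (SOME p. p \<in> X) in \<Oplus>\<^bsub>N\<^esub> w\<in>{w. p w \<noteq> \<zero>\<^bsub>R\<^esub>}. p w \<odot>\<^bsub>N\<^esub> f w)"

text \<open>The linear map \<open>M\<^bsup>\<otimes>k\<^esup> \<rightarrow> N\<close> determined by a multilinear \<open>f\<close>, extended by zero to \<open>T(M)\<close>.\<close>

definition tlift_pow :: "'r ring \<Rightarrow> ('r, 'm) gmodule \<Rightarrow> ('r, 'n) gmodule \<Rightarrow> nat \<Rightarrow> ('m list \<Rightarrow> 'n)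
    \<Rightarrow> ('m list \<Rightarrow> 'r) set \<Rightarrow> 'n" where
  "tlift_pow R M N k f = tlift R M N (\<lambda>w. if length w = k then f w else \<zero>\<^bsub>N\<^esub>)"

definition tlift2 :: "'r ring \<Rightarrow> ('r, 'm) gmodule \<Rightarrow> ('r, 'n) gmodule \<Rightarrow> ('m \<Rightarrow> 'm \<Rightarrow> 'n)
    \<Rightarrow> ('m list \<Rightarrow> 'r) set \<Rightarrow> 'n" where
  "tlift2 R M N f = tlift_pow R M N 2 (\<lambda>w. f (w ! 0) (w ! 1))"

definition tproj :: "'r ring \<Rightarrow> ('r, 'm) gmodule \<Rightarrow> nat \<Rightarrow> ('m list \<Rightarrow> 'r) set \<Rightarrow> ('m list \<Rightarrow> 'r) set"
  where "tproj R M k = tlift_pow R M (TA R M) k (tens R M)"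

text \<open>
  Permutation of tensor factors with Koszul sign: the \<open>a\<close>-th factor of the result is factor \<open>p ! a\<close>
  (counted from 0) of the argument. The sum decomposes the factors into homogeneous components;
  the sign exponent is the sum of products of degrees over the pairs of factors that change order.
\<close>

definition koszul_perm :: "'r ring \<Rightarrow> ('r, 'm) gmodule \<Rightarrow> nat list
    \<Rightarrow> ('m list \<Rightarrow> 'r) set \<Rightarrow> ('m list \<Rightarrow> 'r) set" where
  "koszul_perm R M p = tlift_pow R M (TA R M) (length p) (\<lambda>w.
     \<Oplus>\<^bsub>TA R M\<^esub> ds\<in>{ds. length ds = length w \<and> (\<forall>i<length w. hcomp M (ds ! i) (w ! i) \<noteq> \<zero>\<^bsub>M\<^esub>)}.
       sg (TA R M) (\<Sum>(i, j)\<in>{(i, j). i < j \<and> j < length p \<and> p ! j < p ! i}. ds ! (p ! i) * ds ! (p ! j))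
         (tens R M (map (\<lambda>i. hcomp M (ds ! i) (w ! i)) p)))"


section \<open>DG algebras, coalgebras and bialgebras\<close>

locale dg_algebra = graded_module R A + ring A
  for R :: "'r ring" and A :: "('r, 'a) gmodule" +
  fixes d :: "'a \<Rightarrow> 'a"
  assumes smult_mult_l: "\<lbrakk>r \<in> carrier R; x \<in> carrier A; y \<in> carrier A\<rbrakk>
      \<Longrightarrow> (r \<odot>\<^bsub>A\<^esub> x) \<otimes>\<^bsub>A\<^esub> y = r \<odot>\<^bsub>A\<^esub> (x \<otimes>\<^bsub>A\<^esub> y)"
    and smult_mult_r: "\<lbrakk>r \<in> carrier R; x \<in> carrier A; y \<in> carrier A\<rbrakk>
      \<Longrightarrow> x \<otimes>\<^bsub>A\<^esub> (r \<odot>\<^bsub>A\<^esub> y) = r \<odot>\<^bsub>A\<^esub> (x \<otimes>\<^bsub>A\<^esub> y)"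
    and one_degree: "\<one>\<^bsub>A\<^esub> \<in> gpart A 0"
    and mult_degree: "\<lbrakk>x \<in> gpart A m; y \<in> gpart A n\<rbrakk> \<Longrightarrow> x \<otimes>\<^bsub>A\<^esub> y \<in> gpart A (m + n)"
    and d_degree: "d \<in> deg_map R A A (-1)"
    and d_d: "x \<in> carrier A \<Longrightarrow> d (d x) = \<zero>\<^bsub>A\<^esub>"
    and derivation: "\<lbrakk>x \<in> carrier A; y \<in> carrier A\<rbrakk>
      \<Longrightarrow> d (x \<otimes>\<^bsub>A\<^esub> y) = d x \<otimes>\<^bsub>A\<^esub> y \<oplus>\<^bsub>A\<^esub> sgn_inv A x \<otimes>\<^bsub>A\<^esub> d y"

text \<open>
  The coproduct takes values in the second tensor power inside \<open>T(C)\<close>; both sides of coassociativity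
  live in the third one.
\<close>

locale dg_coalgebra = graded_module R C
  for R :: "'r ring" and C :: "('r, 'c) gmodule" +
  fixes d :: "'c \<Rightarrow> 'c" and \<Delta> :: "'c \<Rightarrow> ('c list \<Rightarrow> 'r) set" and \<epsilon> :: "'c \<Rightarrow> 'r"
  assumes d_degree: "d \<in> deg_map R C C (-1)"
    and d_d: "x \<in> carrier C \<Longrightarrow> d (d x) = \<zero>\<^bsub>C\<^esub>"
    and coproduct_degree: "\<Delta> \<in> deg_map R C (TA R C) 0"
    and coproduct_tensor: "x \<in> carrier C \<Longrightarrow> \<Delta> x \<in> tpow R C 2"
    and coproduct_d: "x \<in> carrier C \<Longrightarrow> \<Delta> (d x) =
      tlift2 R C (TA R C) (\<lambda>a b. tens R C [d a, b] \<oplus>\<^bsub>TA R C\<^esub> tens R C [sgn_inv C a, d b]) (\<Delta> x)"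
    and coassoc: "x \<in> carrier C \<Longrightarrow>
      tlift2 R C (TA R C) (\<lambda>a b. \<Delta> a \<otimes>\<^bsub>TA R C\<^esub> tens R C [b]) (\<Delta> x) =
      tlift2 R C (TA R C) (\<lambda>a b. tens R C [a] \<otimes>\<^bsub>TA R C\<^esub> \<Delta> b) (\<Delta> x)"
    and counit_degree: "\<epsilon> \<in> deg_map R C (ground R) 0"
    and counit_d: "x \<in> carrier C \<Longrightarrow> \<epsilon> (d x) = \<zero>\<^bsub>R\<^esub>"
    and counit_l: "x \<in> carrier C \<Longrightarrow> tlift2 R C C (\<lambda>a b. \<epsilon> a \<odot>\<^bsub>C\<^esub> b) (\<Delta> x) = x"
    and counit_r: "x \<in> carrier C \<Longrightarrow> tlift2 R C C (\<lambda>a b. \<epsilon> b \<odot>\<^bsub>C\<^esub> a) (\<Delta> x) = x"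

text \<open>The product \<open>(\<mu> \<otimes> \<mu>)(1 \<otimes> \<tau> \<otimes> 1)\<close> of \<open>A \<otimes> A\<close> for a graded algebra \<open>A\<close>.\<close>

definition tsquare_mult :: "'r ring \<Rightarrow> ('r, 'a) gmodule
    \<Rightarrow> ('a list \<Rightarrow> 'r) set \<Rightarrow> ('a list \<Rightarrow> 'r) set \<Rightarrow> ('a list \<Rightarrow> 'r) set" where
  "tsquare_mult R A X Y =
     tlift_pow R A (TA R A) 4 (\<lambda>w. tens R A [w ! 0 \<otimes>\<^bsub>A\<^esub> w ! 1, w ! 2 \<otimes>\<^bsub>A\<^esub> w ! 3])
       (koszul_perm R A [0, 2, 1, 3] (X \<otimes>\<^bsub>TA R A\<^esub> Y))"

locale dg_bialgebra = dg_algebra R A d + dg_coalgebra R A d \<Delta> \<epsilon>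
  for R :: "'r ring" and A :: "('r, 'a) gmodule" and d :: "'a \<Rightarrow> 'a"
    and \<Delta> :: "'a \<Rightarrow> ('a list \<Rightarrow> 'r) set" and \<epsilon> :: "'a \<Rightarrow> 'r" +
  assumes coproduct_one: "\<Delta> \<one>\<^bsub>A\<^esub> = tens R A [\<one>\<^bsub>A\<^esub>, \<one>\<^bsub>A\<^esub>]"
    and coproduct_mult: "\<lbrakk>x \<in> carrier A; y \<in> carrier A\<rbrakk>
      \<Longrightarrow> \<Delta> (x \<otimes>\<^bsub>A\<^esub> y) = tsquare_mult R A (\<Delta> x) (\<Delta> y)"
    and counit_one: "\<epsilon> \<one>\<^bsub>A\<^esub> = \<one>\<^bsub>R\<^esub>"
    and counit_mult: "\<lbrakk>x \<in> carrier A; y \<in> carrier A\<rbrakk> \<Longrightarrow> \<epsilon> (x \<otimes>\<^bsub>A\<^esub> y) = \<epsilon> x \<otimes>\<^bsub>R\<^esub> \<epsilon> y"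

text \<open>The coaugmentation \<open>R \<rightarrow> C\<close> is given by the image \<open>u\<close> of \<open>1\<close>.\<close>

locale one_reduced_dg_coalgebra = dg_coalgebra R C d \<Delta> \<epsilon>
  for R :: "'r ring" and C :: "('r, 'c) gmodule" and d :: "'c \<Rightarrow> 'c"
    and \<Delta> :: "'c \<Rightarrow> ('c list \<Rightarrow> 'r) set" and \<epsilon> :: "'c \<Rightarrow> 'r" +
  fixes u :: 'c
  assumes coaug_degree: "u \<in> gpart C 0"
    and coaug_coproduct: "\<Delta> u = tens R C [u, u]"
    and coaug_counit: "\<epsilon> u = \<one>\<^bsub>R\<^esub>"
    and coaug_d: "d u = \<zero>\<^bsub>C\<^esub>"
    and neg_zero: "n < 0 \<Longrightarrow> gpart C n = {\<zero>\<^bsub>C\<^esub>}"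
    and degree_zero: "\<exists>\<phi>\<in>lin_map R (ground R) (C\<lparr>carrier := gpart C 0\<rparr>).
      bij_betw \<phi> (carrier R) (gpart C 0)"
    and degree_one: "gpart C 1 = {\<zero>\<^bsub>C\<^esub>}"


section \<open>The cobar construction\<close>

text \<open>
  The desuspension of the kernel of the counit, with the same elements as the kernel: the map
  \<open>s\<^bsup>-1\<^esup>\<close> is the identity on elements and shifts the grading.
\<close>

definition desusp :: "'r ring \<Rightarrow> ('r, 'c) gmodule \<Rightarrow> ('c \<Rightarrow> 'r) \<Rightarrow> ('r, 'c) gmodule" where
  "desusp R C \<epsilon> = C\<lparr>carrier := {x \<in> carrier C. \<epsilon> x = \<zero>\<^bsub>R\<^esub>},
     gpart := (\<lambda>n. {x \<in> gpart C (n + 1). \<epsilon> x = \<zero>\<^bsub>R\<^esub>})\<rparr>"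

definition reduced_coproduct :: "'r ring \<Rightarrow> ('r, 'c) gmodule \<Rightarrow> ('c \<Rightarrow> ('c list \<Rightarrow> 'r) set) \<Rightarrow> 'c
    \<Rightarrow> 'c \<Rightarrow> ('c list \<Rightarrow> 'r) set" where
  "reduced_coproduct R C \<Delta> u c =
     (\<Delta> c \<ominus>\<^bsub>TA R C\<^esub> tens R C [c, u]) \<ominus>\<^bsub>TA R C\<^esub> tens R C [u, c]"

text \<open>
  The reduced coproduct is formed in \<open>C \<otimes> C\<close>. The kernel of the counit is a direct summand of \<open>C\<close>
  with projection \<open>a \<mapsto> a - \<epsilon>(a) u\<close>, and the tensor square of this projection is the identity on the
  tensor square of the kernel; it is used to read the reduced coproduct as an element of the latter.
  The operator \<^const>\<open>sgn_inv\<close> is the sign in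
  \<open>(s\<^bsup>-1\<^esup> \<otimes> s\<^bsup>-1\<^esup>)(a \<otimes> b) = (-1)\<^bsup>|a|\<^esup> s\<^bsup>-1\<^esup>a \<otimes> s\<^bsup>-1\<^esup>b\<close>, with \<open>|a|\<close> the degree in \<open>C\<close>.
\<close>

definition cobar_gen_d :: "'r ring \<Rightarrow> ('r, 'c) gmodule \<Rightarrow> ('c \<Rightarrow> 'c) \<Rightarrow> ('c \<Rightarrow> ('c list \<Rightarrow> 'r) set)
    \<Rightarrow> ('c \<Rightarrow> 'r) \<Rightarrow> 'c \<Rightarrow> 'c \<Rightarrow> ('c list \<Rightarrow> 'r) set" where
  "cobar_gen_d R C d \<Delta> \<epsilon> u c =
     (let V = desusp R C \<epsilon>; pr = (\<lambda>a. a \<ominus>\<^bsub>C\<^esub> (\<epsilon> a \<odot>\<^bsub>C\<^esub> u)) in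
       (\<ominus>\<^bsub>TA R V\<^esub> tens R V [d c]) \<oplus>\<^bsub>TA R V\<^esub>
       tlift2 R C (TA R V) (\<lambda>a b. tens R V [pr (sgn_inv C a), pr b]) (reduced_coproduct R C \<Delta> u c))"

text \<open>The extension to a derivation:
  \<open>d(v\<^sub>1 \<dots> v\<^sub>n) = \<Sum>\<^sub>i (-1)\<^bsup>|v\<^sub>1| + \<dots> + |v\<^sub>i\<^sub>-\<^sub>1|\<^esup> v\<^sub>1 \<dots> d(v\<^sub>i) \<dots> v\<^sub>n\<close>.\<close>

definition cobar_d :: "'r ring \<Rightarrow> ('r, 'c) gmodule \<Rightarrow> ('c \<Rightarrow> 'c) \<Rightarrow> ('c \<Rightarrow> ('c list \<Rightarrow> 'r) set)
    \<Rightarrow> ('c \<Rightarrow> 'r) \<Rightarrow> 'c \<Rightarrow> ('c list \<Rightarrow> 'r) set \<Rightarrow> ('c list \<Rightarrow> 'r) set" where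
  "cobar_d R C d \<Delta> \<epsilon> u = (let V = desusp R C \<epsilon> in
     tlift R V (TA R V) (\<lambda>w. \<Oplus>\<^bsub>TA R V\<^esub> i\<in>{..<length w}.
       tens R V (map (sgn_inv V) (take i w)) \<otimes>\<^bsub>TA R V\<^esub> cobar_gen_d R C d \<Delta> \<epsilon> u (w ! i)
         \<otimes>\<^bsub>TA R V\<^esub> tens R V (drop (Suc i) w)))"


section \<open>Homotopy G-coalgebras\<close>

text \<open>
  The component \<open>E\<^bsup>i,j\<^esup>\<close> of the restriction to \<open>V\<close> of a coproduct \<open>\<nabla>\<close> on \<open>T(V)\<close>, with
  \<open>V\<^bsup>\<otimes>i\<^esup> \<otimes> V\<^bsup>\<otimes>j\<^esup>\<close> identified with \<open>V\<^bsup>\<otimes>(i+j)\<^esup>\<close> by concatenation.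
\<close>

definition Ecomp :: "'r ring \<Rightarrow> ('r, 'v) gmodule
    \<Rightarrow> (('v list \<Rightarrow> 'r) set \<Rightarrow> (('v list \<Rightarrow> 'r) set list \<Rightarrow> 'r) set)
    \<Rightarrow> nat \<Rightarrow> nat \<Rightarrow> 'v \<Rightarrow> ('v list \<Rightarrow> 'r) set" where
  "Ecomp R V nabla i j x =
     tlift2 R (TA R V) (TA R V) (\<lambda>a b. tproj R V i a \<otimes>\<^bsub>TA R V\<^esub> tproj R V j b) (nabla (tens R V [x]))"

locale homotopy_G_coalgebra = one_reduced_dg_coalgebra R C d \<Delta> \<epsilon> u
  for R :: "'r ring" and C :: "('r, 'c) gmodule" and d :: "'c \<Rightarrow> 'c"
    and \<Delta> :: "'c \<Rightarrow> ('c list \<Rightarrow> 'r) set" and \<epsilon> :: "'c \<Rightarrow> 'r" and u :: 'c +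
  fixes nabla :: "('c list \<Rightarrow> 'r) set \<Rightarrow> (('c list \<Rightarrow> 'r) set list \<Rightarrow> 'r) set"
  assumes cobar_bialgebra:
      "\<exists>\<eta>. dg_bialgebra R (TA R (desusp R C \<epsilon>)) (cobar_d R C d \<Delta> \<epsilon> u) nabla \<eta>"
    and E_vanish: "\<lbrakk>1 \<le> i; 2 \<le> j; x \<in> carrier (desusp R C \<epsilon>)\<rbrakk>
      \<Longrightarrow> Ecomp R (desusp R C \<epsilon>) nabla i j x = \<zero>\<^bsub>TA R (desusp R C \<epsilon>)\<^esub>"


section \<open>The obstructions\<close>

text \<open>Families \<open>E k :: V \<rightarrow> V\<^bsup>\<otimes>(k+1)\<^esup>\<close> stand for \<open>E\<^bsup>k,1\<^esup>\<close>. They have degree 0, hence so do the maps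
  \<open>F\<^sup>n\<close>, and no signs arise when tensor products of these maps are evaluated.\<close>

definition compositions :: "nat \<Rightarrow> nat \<Rightarrow> nat list set" where
  "compositions s n = {ns. length ns = s \<and> sum_list ns = n \<and> (\<forall>k\<in>set ns. 1 \<le> k)}"

text \<open>\<open>1\<^bsup>\<otimes>m\<^esup> \<otimes> f\<close> on \<open>V\<^bsup>\<otimes>(m+1)\<^esup>\<close>\<close>

definition id_tensor :: "'r ring \<Rightarrow> ('r, 'v) gmodule \<Rightarrow> nat \<Rightarrow> ('v \<Rightarrow> ('v list \<Rightarrow> 'r) set)
    \<Rightarrow> ('v list \<Rightarrow> 'r) set \<Rightarrow> ('v list \<Rightarrow> 'r) set" where
  "id_tensor R V m f =
     tlift_pow R V (TA R V) (Suc m) (\<lambda>w. tens R V (take m w) \<otimes>\<^bsub>TA R V\<^esub> f (w ! m))"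

text \<open>\<open>E_chain R V E m [k\<^sub>1, \<dots>, k\<^sub>s]\<close> applies first \<open>1\<^bsup>\<otimes>m\<^esup> \<otimes> E k\<^sub>1\<close>, then
  \<open>1\<^bsup>\<otimes>(m+k\<^sub>1)\<^esup> \<otimes> E k\<^sub>2\<close>, and so on.\<close>

fun E_chain :: "'r ring \<Rightarrow> ('r, 'v) gmodule \<Rightarrow> (nat \<Rightarrow> 'v \<Rightarrow> ('v list \<Rightarrow> 'r) set) \<Rightarrow> nat \<Rightarrow> nat list
    \<Rightarrow> ('v list \<Rightarrow> 'r) set \<Rightarrow> ('v list \<Rightarrow> 'r) set" where
  "E_chain R V E m [] X = X"
| "E_chain R V E m (k # ks) X = E_chain R V E (m + k) ks (id_tensor R V m (E k) X)"

definition Fmap :: "'r ring \<Rightarrow> ('r, 'v) gmodule \<Rightarrow> (nat \<Rightarrow> 'v \<Rightarrow> ('v list \<Rightarrow> 'r) set)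
    \<Rightarrow> nat \<Rightarrow> 'v \<Rightarrow> ('v list \<Rightarrow> 'r) set" where
  "Fmap R V E n x =
     (if n = 1 then \<ominus>\<^bsub>TA R V\<^esub> tens R V [x]
      else \<Oplus>\<^bsub>TA R V\<^esub> s\<in>{1..n - 1}. \<Oplus>\<^bsub>TA R V\<^esub> ns\<in>compositions s (n - 1).
        sg (TA R V) (int s + 1) (E_chain R V E 0 ns (tens R V [x])))"

definition tensor_maps :: "'r ring \<Rightarrow> ('r, 'v) gmodule \<Rightarrow> ('v \<Rightarrow> ('v list \<Rightarrow> 'r) set) list
    \<Rightarrow> ('v list \<Rightarrow> 'r) set \<Rightarrow> ('v list \<Rightarrow> 'r) set" where
  "tensor_maps R V fs = tlift_pow R V (TA R V) (length fs)
     (\<lambda>w. foldr (mult (TA R V)) (map2 (\<lambda>f v. f v) fs w) \<one>\<^bsub>TA R V\<^esub>)"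

fun blocks :: "nat list \<Rightarrow> 'a list \<Rightarrow> 'a list list" where
  "blocks [] xs = []"
| "blocks (n # ns) xs = take n xs # blocks ns (drop n xs)"

definition block_reversal :: "'r ring \<Rightarrow> ('r, 'v) gmodule \<Rightarrow> nat list
    \<Rightarrow> ('v list \<Rightarrow> 'r) set \<Rightarrow> ('v list \<Rightarrow> 'r) set" where
  "block_reversal R V ns = koszul_perm R V (concat (rev (blocks ns [0..<sum_list ns])))"

definition obstruction :: "'r ring \<Rightarrow> ('r, 'v) gmodule \<Rightarrow> (nat \<Rightarrow> 'v \<Rightarrow> ('v list \<Rightarrow> 'r) set)
    \<Rightarrow> nat \<Rightarrow> 'v \<Rightarrow> ('v list \<Rightarrow> 'r) set" where
  "obstruction R V E n x =
     (\<Oplus>\<^bsub>TA R V\<^esub> s\<in>{1..n}. \<Oplus>\<^bsub>TA R V\<^esub> ns\<in>compositions s n.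
        block_reversal R V ns (tensor_maps R V (map (Fmap R V E) ns) (Fmap R V E s x)))"

end

theory Submission
  imports Defs
begin

text \<open>
  Write \<open>e = E\<^sup>1\<^sup>,\<^sup>1\<close>. Comparing the components in \<open>V \<otimes> V \<otimes> V\<close> of the two sides of coassociativity of
  \<open>\<nabla>\<close> on a generator shows that \<open>e\<close> is coassociative, because \<open>\<nabla> 1 = 1 \<otimes> 1\<close> and
  \<open>E\<^sup>k\<^sup>,\<^sup>1 = E\<^sup>1\<^sup>,\<^sup>k = 0\<close> for \<open>k \<ge> 2\<close>. Hence \<open>F\<^sup>n = (-1)\<^sup>n e\<^sup>(\<^sup>n\<^sup>)\<close> with \<open>e\<^sup>(\<^sup>n\<^sup>)\<close> the iterated coproduct, and
  \<open>(e\<^sup>(\<^sup>n\<^sub>1\<^sup>) \<otimes> \<dots> \<otimes> e\<^sup>(\<^sup>n\<^sub>s\<^sup>)) e\<^sup>(\<^sup>s\<^sup>) = e\<^sup>(\<^sup>n\<^sup>)\<close>. If \<open>e\<close> is also cocommutative, then \<open>e\<^sup>(\<^sup>n\<^sup>)\<close> is fixed by all block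
  reversals, so \<open>O\<^sub>n\<close> is \<open>e\<^sup>(\<^sup>n\<^sup>)\<close> times the sum of \<open>(-1)\<^sup>n\<^sup>+\<^sup>s\<close> over the compositions of \<open>n\<close> into \<open>s\<close> parts, an
  alternating sum of binomial coefficients, which vanishes for \<open>n \<ge> 2\<close>.
\<close>

section \<open>Linear maps and spans\<close>

text \<open>Projecting all three factors of coassociativity onto V leaves, on one side,
  \<open>nabla11\<close> \<otimes> 1 applied to those terms of \<nabla>x whose right factor lies in
  V. Their left factors have arbitrary word length k, and the term of length k is E^(k,1)(x). For k
  = 0 it dies because 1 \<otimes> 1 has no component in V \<otimes> V, for k >= 2 it is zero, and k
  = 1 gives e. So \<nabla> is only ever evaluated on generators and on 1. Invariance under block
  reversals is an induction on the number of blocks. The first block moves behind the others, each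
  of its factors crossing each of theirs, so the Koszul sign is (-1)^(ab) with a and b the total
  degrees of the two parts. Since e has degree 0, this is the sign of exchanging the two factors of
  e in (e^(n) \<otimes> e^(m)) e, and the single identity \<tau>e = e absorbs it. Signs depend on
  degrees, so these identities are checked on spans of homogeneous elementary tensors.\<close>

definition linear_maps ::
  "('r, 'x) ring_scheme \<Rightarrow> ('r, 'm, 'y) module_scheme \<Rightarrow> ('r, 'n, 'z) module_scheme \<Rightarrow> ('m \<Rightarrow> 'n) set" where
  "linear_maps R M N = {f \<in> carrier M \<rightarrow> carrier N.
     (\<forall>x\<in>carrier M. \<forall>y\<in>carrier M. f (x \<oplus>\<^bsub>M\<^esub> y) = f x \<oplus>\<^bsub>N\<^esub> f y) \<and>
     (\<forall>r\<in>carrier R. \<forall>x\<in>carrier M. f (r \<odot>\<^bsub>M\<^esub> x) = r \<odot>\<^bsub>N\<^esub> f x)}"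

text \<open>\<open>linear_maps\<close> repeats \<open>lin_map\<close> with scheme types, because the
  free algebra is a plain \<open>module\<close> record without a grading and also occurs as source
  and target of linear maps.\<close>

lemma lin_map_eq_linear_maps: "lin_map R M N = linear_maps R M N"
  by (simp add: lin_map_def linear_maps_def)

lemma linear_mapsI:
  assumes "\<And>x. x \<in> carrier M \<Longrightarrow> f x \<in> carrier N"
    and "\<And>x y. \<lbrakk>x \<in> carrier M; y \<in> carrier M\<rbrakk> \<Longrightarrow> f (x \<oplus>\<^bsub>M\<^esub> y) = f x \<oplus>\<^bsub>N\<^esub> f y"
    and "\<And>r x. \<lbrakk>r \<in> carrier R; x \<in> carrier M\<rbrakk> \<Longrightarrow> f (r \<odot>\<^bsub>M\<^esub> x) = r \<odot>\<^bsub>N\<^esub> f x"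
  shows "f \<in> linear_maps R M N"
  using assms by (auto simp: linear_maps_def)

lemma linear_maps_closed: "\<lbrakk>f \<in> linear_maps R M N; x \<in> carrier M\<rbrakk> \<Longrightarrow> f x \<in> carrier N"
  by (auto simp: linear_maps_def)

lemma linear_maps_add:
  "\<lbrakk>f \<in> linear_maps R M N; x \<in> carrier M; y \<in> carrier M\<rbrakk> \<Longrightarrow> f (x \<oplus>\<^bsub>M\<^esub> y) = f x \<oplus>\<^bsub>N\<^esub> f y"
  by (auto simp: linear_maps_def)

lemma linear_maps_smult:
  "\<lbrakk>f \<in> linear_maps R M N; r \<in> carrier R; x \<in> carrier M\<rbrakk> \<Longrightarrow> f (r \<odot>\<^bsub>M\<^esub> x) = r \<odot>\<^bsub>N\<^esub> f x"
  by (auto simp: linear_maps_def)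

lemma linear_maps_zero:
  assumes "module R M" "module R N" "f \<in> linear_maps R M N"
  shows "f \<zero>\<^bsub>M\<^esub> = \<zero>\<^bsub>N\<^esub>"
proof -
  interpret M: module R M by fact
  interpret N: module R N by fact
  have "f (\<zero>\<^bsub>R\<^esub> \<odot>\<^bsub>M\<^esub> \<zero>\<^bsub>M\<^esub>) = \<zero>\<^bsub>R\<^esub> \<odot>\<^bsub>N\<^esub> f \<zero>\<^bsub>M\<^esub>"
    by (rule linear_maps_smult[OF assms(3)]) auto
  then show ?thesis using linear_maps_closed[OF assms(3) M.zero_closed] by simp
qed

lemma linear_maps_finsum:
  assumes "module R M" "module R N" "f \<in> linear_maps R M N" "g \<in> A \<rightarrow> carrier M"
  shows "f (\<Oplus>\<^bsub>M\<^esub> i\<in>A. g i) = (\<Oplus>\<^bsub>N\<^esub> i\<in>A. f (g i))"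
proof -
  interpret M: module R M by fact
  interpret N: module R N by fact
  show ?thesis using assms(4)
  proof (induction A rule: infinite_finite_induct)
    \<comment> \<open>Both sums over an infinite index set are zero by convention.\<close>
    case (infinite A)
    then show ?case by (simp add: linear_maps_zero[OF assms(1-3)])
  next
    case empty
    then show ?case by (simp add: linear_maps_zero[OF assms(1-3)])
  next
    case (insert x F)
    have "g \<in> F \<rightarrow> carrier M" "g x \<in> carrier M" using insert.prems by auto
    then have "f (\<Oplus>\<^bsub>M\<^esub> i\<in>insert x F. g i) = f (g x) \<oplus>\<^bsub>N\<^esub> f (\<Oplus>\<^bsub>M\<^esub> i\<in>F. g i)"
      using insert.hyps by (simp add: linear_maps_add[OF assms(3)])
    also have "\<dots> = (\<Oplus>\<^bsub>N\<^esub> i\<in>insert x F. f (g i))"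
      using insert \<open>g \<in> F \<rightarrow> carrier M\<close> \<open>g x \<in> carrier M\<close>
      by (subst N.finsum_insert) (auto intro: linear_maps_closed[OF assms(3)])
    finally show ?case .
  qed
qed

lemma linear_maps_a_inv:
  assumes "module R M" "module R N" "f \<in> linear_maps R M N" "x \<in> carrier M"
  shows "f (\<ominus>\<^bsub>M\<^esub> x) = \<ominus>\<^bsub>N\<^esub> f x"
proof -
  interpret M: module R M by fact
  interpret N: module R N by fact
  have "f (\<ominus>\<^bsub>M\<^esub> x) \<oplus>\<^bsub>N\<^esub> f x = \<zero>\<^bsub>N\<^esub>"
    using linear_maps_add[OF assms(3), of "\<ominus>\<^bsub>M\<^esub> x" x] assms
    by (simp add: M.l_neg linear_maps_zero[OF assms(1-3)])
  then show ?thesis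
    using assms by (metis N.minus_equality M.a_inv_closed linear_maps_closed)
qed

lemma linear_maps_sg:
  assumes "module R M" "module R N" "f \<in> linear_maps R M N" "x \<in> carrier M"
  shows "f (sg M k x) = sg N k (f x)"
  using assms by (simp add: sg_def linear_maps_a_inv)

lemma linear_maps_comp:
  "\<lbrakk>f \<in> linear_maps R M N; g \<in> linear_maps R N P\<rbrakk> \<Longrightarrow> (\<lambda>x. g (f x)) \<in> linear_maps R M P"
  by (auto simp: linear_maps_def Pi_iff)

lemma linear_maps_id: "(\<lambda>x. x) \<in> linear_maps R M M"
  by (auto simp: linear_maps_def)

lemma linear_maps_const_zero: "module R N \<Longrightarrow> (\<lambda>x. \<zero>\<^bsub>N\<^esub>) \<in> linear_maps R M N"
  by (auto simp: linear_maps_def module.smult_r_null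
      dest: abelian_group.axioms(1)[OF module.axioms(2)] intro: abelian_monoid.zero_closed
      abelian_monoid.l_zero[symmetric])

lemma linear_maps_finsum_fun:
  assumes "module R N" "\<And>i. i \<in> A \<Longrightarrow> f i \<in> linear_maps R M N"
  shows "(\<lambda>x. \<Oplus>\<^bsub>N\<^esub> i\<in>A. f i x) \<in> linear_maps R M N"
proof -
  interpret N: module R N by fact
  show ?thesis
  proof (cases "finite A")
    case False
    then show ?thesis by (simp add: linear_maps_const_zero[OF assms(1)])
  next
    case True
    show ?thesis
    proof (rule linear_mapsI)
      fix x assume x: "x \<in> carrier M"
      then show "(\<Oplus>\<^bsub>N\<^esub> i\<in>A. f i x) \<in> carrier N"
        by (intro N.finsum_closed) (auto intro: linear_maps_closed[OF assms(2)])
      fix y assume y: "y \<in> carrier M"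
      have "(\<Oplus>\<^bsub>N\<^esub> i\<in>A. f i (x \<oplus>\<^bsub>M\<^esub> y)) = (\<Oplus>\<^bsub>N\<^esub> i\<in>A. f i x \<oplus>\<^bsub>N\<^esub> f i y)"
        using x y by (intro N.finsum_cong') (auto intro: linear_maps_closed[OF assms(2)]
            linear_maps_add[OF assms(2)])
      then show "(\<Oplus>\<^bsub>N\<^esub> i\<in>A. f i (x \<oplus>\<^bsub>M\<^esub> y)) = (\<Oplus>\<^bsub>N\<^esub> i\<in>A. f i x) \<oplus>\<^bsub>N\<^esub> (\<Oplus>\<^bsub>N\<^esub> i\<in>A. f i y)"
        using x y by (simp add: N.finsum_addf linear_maps_closed[OF assms(2)])
    next
      fix r x assume r: "r \<in> carrier R" and x: "x \<in> carrier M"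
      have "(\<Oplus>\<^bsub>N\<^esub> i\<in>A. f i (r \<odot>\<^bsub>M\<^esub> x)) = (\<Oplus>\<^bsub>N\<^esub> i\<in>A. r \<odot>\<^bsub>N\<^esub> f i x)"
        using r x by (intro N.finsum_cong') (auto intro: linear_maps_closed[OF assms(2)]
            linear_maps_smult[OF assms(2)])
      then show "(\<Oplus>\<^bsub>N\<^esub> i\<in>A. f i (r \<odot>\<^bsub>M\<^esub> x)) = r \<odot>\<^bsub>N\<^esub> (\<Oplus>\<^bsub>N\<^esub> i\<in>A. f i x)"
        using r x True by (subst N.finsum_smult_ldistr)
          (auto intro: linear_maps_closed[OF assms(2)])
    qed
  qed
qed

section \<open>Linear spans and linear maps determined on a spanning set\<close>

inductive_set lspan :: "('r, 'x) ring_scheme \<Rightarrow> ('r, 'm, 'z) module_scheme \<Rightarrow> 'm set \<Rightarrow> 'm set" for R M S where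
  zero: "\<zero>\<^bsub>M\<^esub> \<in> lspan R M S"
| step: "\<lbrakk>r \<in> carrier R; s \<in> S; x \<in> lspan R M S\<rbrakk> \<Longrightarrow> r \<odot>\<^bsub>M\<^esub> s \<oplus>\<^bsub>M\<^esub> x \<in> lspan R M S"

context module
begin

lemma lspan_closed:
  assumes "x \<in> lspan R M S" "S \<subseteq> carrier M"
  shows "x \<in> carrier M"
  using assms by (induction rule: lspan.induct) auto

lemma lspan_base: "\<lbrakk>s \<in> S; S \<subseteq> carrier M\<rbrakk> \<Longrightarrow> s \<in> lspan R M S"
  using lspan.step[OF R.one_closed _ lspan.zero, of s S M] by (auto simp: subset_iff)

lemma lspan_add:
  assumes "x \<in> lspan R M S" "y \<in> lspan R M S" "S \<subseteq> carrier M"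
  shows "x \<oplus>\<^bsub>M\<^esub> y \<in> lspan R M S"
  using assms(1)
proof induction
  case zero
  then show ?case using assms(2,3) lspan_closed by simp
next
  case (step r s x)
  then show ?case using lspan.step[OF step(1,2) step(4)] assms lspan_closed[OF step(3)]
      lspan_closed[OF assms(2)] by (subst M.a_assoc) auto
qed

lemma lspan_smult:
  assumes "x \<in> lspan R M S" "r \<in> carrier R" "S \<subseteq> carrier M"
  shows "r \<odot>\<^bsub>M\<^esub> x \<in> lspan R M S"
  using assms(1)
proof induction
  case zero
  then show ?case using assms lspan.zero by simp
next
  case (step q s x)
  then show ?case using lspan.step[OF _ step(2) step(4), of "r \<otimes> q"] assms lspan_closed[OF step(3)]
    by (auto simp: smult_r_distr smult_assoc1 subset_iff)
qed

lemma lspan_finsum: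
  assumes "\<And>i. i \<in> A \<Longrightarrow> g i \<in> lspan R M S" "S \<subseteq> carrier M"
  shows "(\<Oplus>\<^bsub>M\<^esub> i\<in>A. g i) \<in> lspan R M S"
  using assms(1)
proof (induction A rule: infinite_finite_induct)
  case (insert x F)
  then have "(\<Oplus>\<^bsub>M\<^esub> i\<in>insert x F. g i) = g x \<oplus>\<^bsub>M\<^esub> (\<Oplus>\<^bsub>M\<^esub> i\<in>F. g i)"
    using lspan_closed[OF _ assms(2)] by (subst M.finsum_insert) auto
  then show ?case using insert by (auto intro!: lspan_add assms(2))
qed (use lspan.zero in auto)

end

lemma linear_maps_eq_on_lspan:
  assumes "module R M" "module R N" "f \<in> linear_maps R M N" "g \<in> linear_maps R M N"
    and "S \<subseteq> carrier M" "\<And>s. s \<in> S \<Longrightarrow> f s = g s" "x \<in> lspan R M S"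
  shows "f x = g x"
proof -
  interpret M: module R M by fact
  show ?thesis using assms(7)
  proof induction
    case zero
    then show ?case using linear_maps_zero assms(1-4) by metis
  next
    case (step r s x)
    then show ?case
      using assms(5,6) M.lspan_closed[OF step(3) assms(5)]
      by (auto simp: linear_maps_add[OF assms(3)] linear_maps_add[OF assms(4)]
        linear_maps_smult[OF assms(3)] linear_maps_smult[OF assms(4)] subset_iff)
  qed
qed

text \<open>This is how gradings are propagated: with sets of homogeneous tensors for
  \<open>S\<close> and \<open>S'\<close> it says that a map respects degree and word length.\<close>

lemma linear_maps_lspan:
  assumes "module R M" "module R N" "f \<in> linear_maps R M N" "S \<subseteq> carrier M"
    and "\<And>s. s \<in> S \<Longrightarrow> f s \<in> lspan R N S'" "S' \<subseteq> carrier N" "x \<in> lspan R M S"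
  shows "f x \<in> lspan R N S'"
proof -
  interpret M: module R M by fact
  interpret N: module R N by fact
  show ?thesis using assms(7)
  proof induction
    case zero
    then show ?case using linear_maps_zero[OF assms(1-3)] lspan.zero by simp
  next
    case (step r s x)
    have "f (r \<odot>\<^bsub>M\<^esub> s \<oplus>\<^bsub>M\<^esub> x) = r \<odot>\<^bsub>N\<^esub> f s \<oplus>\<^bsub>N\<^esub> f x"
      using step assms(4) M.lspan_closed[OF step(3) assms(4)]
      by (auto simp: linear_maps_add[OF assms(3)] linear_maps_smult[OF assms(3)] subset_iff)
    then show ?case using step assms(5,6) by (simp add: N.lspan_add N.lspan_smult)
  qed
qed

section \<open>The free algebra\<close>

locale free_algebra = cring R for R :: "'r ring" (structure) +
  fixes S :: "'m set"
begin

abbreviation F where "F \<equiv> free_alg R S"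

lemma free_alg_carrier_iff:
  "p \<in> carrier F \<longleftrightarrow> (\<forall>w. p w \<in> carrier R) \<and> finite {w. p w \<noteq> \<zero>} \<and> {w. p w \<noteq> \<zero>} \<subseteq> lists S"
  by (simp add: free_alg_def)

lemma free_alg_carrierI:
  assumes "\<And>w. p w \<in> carrier R" "finite {w. p w \<noteq> \<zero>}" "\<And>w. p w \<noteq> \<zero> \<Longrightarrow> w \<in> lists S"
  shows "p \<in> carrier F"
  using assms by (auto simp: free_alg_carrier_iff)

lemma free_alg_coeff: "p \<in> carrier F \<Longrightarrow> p w \<in> carrier R"
  by (simp add: free_alg_carrier_iff)

lemma free_alg_finite: "p \<in> carrier F \<Longrightarrow> finite {w. p w \<noteq> \<zero>}"
  by (simp add: free_alg_carrier_iff)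

lemma free_alg_lists: "\<lbrakk>p \<in> carrier F; p w \<noteq> \<zero>\<rbrakk> \<Longrightarrow> w \<in> lists S"
  by (auto simp: free_alg_carrier_iff subset_iff)

lemma free_alg_ops:
  "\<zero>\<^bsub>F\<^esub> = (\<lambda>w. \<zero>)" "p \<oplus>\<^bsub>F\<^esub> q = (\<lambda>w. p w \<oplus> q w)" "r \<odot>\<^bsub>F\<^esub> p = (\<lambda>w. r \<otimes> p w)"
  "\<one>\<^bsub>F\<^esub> = word R []"
  by (simp_all add: free_alg_def word_def)

lemma free_alg_mult: "(p \<otimes>\<^bsub>F\<^esub> q) w = (\<Oplus>i\<in>{..length w}. p (take i w) \<otimes> q (drop i w))"
  by (simp add: free_alg_def)

lemma free_alg_module: "module R F"
proof (rule moduleI)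
  have fin: "finite {w. p w \<oplus> q w \<noteq> \<zero>}" if "p \<in> carrier F" "q \<in> carrier F" for p q
    by (rule finite_subset[of _ "{w. p w \<noteq> \<zero>} \<union> {w. q w \<noteq> \<zero>}"])
      (use that in \<open>auto simp: free_alg_carrier_iff\<close>)
  have add: "p \<oplus>\<^bsub>F\<^esub> q \<in> carrier F" if "p \<in> carrier F" "q \<in> carrier F" for p q
    unfolding free_alg_ops using that fin[OF that]
    by (intro free_alg_carrierI) (simp_all add: free_alg_coeff, metis free_alg_lists r_zero zero_closed)
  show "abelian_group F"
  proof (rule abelian_groupI)
    fix p assume p: "p \<in> carrier F"
    then have "{w. \<ominus> p w \<noteq> \<zero>} = {w. p w \<noteq> \<zero>}"
      by (auto simp: free_alg_coeff)
    then have "(\<lambda>w. \<ominus> p w) \<in> carrier F" using p by (auto simp: free_alg_carrier_iff)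
    moreover have "(\<lambda>w. \<ominus> p w) \<oplus>\<^bsub>F\<^esub> p = \<zero>\<^bsub>F\<^esub>"
      using p by (simp add: free_alg_ops free_alg_coeff l_neg)
    ultimately show "\<exists>y\<in>carrier F. y \<oplus>\<^bsub>F\<^esub> p = \<zero>\<^bsub>F\<^esub>" by blast
  next
    show "\<zero>\<^bsub>F\<^esub> \<in> carrier F" by (simp add: free_alg_carrier_iff free_alg_ops)
  next
    fix p q assume "p \<in> carrier F" "q \<in> carrier F"
    then show "p \<oplus>\<^bsub>F\<^esub> q \<in> carrier F" by (rule add)
  qed (auto simp: free_alg_ops free_alg_coeff a_ac)
next
  fix r p assume r: "r \<in> carrier R" and p: "p \<in> carrier F"
  have "finite {w. r \<otimes> p w \<noteq> \<zero>}"
    by (rule finite_subset[of _ "{w. p w \<noteq> \<zero>}"]) (use r p in \<open>auto simp: free_alg_carrier_iff\<close>)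
  then show "r \<odot>\<^bsub>F\<^esub> p \<in> carrier F"
    unfolding free_alg_ops using r p
    by (intro free_alg_carrierI) (simp_all add: free_alg_coeff, metis free_alg_lists r_null)
qed (auto simp: free_alg_ops free_alg_coeff l_distr r_distr m_assoc is_cring)

sublocale F: module R F
  by (rule free_alg_module)

lemma word_closed [simp]: "set w \<subseteq> S \<Longrightarrow> word R w \<in> carrier F"
  by (auto simp: free_alg_carrier_iff word_def)

text \<open>In the convolution only the cut of \<open>w\<close> after \<open>length u\<close>
  letters can contribute, and it does so exactly when \<open>w\<close> is the concatenation.\<close>

lemma word_mult_word: "word R u \<otimes>\<^bsub>F\<^esub> word R v = word R (u @ v)"
proof
  fix w
  have *: "word R u (take i w) \<otimes> word R v (drop i w) =
      (if length u = i then if w = u @ v then \<one> else \<zero> else \<zero>)" if "i \<le> length w" for i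
  proof -
    have "word R u (take i w) \<otimes> word R v (drop i w) =
        (if take i w = u \<and> drop i w = v then \<one> else \<zero>)"
      by (simp add: word_def)
    also have "take i w = u \<and> drop i w = v \<longleftrightarrow> i = length u \<and> w = u @ v"
      using that by auto
    finally show ?thesis by simp
  qed
  have "(word R u \<otimes>\<^bsub>F\<^esub> word R v) w =
      (\<Oplus>i\<in>{..length w}. if length u = i then if w = u @ v then \<one> else \<zero> else \<zero>)"
    unfolding free_alg_mult by (rule finsum_cong') (auto simp: *)
  also have "\<dots> = word R (u @ v) w"
  proof (cases "length u \<le> length w")
    case True
    then show ?thesis
      using finsum_singleton[of "length u" "{..length w}" "\<lambda>i. if w = u @ v then \<one> else \<zero>"]
      by (auto simp: word_def cong: if_cong)
  next
    case False
    then have "w \<noteq> u @ v" by auto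
    then show ?thesis by (simp add: word_def)
  qed
  finally show "(word R u \<otimes>\<^bsub>F\<^esub> word R v) w = word R (u @ v) w" .
qed

lemma free_alg_mult_closed: "\<lbrakk>p \<in> carrier F; q \<in> carrier F\<rbrakk> \<Longrightarrow> p \<otimes>\<^bsub>F\<^esub> q \<in> carrier F"
proof -
  assume p: "p \<in> carrier F" and q: "q \<in> carrier F"
  have ex: "\<exists>i. p (take i w) \<noteq> \<zero> \<and> q (drop i w) \<noteq> \<zero>" if "(p \<otimes>\<^bsub>F\<^esub> q) w \<noteq> \<zero>" for w
  proof (rule ccontr)
    assume "\<not> ?thesis"
    then have "p (take i w) \<otimes> q (drop i w) = \<zero>" for i
      using p q by (metis free_alg_coeff l_null r_null)
    then show False using that by (simp add: free_alg_mult)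
  qed
  \<comment> \<open>A word in the support of the product is a concatenation of words from the two
    supports, which gives finiteness.\<close>
  have "{w. (p \<otimes>\<^bsub>F\<^esub> q) w \<noteq> \<zero>} \<subseteq> (\<lambda>(u, v). u @ v) ` ({w. p w \<noteq> \<zero>} \<times> {w. q w \<noteq> \<zero>})"
  proof
    fix w assume "w \<in> {w. (p \<otimes>\<^bsub>F\<^esub> q) w \<noteq> \<zero>}"
    then obtain i where "p (take i w) \<noteq> \<zero>" "q (drop i w) \<noteq> \<zero>" using ex by auto
    moreover have "w = (\<lambda>(u, v). u @ v) (take i w, drop i w)" by simp
    ultimately show "w \<in> (\<lambda>(u, v). u @ v) ` ({w. p w \<noteq> \<zero>} \<times> {w. q w \<noteq> \<zero>})" by blast
  qed
  moreover have "finite (\<dots>)" using p q by (simp add: free_alg_finite)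
  ultimately have "finite {w. (p \<otimes>\<^bsub>F\<^esub> q) w \<noteq> \<zero>}" by (rule finite_subset)
  moreover have "w \<in> lists S" if w: "(p \<otimes>\<^bsub>F\<^esub> q) w \<noteq> \<zero>" for w
  proof -
    obtain i where "p (take i w) \<noteq> \<zero>" "q (drop i w) \<noteq> \<zero>" using ex[OF w] by auto
    then have "take i w \<in> lists S" "drop i w \<in> lists S"
      using free_alg_lists p q by blast+
    then show ?thesis by (metis append_in_lists_conv append_take_drop_id)
  qed
  moreover have "(p \<otimes>\<^bsub>F\<^esub> q) w \<in> carrier R" for w
    using p q by (auto simp: free_alg_mult free_alg_coeff intro!: finsum_closed)
  ultimately show ?thesis by (auto simp: free_alg_carrier_iff)
qed

lemma free_alg_mult_l: "p \<in> carrier F \<Longrightarrow> (\<lambda>q. p \<otimes>\<^bsub>F\<^esub> q) \<in> linear_maps R F F"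
proof (rule linear_mapsI)
  fix q q' assume *: "p \<in> carrier F" "q \<in> carrier F" "q' \<in> carrier F"
  show "p \<otimes>\<^bsub>F\<^esub> (q \<oplus>\<^bsub>F\<^esub> q') = p \<otimes>\<^bsub>F\<^esub> q \<oplus>\<^bsub>F\<^esub> p \<otimes>\<^bsub>F\<^esub> q'"
  proof
    fix w
    have "(\<Oplus>i\<in>{..length w}. p (take i w) \<otimes> (q (drop i w) \<oplus> q' (drop i w))) =
      (\<Oplus>i\<in>{..length w}. p (take i w) \<otimes> q (drop i w) \<oplus> p (take i w) \<otimes> q' (drop i w))"
      using * by (intro finsum_cong') (auto simp: free_alg_coeff r_distr)
    then show "(p \<otimes>\<^bsub>F\<^esub> (q \<oplus>\<^bsub>F\<^esub> q')) w = (p \<otimes>\<^bsub>F\<^esub> q \<oplus>\<^bsub>F\<^esub> p \<otimes>\<^bsub>F\<^esub> q') w"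
      using * by (simp add: free_alg_mult free_alg_ops(2) finsum_addf free_alg_coeff)
  qed
next
  fix r q assume *: "p \<in> carrier F" "r \<in> carrier R" "q \<in> carrier F"
  show "p \<otimes>\<^bsub>F\<^esub> (r \<odot>\<^bsub>F\<^esub> q) = r \<odot>\<^bsub>F\<^esub> (p \<otimes>\<^bsub>F\<^esub> q)"
  proof
    fix w
    have "(\<Oplus>i\<in>{..length w}. p (take i w) \<otimes> (r \<otimes> q (drop i w))) =
      (\<Oplus>i\<in>{..length w}. r \<otimes> (p (take i w) \<otimes> q (drop i w)))"
      using * by (intro finsum_cong') (auto simp: free_alg_coeff m_lcomm)
    then show "(p \<otimes>\<^bsub>F\<^esub> (r \<odot>\<^bsub>F\<^esub> q)) w = (r \<odot>\<^bsub>F\<^esub> (p \<otimes>\<^bsub>F\<^esub> q)) w"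
      using * by (simp add: free_alg_mult free_alg_ops(3) finsum_rdistr free_alg_coeff Pi_def)
  qed
qed (simp add: free_alg_mult_closed)

lemma free_alg_mult_r: "q \<in> carrier F \<Longrightarrow> (\<lambda>p. p \<otimes>\<^bsub>F\<^esub> q) \<in> linear_maps R F F"
proof (rule linear_mapsI)
  fix p p' assume *: "q \<in> carrier F" "p \<in> carrier F" "p' \<in> carrier F"
  show "(p \<oplus>\<^bsub>F\<^esub> p') \<otimes>\<^bsub>F\<^esub> q = p \<otimes>\<^bsub>F\<^esub> q \<oplus>\<^bsub>F\<^esub> p' \<otimes>\<^bsub>F\<^esub> q"
  proof
    fix w
    have "(\<Oplus>i\<in>{..length w}. (p (take i w) \<oplus> p' (take i w)) \<otimes> q (drop i w)) =
      (\<Oplus>i\<in>{..length w}. p (take i w) \<otimes> q (drop i w) \<oplus> p' (take i w) \<otimes> q (drop i w))"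
      using * by (intro finsum_cong') (auto simp: free_alg_coeff l_distr)
    then show "((p \<oplus>\<^bsub>F\<^esub> p') \<otimes>\<^bsub>F\<^esub> q) w = (p \<otimes>\<^bsub>F\<^esub> q \<oplus>\<^bsub>F\<^esub> p' \<otimes>\<^bsub>F\<^esub> q) w"
      using * by (simp add: free_alg_mult free_alg_ops(2) finsum_addf free_alg_coeff)
  qed
next
  fix r p assume *: "q \<in> carrier F" "r \<in> carrier R" "p \<in> carrier F"
  show "(r \<odot>\<^bsub>F\<^esub> p) \<otimes>\<^bsub>F\<^esub> q = r \<odot>\<^bsub>F\<^esub> (p \<otimes>\<^bsub>F\<^esub> q)"
  proof
    fix w
    have "(\<Oplus>i\<in>{..length w}. (r \<otimes> p (take i w)) \<otimes> q (drop i w)) =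
      (\<Oplus>i\<in>{..length w}. r \<otimes> (p (take i w) \<otimes> q (drop i w)))"
      using * by (intro finsum_cong') (auto simp: free_alg_coeff m_assoc)
    then show "((r \<odot>\<^bsub>F\<^esub> p) \<otimes>\<^bsub>F\<^esub> q) w = (r \<odot>\<^bsub>F\<^esub> (p \<otimes>\<^bsub>F\<^esub> q)) w"
      using * by (simp add: free_alg_mult free_alg_ops(3) finsum_rdistr free_alg_coeff Pi_def)
  qed
qed (simp add: free_alg_mult_closed)

lemma words_subset: "word R ` lists S \<subseteq> carrier F"
  by (auto intro!: word_closed)

text \<open>The set \<open>W\<close> is kept general for the sake of homogeneous elements of the
  tensor algebra, which have a representative supported on words of one total degree. The proof
  removes one word of the support at a time.\<close>

lemma free_alg_lspan_support:
  assumes "p \<in> carrier F" "{w. p w \<noteq> \<zero>} \<subseteq> W"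
  shows "p \<in> lspan R F (word R ` W)"
proof -
  have "p \<in> lspan R F (word R ` W)"
    if "card {w. p w \<noteq> \<zero>} = n" "p \<in> carrier F" "{w. p w \<noteq> \<zero>} \<subseteq> W" for n p
    using that
  proof (induction n arbitrary: p)
    case 0
    then have "p = \<zero>\<^bsub>F\<^esub>" by (auto simp: free_alg_ops free_alg_carrier_iff)
    then show ?case using lspan.zero by metis
  next
    case (Suc n)
    then obtain v where v: "p v \<noteq> \<zero>" by fastforce
    define q where "q = p(v := \<zero>)"
    have supp: "{w. q w \<noteq> \<zero>} = {w. p w \<noteq> \<zero>} - {v}" by (auto simp: q_def)
    have q: "q \<in> carrier F" using Suc.prems(2) supp
      by (auto simp: free_alg_carrier_iff q_def)
    have "card {w. q w \<noteq> \<zero>} = n" using Suc.prems v supp by (simp add: free_alg_finite)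
    then have IH: "q \<in> lspan R F (word R ` W)" using Suc.IH q Suc.prems(3) supp by blast
    have "p = p v \<odot>\<^bsub>F\<^esub> word R v \<oplus>\<^bsub>F\<^esub> q"
      using Suc.prems(2) by (auto simp: free_alg_ops word_def q_def free_alg_coeff)
    moreover have "\<dots> \<in> lspan R F (word R ` W)"
      using IH Suc.prems(2,3) v by (intro lspan.step) (auto simp: free_alg_coeff)
    ultimately show ?case by metis
  qed
  then show ?thesis using assms by blast
qed

lemma free_alg_lspan: "carrier F = lspan R F (word R ` lists S)"
proof
  show "lspan R F (word R ` lists S) \<subseteq> carrier F"
    using F.lspan_closed[OF _ words_subset] by auto
  show "carrier F \<subseteq> lspan R F (word R ` lists S)"
    using free_alg_lspan_support by (auto simp: free_alg_carrier_iff)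
qed

lemma free_alg_linear_eqI:
  assumes "module R N" "f \<in> linear_maps R F N" "g \<in> linear_maps R F N"
    and "\<And>w. w \<in> lists S \<Longrightarrow> f (word R w) = g (word R w)" "p \<in> carrier F"
  shows "f p = g p"
  by (rule linear_maps_eq_on_lspan[OF free_alg_module assms(1-3) words_subset])
    (use assms(4,5) free_alg_lspan in auto)

text \<open>Both sides are linear in each argument, so the arguments are reduced to words one at a
  time, beginning with \<open>r\<close>. On words all products are concatenations.\<close>

lemma free_alg_assoc:
  assumes p: "p \<in> carrier F" and q: "q \<in> carrier F" and r: "r \<in> carrier F"
  shows "(p \<otimes>\<^bsub>F\<^esub> q) \<otimes>\<^bsub>F\<^esub> r = p \<otimes>\<^bsub>F\<^esub> (q \<otimes>\<^bsub>F\<^esub> r)"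
proof -
  have 1: "(word R u \<otimes>\<^bsub>F\<^esub> word R v) \<otimes>\<^bsub>F\<^esub> r = word R u \<otimes>\<^bsub>F\<^esub> (word R v \<otimes>\<^bsub>F\<^esub> r)"
    if "u \<in> lists S" "v \<in> lists S" for u v
    by (rule free_alg_linear_eqI[OF free_alg_module _ _ _ r])
      (use that in \<open>auto simp: word_mult_word subset_iff intro!: free_alg_mult_l free_alg_mult_closed
        linear_maps_comp[OF free_alg_mult_l free_alg_mult_l]\<close>)
  have 2: "(word R u \<otimes>\<^bsub>F\<^esub> q) \<otimes>\<^bsub>F\<^esub> r = word R u \<otimes>\<^bsub>F\<^esub> (q \<otimes>\<^bsub>F\<^esub> r)" if "u \<in> lists S" for u
    by (rule free_alg_linear_eqI[OF free_alg_module _ _ _ q])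
      (use that r 1 in \<open>auto simp: subset_iff intro!: linear_maps_comp[OF free_alg_mult_l free_alg_mult_r]
        linear_maps_comp[OF free_alg_mult_r free_alg_mult_l]\<close>)
  show ?thesis
    by (rule free_alg_linear_eqI[OF free_alg_module _ _ _ p])
      (use q r 2 in \<open>auto intro!: linear_maps_comp[OF free_alg_mult_r free_alg_mult_r]
        free_alg_mult_r free_alg_mult_closed\<close>)
qed

lemma free_alg_ring: "ring F"
proof (rule ringI)
  show "abelian_group F" by (rule F.abelian_group_axioms)
  have l: "\<one>\<^bsub>F\<^esub> \<otimes>\<^bsub>F\<^esub> p = p" if "p \<in> carrier F" for p
    by (rule free_alg_linear_eqI[OF free_alg_module free_alg_mult_l linear_maps_id _ that])
      (auto simp: free_alg_ops word_mult_word)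
  have r: "p \<otimes>\<^bsub>F\<^esub> \<one>\<^bsub>F\<^esub> = p" if "p \<in> carrier F" for p
    by (rule free_alg_linear_eqI[OF free_alg_module free_alg_mult_r linear_maps_id _ that])
      (auto simp: free_alg_ops word_mult_word)
  show "monoid F"
    using word_closed[of "[]"]
    by (intro monoidI) (simp_all add: free_alg_mult_closed free_alg_assoc l r free_alg_ops(4)[symmetric])
qed (auto simp: linear_maps_add[OF free_alg_mult_l] linear_maps_add[OF free_alg_mult_r])

section \<open>The universal property of the free algebra\<close>

definition extend :: "('r, 'n, 'z) module_scheme \<Rightarrow> ('m list \<Rightarrow> 'n) \<Rightarrow> ('m list \<Rightarrow> 'r) \<Rightarrow> 'n" where
  "extend N f p = (\<Oplus>\<^bsub>N\<^esub> w\<in>{w. p w \<noteq> \<zero>}. p w \<odot>\<^bsub>N\<^esub> f w)"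

context
  fixes N :: "('r, 'n, 'z) module_scheme" and f
  assumes N: "module R N" and f: "f \<in> lists S \<rightarrow> carrier N"
begin

interpretation N: module R N by (rule N)

text \<open>Supports change under sums and scalar multiples; summing over a common finite superset
  makes the values of \<open>extend\<close> comparable.\<close>

lemma extend_superset:
  assumes "p \<in> carrier F" "finite A" "{w. p w \<noteq> \<zero>} \<subseteq> A" "A \<subseteq> lists S"
  shows "extend N f p = (\<Oplus>\<^bsub>N\<^esub> w\<in>A. p w \<odot>\<^bsub>N\<^esub> f w)"
  unfolding extend_def
proof (rule N.add.finprod_mono_neutral_cong_left[OF assms(2,3)])
  show "p i \<odot>\<^bsub>N\<^esub> f i = \<zero>\<^bsub>N\<^esub>" if "i \<in> A - {w. p w \<noteq> \<zero>}" for i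
    using that assms(4) f by (auto intro!: N.smult_l_null)
  show "(\<lambda>w. p w \<odot>\<^bsub>N\<^esub> f w) \<in> A \<rightarrow> carrier N"
    using assms f by (auto simp: free_alg_coeff Pi_iff subset_iff)
qed simp

lemma extend_linear: "extend N f \<in> linear_maps R F N"
proof (rule linear_mapsI)
  have c: "f w \<in> carrier N" if "p \<in> carrier F" "p w \<noteq> \<zero>" for p w
    using f free_alg_lists[OF that] by auto
  fix p assume p: "p \<in> carrier F"
  show "extend N f p \<in> carrier N"
    unfolding extend_def using p c by (intro N.finsum_closed) (auto simp: free_alg_coeff)
  {
    fix q assume q: "q \<in> carrier F"
    let ?A = "{w. p w \<noteq> \<zero>} \<union> {w. q w \<noteq> \<zero>}"
    have A: "finite ?A" "?A \<subseteq> lists S" using p q by (auto simp: free_alg_finite dest: free_alg_lists)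
    have "extend N f (p \<oplus>\<^bsub>F\<^esub> q) = (\<Oplus>\<^bsub>N\<^esub> w\<in>?A. (p w \<oplus> q w) \<odot>\<^bsub>N\<^esub> f w)"
      using F.M.a_closed[OF p q] A by (subst extend_superset[of _ ?A]) (auto simp: free_alg_ops free_alg_coeff[OF p] free_alg_coeff[OF q])
    also have "\<dots> = (\<Oplus>\<^bsub>N\<^esub> w\<in>?A. p w \<odot>\<^bsub>N\<^esub> f w \<oplus>\<^bsub>N\<^esub> q w \<odot>\<^bsub>N\<^esub> f w)"
      using p q c by (intro N.finsum_cong') (auto simp: free_alg_coeff N.smult_l_distr)
    also have "\<dots> = (\<Oplus>\<^bsub>N\<^esub> w\<in>?A. p w \<odot>\<^bsub>N\<^esub> f w) \<oplus>\<^bsub>N\<^esub> (\<Oplus>\<^bsub>N\<^esub> w\<in>?A. q w \<odot>\<^bsub>N\<^esub> f w)"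
      using p q c by (intro N.finsum_addf) (auto simp: free_alg_coeff)
    also have "\<dots> = extend N f p \<oplus>\<^bsub>N\<^esub> extend N f q"
      using p q A by (simp add: extend_superset[of _ ?A])
    finally show "extend N f (p \<oplus>\<^bsub>F\<^esub> q) = extend N f p \<oplus>\<^bsub>N\<^esub> extend N f q" .
  next
    fix r assume r: "r \<in> carrier R"
    let ?A = "{w. p w \<noteq> \<zero>}"
    have A: "finite ?A" "?A \<subseteq> lists S" using p by (auto simp: free_alg_finite dest: free_alg_lists)
    have "extend N f (r \<odot>\<^bsub>F\<^esub> p) = (\<Oplus>\<^bsub>N\<^esub> w\<in>?A. (r \<otimes> p w) \<odot>\<^bsub>N\<^esub> f w)"
      using F.smult_closed[OF r p] A r by (subst extend_superset[of _ ?A]) (auto simp: free_alg_ops free_alg_coeff[OF p])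
    also have "\<dots> = (\<Oplus>\<^bsub>N\<^esub> w\<in>?A. r \<odot>\<^bsub>N\<^esub> (p w \<odot>\<^bsub>N\<^esub> f w))"
      using p r c by (intro N.finsum_cong') (auto simp: free_alg_coeff N.smult_assoc1)
    also have "\<dots> = r \<odot>\<^bsub>N\<^esub> extend N f p"
      unfolding extend_def using p r c A
      by (subst N.finsum_smult_ldistr) (auto simp: free_alg_coeff)
    finally show "extend N f (r \<odot>\<^bsub>F\<^esub> p) = r \<odot>\<^bsub>N\<^esub> extend N f p" .
  }
qed

lemma extend_word: assumes "w \<in> lists S" shows "extend N f (word R w) = f w"
proof -
  have "extend N f (word R w) = (\<Oplus>\<^bsub>N\<^esub> v\<in>{w}. word R w v \<odot>\<^bsub>N\<^esub> f v)"
    using assms word_closed[of w] by (intro extend_superset) (auto simp: word_def subset_iff)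
  then show ?thesis using f assms by (simp add: word_def Pi_iff)
qed

end

end

section \<open>The tensor algebra and its universal property\<close>

text \<open>For each word length this is ordinary multilinearity, and no relation between different
  lengths is imposed. Such functions on words are the ones that descend to linear maps on
  T(M).\<close>

definition multilinear ::
  "'r ring \<Rightarrow> ('r, 'm) gmodule \<Rightarrow> ('r, 'n) gmodule \<Rightarrow> ('m list \<Rightarrow> 'n) \<Rightarrow> bool" where
  "multilinear R M N f \<longleftrightarrow> f \<in> lists (carrier M) \<rightarrow> carrier N \<and>
     (\<forall>u\<in>lists (carrier M). \<forall>v\<in>lists (carrier M). (\<lambda>x. f (u @ x # v)) \<in> linear_maps R M N)"

text \<open>Varying one letter does not change the length of a word, so outside length
  \<open>k\<close> the function of that letter is constantly zero and hence linear.\<close>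

lemma multilinear_powI:
  assumes "module R N"
    and "\<And>w. \<lbrakk>set w \<subseteq> carrier M; length w = k\<rbrakk> \<Longrightarrow> f w \<in> carrier N"
    and "\<And>u v. \<lbrakk>set u \<subseteq> carrier M; set v \<subseteq> carrier M; k = Suc (length u + length v)\<rbrakk>
      \<Longrightarrow> (\<lambda>x. f (u @ x # v)) \<in> linear_maps R M N"
  shows "multilinear R M N (\<lambda>w. if length w = k then f w else \<zero>\<^bsub>N\<^esub>)"
proof -
  interpret N: module R N by fact
  show ?thesis
    unfolding multilinear_def
  proof (intro conjI ballI)
    show "(\<lambda>w. if length w = k then f w else \<zero>\<^bsub>N\<^esub>) \<in> lists (carrier M) \<rightarrow> carrier N"
      using assms(2) by (auto simp: subset_iff)
    show "(\<lambda>x. if length (u @ x # v) = k then f (u @ x # v) else \<zero>\<^bsub>N\<^esub>) \<in> linear_maps R M N"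
      if "u \<in> lists (carrier M)" "v \<in> lists (carrier M)" for u v
      using that assms(3)[of u v] linear_maps_const_zero[OF assms(1)]
      by (cases "k = Suc (length u + length v)") (auto simp: subset_iff)
  qed
qed

locale tensor_algebra = module R M for R :: "'r ring" (structure) and M :: "('r, 'm) gmodule"
begin

sublocale free: free_algebra R "carrier M" ..

abbreviation F where "F \<equiv> free_alg R (carrier M)"
abbreviation T where "T \<equiv> TA R M"
abbreviation I where "I \<equiv> tensor_ideal R M"

sublocale F: ring F
  by (rule free.free_alg_ring)

lemma tensor_rels_subset: "tensor_rels R M \<subseteq> carrier F"
  by (auto simp: tensor_rels_def Let_def intro!: free.F.minus_closed free.F.a_closed free.F.smult_closed)

sublocale I: ideal I F
  unfolding tensor_ideal_def by (rule F.genideal_ideal[OF tensor_rels_subset])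

definition cls :: "('m list \<Rightarrow> 'r) \<Rightarrow> ('m list \<Rightarrow> 'r) set" where
  "cls p = I +>\<^bsub>F\<^esub> p"

lemma TA_carrier: "carrier T = cls ` carrier F"
  by (auto simp: TA_def Let_def FactRing_def A_RCOSETS_def' cls_def)

lemma TA_add: "\<lbrakk>p \<in> carrier F; q \<in> carrier F\<rbrakk> \<Longrightarrow> cls p \<oplus>\<^bsub>T\<^esub> cls q = cls (p \<oplus>\<^bsub>F\<^esub> q)"
  by (simp add: TA_def Let_def FactRing_def cls_def I.a_rcos_sum)

lemma TA_mult: "\<lbrakk>p \<in> carrier F; q \<in> carrier F\<rbrakk> \<Longrightarrow> cls p \<otimes>\<^bsub>T\<^esub> cls q = cls (p \<otimes>\<^bsub>F\<^esub> q)"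
  by (simp add: TA_def Let_def FactRing_def cls_def I.rcoset_mult_add)

lemma TA_one: "\<one>\<^bsub>T\<^esub> = cls \<one>\<^bsub>F\<^esub>"
  by (simp add: TA_def Let_def FactRing_def cls_def)

lemma TA_ring: "ring T"
proof -
  interpret Q: ring "F Quot I" by (rule I.quotient_is_ring)
  have *: "carrier T = carrier (F Quot I)" "mult T = mult (F Quot I)" "one T = one (F Quot I)"
    "add T = add (F Quot I)" "zero T = zero (F Quot I)"
    by (simp_all add: TA_def Let_def)
  show ?thesis
  proof (rule ringI)
    show "abelian_group T"
      by (rule abelian_groupI; unfold *)
        (simp_all add: Q.a_ac Q.add.l_inv_ex)
    show "monoid T" by (rule monoidI; unfold *) (simp_all add: Q.m_assoc)
  qed (unfold *, simp_all add: Q.l_distr Q.r_distr)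
qed

lemma cls_eq_iff: "\<lbrakk>p \<in> carrier F; q \<in> carrier F\<rbrakk> \<Longrightarrow> cls p = cls q \<longleftrightarrow> p \<ominus>\<^bsub>F\<^esub> q \<in> I"
  by (simp add: cls_def F.quotient_eq_iff_same_a_r_cos[OF I.ideal_axioms])

lemma cls_memD: assumes "q \<in> cls p" "p \<in> carrier F" shows "q \<in> carrier F" "cls q = cls p"
proof -
  show "q \<in> carrier F"
    using assms free.F.a_r_coset_subset_G[OF I.a_subset assms(2)] by (auto simp: cls_def)
  show "cls q = cls p"
    using assms free.F.a_repr_independence[OF _ assms(2) I.a_subgroup] unfolding cls_def by auto
qed

lemma cls_self: "p \<in> carrier F \<Longrightarrow> p \<in> cls p"
  unfolding cls_def by (rule I.a_rcos_self)

text \<open>A scalar acts as left multiplication by the corresponding multiple of the unit, so an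
  ideal is also a submodule.\<close>

lemma ideal_smult:
  assumes "r \<in> carrier R" "p \<in> I" shows "r \<odot>\<^bsub>F\<^esub> p \<in> I"
proof -
  have "r \<odot>\<^bsub>F\<^esub> p = (r \<odot>\<^bsub>F\<^esub> \<one>\<^bsub>F\<^esub>) \<otimes>\<^bsub>F\<^esub> p"
    using assms linear_maps_smult[OF free.free_alg_mult_r] I.a_subset by (metis F.l_one F.one_closed I.Icarr)
  then show ?thesis using assms I.I_l_closed by simp
qed

text \<open>The union over representatives in the definition of \<open>TA\<close> is a union of
  equal classes, because the ideal is stable under scalars.\<close>

lemma TA_smult:
  assumes "r \<in> carrier R" "p \<in> carrier F" shows "r \<odot>\<^bsub>T\<^esub> cls p = cls (r \<odot>\<^bsub>F\<^esub> p)"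
proof -
  have "cls (r \<odot>\<^bsub>F\<^esub> q) = cls (r \<odot>\<^bsub>F\<^esub> p)" if "q \<in> cls p" for q
  proof -
    note q = cls_memD[OF that assms(2)]
    then have "q \<ominus>\<^bsub>F\<^esub> p \<in> I" using cls_eq_iff[of q p] assms by simp
    then have "r \<odot>\<^bsub>F\<^esub> (q \<ominus>\<^bsub>F\<^esub> p) \<in> I" by (rule ideal_smult[OF assms(1)])
    moreover have "r \<odot>\<^bsub>F\<^esub> (q \<ominus>\<^bsub>F\<^esub> p) = r \<odot>\<^bsub>F\<^esub> q \<ominus>\<^bsub>F\<^esub> r \<odot>\<^bsub>F\<^esub> p"
      unfolding a_minus_def using q(1) assms
      by (simp only: free.F.smult_r_distr free.F.smult_r_minus free.F.a_inv_closed)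
    ultimately show ?thesis
      using cls_eq_iff[of "r \<odot>\<^bsub>F\<^esub> q" "r \<odot>\<^bsub>F\<^esub> p"] q(1) assms free.F.smult_closed by metis
  qed
  then have "(\<Union>q\<in>cls p. cls (r \<odot>\<^bsub>F\<^esub> q)) = cls (r \<odot>\<^bsub>F\<^esub> p)"
    using cls_self[OF assms(2)] by blast
  moreover have "r \<odot>\<^bsub>T\<^esub> X = (\<Union>q\<in>X. cls (r \<odot>\<^bsub>F\<^esub> q))" for X
    by (simp add: TA_def Let_def cls_def)
  ultimately show ?thesis by simp
qed

lemma TA_module: "module R T"
proof (rule moduleI)
  show "abelian_group T" using TA_ring by (simp add: ring_def)
qed (auto simp: TA_carrier TA_smult TA_add free.F.smult_l_distr free.F.smult_r_distr
    free.F.smult_assoc1 is_cring)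

sublocale T: module R T
  by (rule TA_module)

sublocale T: ring T
  by (rule TA_ring)

lemma cls_linear: "cls \<in> linear_maps R F T"
  by (rule linear_mapsI) (auto simp: TA_carrier TA_add TA_smult)

lemma TA_mult_l: "X \<in> carrier T \<Longrightarrow> (\<lambda>Y. X \<otimes>\<^bsub>T\<^esub> Y) \<in> linear_maps R T T"
  by (rule linear_mapsI)
    (auto simp: T.r_distr TA_carrier TA_smult TA_mult linear_maps_smult[OF free.free_alg_mult_l])

lemma TA_mult_r: "Y \<in> carrier T \<Longrightarrow> (\<lambda>X. X \<otimes>\<^bsub>T\<^esub> Y) \<in> linear_maps R T T"
  by (rule linear_mapsI)
    (auto simp: T.l_distr TA_carrier TA_smult TA_mult linear_maps_smult[OF free.free_alg_mult_r])

lemma tens_eq_cls: "tens R M w = cls (word R w)"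
  by (simp add: tens_def cls_def)

lemma tens_closed [simp]: "set w \<subseteq> carrier M \<Longrightarrow> tens R M w \<in> carrier T"
  by (simp add: tens_eq_cls TA_carrier)

lemma tens_append: "\<lbrakk>set u \<subseteq> carrier M; set v \<subseteq> carrier M\<rbrakk>
    \<Longrightarrow> tens R M (u @ v) = tens R M u \<otimes>\<^bsub>T\<^esub> tens R M v"
  by (simp add: tens_eq_cls TA_mult free.word_mult_word)

lemma tens_Nil: "tens R M [] = \<one>\<^bsub>T\<^esub>"
  by (simp add: TA_one tens_eq_cls free.free_alg_ops)

lemma tens_Cons: "\<lbrakk>x \<in> carrier M; set v \<subseteq> carrier M\<rbrakk>
    \<Longrightarrow> tens R M (x # v) = tens R M [x] \<otimes>\<^bsub>T\<^esub> tens R M v"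
  using tens_append[of "[x]" v] by simp

lemma tens_subset: "tens R M ` lists (carrier M) \<subseteq> carrier T"
  by (auto simp: subset_iff)

lemma TA_lspan: "carrier T = lspan R T (tens R M ` lists (carrier M))"
proof
  show "lspan R T (tens R M ` lists (carrier M)) \<subseteq> carrier T"
    using T.lspan_closed[OF _ tens_subset] by auto
  show "carrier T \<subseteq> lspan R T (tens R M ` lists (carrier M))"
  proof
    fix X assume "X \<in> carrier T"
    then obtain p where p: "p \<in> carrier F" "X = cls p" by (auto simp: TA_carrier)
    then have "p \<in> lspan R F (word R ` lists (carrier M))"
      using free.free_alg_lspan by simp
    then show "X \<in> lspan R T (tens R M ` lists (carrier M))"
      unfolding p(2)
      by (rule linear_maps_lspan[OF free.free_alg_module TA_module cls_linear
            free.words_subset _ tens_subset, rotated])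
        (auto simp: tens_eq_cls[symmetric] subset_iff intro!: T.lspan_base)
  qed
qed

text \<open>Elementary tensors span T(M). Most identities between maps on T(M) below are reduced to
  words in this way.\<close>

lemma TA_linear_eqI:
  assumes "module R N" "f \<in> linear_maps R T N" "g \<in> linear_maps R T N"
    and "\<And>w. set w \<subseteq> carrier M \<Longrightarrow> f (tens R M w) = g (tens R M w)" "X \<in> carrier T"
  shows "f X = g X"
  by (rule linear_maps_eq_on_lspan[OF TA_module assms(1-3) tens_subset])
    (use assms(4,5) TA_lspan in \<open>auto simp: subset_iff\<close>)

lemma tens_singleton_linear: "(\<lambda>x. tens R M [x]) \<in> linear_maps R M T"
proof (rule linear_mapsI)
  fix x y assume xy: "x \<in> carrier M" "y \<in> carrier M"
  have "word R [x \<oplus>\<^bsub>M\<^esub> y] \<ominus>\<^bsub>F\<^esub> (word R [x] \<oplus>\<^bsub>F\<^esub> word R [y]) \<in> tensor_rels R M"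
    using xy by (auto simp: tensor_rels_def Let_def)
  then have "word R [x \<oplus>\<^bsub>M\<^esub> y] \<ominus>\<^bsub>F\<^esub> (word R [x] \<oplus>\<^bsub>F\<^esub> word R [y]) \<in> I"
    unfolding tensor_ideal_def using F.genideal_self[OF tensor_rels_subset] by blast
  then show "tens R M [x \<oplus>\<^bsub>M\<^esub> y] = tens R M [x] \<oplus>\<^bsub>T\<^esub> tens R M [y]"
    using xy by (simp add: tens_eq_cls TA_add cls_eq_iff)
next
  fix r x assume rx: "r \<in> carrier R" "x \<in> carrier M"
  have "word R [r \<odot>\<^bsub>M\<^esub> x] \<ominus>\<^bsub>F\<^esub> r \<odot>\<^bsub>F\<^esub> word R [x] \<in> tensor_rels R M"
    using rx by (auto simp: tensor_rels_def Let_def)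
  then have "word R [r \<odot>\<^bsub>M\<^esub> x] \<ominus>\<^bsub>F\<^esub> r \<odot>\<^bsub>F\<^esub> word R [x] \<in> I"
    unfolding tensor_ideal_def using F.genideal_self[OF tensor_rels_subset] by blast
  then show "tens R M [r \<odot>\<^bsub>M\<^esub> x] = r \<odot>\<^bsub>T\<^esub> tens R M [x]"
    using rx by (simp add: tens_eq_cls TA_smult cls_eq_iff)
qed simp

lemma tens_linear:
  assumes "set u \<subseteq> carrier M" "set v \<subseteq> carrier M"
  shows "(\<lambda>x. tens R M (u @ x # v)) \<in> linear_maps R M T"
proof -
  have "(\<lambda>x. tens R M u \<otimes>\<^bsub>T\<^esub> (tens R M [x] \<otimes>\<^bsub>T\<^esub> tens R M v)) \<in> linear_maps R M T"
    using assms by (intro linear_maps_comp[OF tens_singleton_linear]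
        linear_maps_comp[OF TA_mult_r TA_mult_l]) auto
  moreover have "tens R M (u @ x # v) = tens R M u \<otimes>\<^bsub>T\<^esub> (tens R M [x] \<otimes>\<^bsub>T\<^esub> tens R M v)"
    if "x \<in> carrier M" for x
    using that assms tens_append[of u "x # v"] tens_Cons[of x v] by simp
  ultimately show ?thesis
    by (auto simp: linear_maps_def Pi_iff)
qed

text \<open>Multiplying by a word amounts to translating the function. With linearity in the other
  factor this reduces closure of an annihilator under multiplication to multiplication by
  words.\<close>

lemma extend_mult_word:
  assumes N: "module R N" and g: "g \<in> lists (carrier M) \<rightarrow> carrier N"
    and y: "y \<in> lists (carrier M)" and p: "p \<in> carrier F"
  shows "free.extend N g (word R y \<otimes>\<^bsub>F\<^esub> p) = free.extend N (\<lambda>w. g (y @ w)) p"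
    and "free.extend N g (p \<otimes>\<^bsub>F\<^esub> word R y) = free.extend N (\<lambda>w. g (w @ y)) p"
proof -
  have y': "word R y \<in> carrier F" using y by (intro free.word_closed) auto
  have l: "(\<lambda>w. g (y @ w)) \<in> lists (carrier M) \<rightarrow> carrier N"
    and r: "(\<lambda>w. g (w @ y)) \<in> lists (carrier M) \<rightarrow> carrier N" using g y by (auto simp: Pi_iff)
  show "free.extend N g (word R y \<otimes>\<^bsub>F\<^esub> p) = free.extend N (\<lambda>w. g (y @ w)) p"
    by (rule free.free_alg_linear_eqI[OF N linear_maps_comp[OF free.free_alg_mult_l[OF y']
          free.extend_linear[OF N g]] free.extend_linear[OF N l] _ p])
      (use y in \<open>simp add: free.word_mult_word free.extend_word[OF N g] free.extend_word[OF N l]\<close>)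
  show "free.extend N g (p \<otimes>\<^bsub>F\<^esub> word R y) = free.extend N (\<lambda>w. g (w @ y)) p"
    by (rule free.free_alg_linear_eqI[OF N linear_maps_comp[OF free.free_alg_mult_r[OF y']
          free.extend_linear[OF N g]] free.extend_linear[OF N r] _ p])
      (use y in \<open>simp add: free.word_mult_word free.extend_word[OF N g] free.extend_word[OF N r]\<close>)
qed

text \<open>The elements annihilated by all translates \<open>w \<mapsto> f (u @ w @ v)\<close> form a two-sided ideal, which
  contains the tensor relations.\<close>

lemma extend_tensor_ideal:
  assumes N: "module R N" and f: "multilinear R M N f" and p: "p \<in> I"
  shows "free.extend N f p = \<zero>\<^bsub>N\<^esub>"
proof -
  interpret N: module R N by (rule N)
  define L where "L u v = free.extend N (\<lambda>w. f (u @ w @ v))" for u v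
  define K where "K = {p \<in> carrier F. \<forall>u\<in>lists (carrier M). \<forall>v\<in>lists (carrier M). L u v p = \<zero>\<^bsub>N\<^esub>}"
  have c: "(\<lambda>w. f (u @ w @ v)) \<in> lists (carrier M) \<rightarrow> carrier N"
    if "u \<in> lists (carrier M)" "v \<in> lists (carrier M)" for u v
    using f that by (auto simp: multilinear_def Pi_iff)
  have lin: "L u v \<in> linear_maps R F N"
    if "u \<in> lists (carrier M)" "v \<in> lists (carrier M)" for u v
    unfolding L_def using free.extend_linear[OF N c[OF that]] .
  have "submodule K R F"
  proof (rule free.F.submoduleI)
    show "\<zero>\<^bsub>F\<^esub> \<in> K"
      by (simp add: K_def linear_maps_zero[OF free.free_alg_module N lin])
  qed (auto simp: K_def linear_maps_add[OF lin] linear_maps_smult[OF lin]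
      linear_maps_a_inv[OF free.free_alg_module N lin])
  then have sub: "subgroup K (add_monoid F)" by (rule submodule.axioms)
  have ideal: "ideal K F"
  proof (rule idealI[OF F.ring_axioms sub])
    fix a x assume a: "a \<in> K" and x: "x \<in> carrier F"
    then have a': "a \<in> carrier F" by (simp add: K_def)
    have "L u v (x \<otimes>\<^bsub>F\<^esub> a) = \<zero>\<^bsub>N\<^esub>" if uv: "u \<in> lists (carrier M)" "v \<in> lists (carrier M)" for u v
    proof (rule free.free_alg_linear_eqI[OF N linear_maps_comp[OF free.free_alg_mult_r[OF a'] lin[OF uv]]
          linear_maps_const_zero[OF N] _ x])
      fix y assume y: "y \<in> lists (carrier M)"
      have "L u v (word R y \<otimes>\<^bsub>F\<^esub> a) = L (u @ y) v a"
        unfolding L_def by (subst extend_mult_word(1)[OF N c[OF uv] y a']) simp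
      also have "\<dots> = \<zero>\<^bsub>N\<^esub>" using a uv y by (simp add: K_def)
      finally show "L u v (word R y \<otimes>\<^bsub>F\<^esub> a) = \<zero>\<^bsub>N\<^esub>" .
    qed
    then show "x \<otimes>\<^bsub>F\<^esub> a \<in> K" using a' x by (simp add: K_def)
    have "L u v (a \<otimes>\<^bsub>F\<^esub> x) = \<zero>\<^bsub>N\<^esub>" if uv: "u \<in> lists (carrier M)" "v \<in> lists (carrier M)" for u v
    proof (rule free.free_alg_linear_eqI[OF N linear_maps_comp[OF free.free_alg_mult_l[OF a'] lin[OF uv]]
          linear_maps_const_zero[OF N] _ x])
      fix y assume y: "y \<in> lists (carrier M)"
      have "L u v (a \<otimes>\<^bsub>F\<^esub> word R y) = L u (y @ v) a"
        unfolding L_def by (subst extend_mult_word(2)[OF N c[OF uv] y a']) simp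
      also have "\<dots> = \<zero>\<^bsub>N\<^esub>" using a uv y by (simp add: K_def)
      finally show "L u v (a \<otimes>\<^bsub>F\<^esub> word R y) = \<zero>\<^bsub>N\<^esub>" .
    qed
    then show "a \<otimes>\<^bsub>F\<^esub> x \<in> K" using a' x by (simp add: K_def)
  qed
  have word: "L u v (word R w) = f (u @ w @ v)"
    if "u \<in> lists (carrier M)" "v \<in> lists (carrier M)" "w \<in> lists (carrier M)" for u v w
    unfolding L_def using free.extend_word[OF N c[OF that(1,2)] that(3)] .
  have fl: "(\<lambda>x. f (u @ x # v)) \<in> linear_maps R M N"
    if "u \<in> lists (carrier M)" "v \<in> lists (carrier M)" for u v
    using f that by (auto simp: multilinear_def)
  have "tensor_rels R M \<subseteq> K"
  proof
    fix q assume q: "q \<in> tensor_rels R M"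
    then have q': "q \<in> carrier F" using tensor_rels_subset by blast
    have "L u v q = \<zero>\<^bsub>N\<^esub>" if uv: "u \<in> lists (carrier M)" "v \<in> lists (carrier M)" for u v
    proof -
      have minus: "L u v (a \<ominus>\<^bsub>F\<^esub> b) = L u v a \<ominus>\<^bsub>N\<^esub> L u v b" if "a \<in> carrier F" "b \<in> carrier F" for a b
        using that by (simp add: a_minus_def a_minus_def linear_maps_add[OF lin[OF uv]]
            linear_maps_a_inv[OF free.free_alg_module N lin[OF uv]])
      have sub0: "a \<ominus>\<^bsub>N\<^esub> a = \<zero>\<^bsub>N\<^esub>" if "a \<in> carrier N" for a
        using that by (simp add: a_minus_def N.r_neg)
      have fc: "f (u @ x # v) \<in> carrier N" if "x \<in> carrier M" for x
        using linear_maps_closed[OF fl[OF uv] that] .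
      consider x y where "x \<in> carrier M" "y \<in> carrier M"
          "q = word R [x \<oplus>\<^bsub>M\<^esub> y] \<ominus>\<^bsub>F\<^esub> (word R [x] \<oplus>\<^bsub>F\<^esub> word R [y])"
        | r x where "r \<in> carrier R" "x \<in> carrier M"
          "q = word R [r \<odot>\<^bsub>M\<^esub> x] \<ominus>\<^bsub>F\<^esub> r \<odot>\<^bsub>F\<^esub> word R [x]"
        using q by (auto simp: tensor_rels_def Let_def)
      then show ?thesis
      proof cases
        case (1 x y)
        then show ?thesis
          using uv fc by (simp add: minus linear_maps_add[OF lin[OF uv]] word
              linear_maps_add[OF fl[OF uv]] sub0)
      next
        case (2 r x)
        then show ?thesis
          using uv fc by (simp add: minus linear_maps_smult[OF lin[OF uv]] word
              linear_maps_smult[OF fl[OF uv]] sub0)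
      qed
    qed
    then show "q \<in> K" using q' by (simp add: K_def)
  qed
  then have "I \<subseteq> K" unfolding tensor_ideal_def by (rule F.genideal_minimal[OF ideal])
  then have "L [] [] p = \<zero>\<^bsub>N\<^esub>" using p by (auto simp: K_def)
  then show ?thesis by (simp add: L_def)
qed

text \<open>Whatever representative the choice operator picks, it differs from \<open>p\<close> by
  an element of the tensor ideal, on which the extension vanishes.\<close>

lemma tlift_cls:
  assumes N: "module R N" and f: "multilinear R M N f" and p: "p \<in> carrier F"
  shows "tlift R M N f (cls p) = free.extend N f p"
proof -
  interpret N: module R N by (rule N)
  have f': "f \<in> lists (carrier M) \<rightarrow> carrier N" using f by (simp add: multilinear_def)
  note lin = free.extend_linear[OF N f']
  define q where "q = (SOME q. q \<in> cls p)"
  have "q \<in> cls p" unfolding q_def using cls_self[OF p] by (rule someI[where P = "\<lambda>q. q \<in> cls p"])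
  from cls_memD[OF this p] have q: "q \<in> carrier F" "q \<ominus>\<^bsub>F\<^esub> p \<in> I"
    using cls_eq_iff[of q p] p by simp_all
  then have "free.extend N f (q \<ominus>\<^bsub>F\<^esub> p) = \<zero>\<^bsub>N\<^esub>"
    by (intro extend_tensor_ideal[OF N f])
  moreover have "free.extend N f ((q \<ominus>\<^bsub>F\<^esub> p) \<oplus>\<^bsub>F\<^esub> p) =
      free.extend N f (q \<ominus>\<^bsub>F\<^esub> p) \<oplus>\<^bsub>N\<^esub> free.extend N f p"
    using q p by (intro linear_maps_add[OF lin]) auto
  moreover have "(q \<ominus>\<^bsub>F\<^esub> p) \<oplus>\<^bsub>F\<^esub> p = q"
    using q p by (simp add: a_minus_def free.F.a_assoc free.F.l_neg)
  ultimately have "free.extend N f q = free.extend N f p"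
    using linear_maps_closed[OF lin p] by simp
  then show ?thesis by (simp add: tlift_def q_def[symmetric] free.extend_def)
qed

lemma tlift_linear:
  assumes N: "module R N" and f: "multilinear R M N f"
  shows "tlift R M N f \<in> linear_maps R T N"
proof -
  have "f \<in> lists (carrier M) \<rightarrow> carrier N" using f by (simp add: multilinear_def)
  note lin = free.extend_linear[OF N this]
  show ?thesis
    by (rule linear_mapsI)
      (auto simp: TA_carrier TA_add TA_smult tlift_cls[OF N f] linear_maps_add[OF lin]
        linear_maps_smult[OF lin] linear_maps_closed[OF lin])
qed

lemma tlift_tens:
  assumes N: "module R N" and f: "multilinear R M N f" and w: "set w \<subseteq> carrier M"
  shows "tlift R M N f (tens R M w) = f w"
  using w f by (simp add: tens_eq_cls tlift_cls[OF N f])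
    (auto simp: multilinear_def subset_iff intro!: free.extend_word[OF N])

end

section \<open>Bilinear maps and products of maps on tensor powers\<close>

lemma linear_maps_cong:
  assumes "f \<in> linear_maps R M N" "module R M" "\<And>x. x \<in> carrier M \<Longrightarrow> f x = g x"
  shows "g \<in> linear_maps R M N"
proof -
  interpret M: module R M by fact
  show ?thesis
    using assms(1) by (auto simp: linear_maps_def Pi_iff simp flip: assms(3))
qed

definition bilinear ::
  "'r ring \<Rightarrow> ('r, 'm) gmodule \<Rightarrow> ('r, 'n) gmodule \<Rightarrow> ('m \<Rightarrow> 'm \<Rightarrow> 'n) \<Rightarrow> bool" where
  "bilinear R M N f \<longleftrightarrow> (\<forall>a\<in>carrier M. f a \<in> linear_maps R M N) \<and>
     (\<forall>b\<in>carrier M. (\<lambda>a. f a b) \<in> linear_maps R M N)"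

lemma bilinear_closed:
  "\<lbrakk>bilinear R M N f; a \<in> carrier M; b \<in> carrier M\<rbrakk> \<Longrightarrow> f a b \<in> carrier N"
  by (auto simp: bilinear_def intro: linear_maps_closed)

lemma bilinear_comp:
  "\<lbrakk>bilinear R M N f; G \<in> linear_maps R N P\<rbrakk> \<Longrightarrow> bilinear R M P (\<lambda>a b. G (f a b))"
  unfolding bilinear_def by (auto intro: linear_maps_comp)

lemma bilinear_cong:
  assumes "bilinear R M N f" "module R M"
    "\<And>a b. \<lbrakk>a \<in> carrier M; b \<in> carrier M\<rbrakk> \<Longrightarrow> f a b = g a b"
  shows "bilinear R M N g"
  using assms unfolding bilinear_def by (auto intro: linear_maps_cong)

text \<open>The tensor product of the maps in \<open>fs\<close>, followed by multiplication in
  T(M'). In contrast to \<open>tensor_maps\<close>, source and target modules may differ: with T(M)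
  as source and M as target module it leads from T(T(M)) to T(M).\<close>

definition mult_maps :: "'r ring \<Rightarrow> ('r, 'm) gmodule \<Rightarrow> ('r, 'n) gmodule
    \<Rightarrow> ('m \<Rightarrow> ('n list \<Rightarrow> 'r) set) list \<Rightarrow> ('m list \<Rightarrow> 'r) set \<Rightarrow> ('n list \<Rightarrow> 'r) set" where
  "mult_maps R M M' fs = tlift_pow R M (TA R M') (length fs)
     (\<lambda>w. foldr (mult (TA R M')) (map2 (\<lambda>f v. f v) fs w) \<one>\<^bsub>TA R M'\<^esub>)"

context tensor_algebra
begin

lemma tlift_pow_linear:
  assumes "module R N" "multilinear R M N (\<lambda>w. if length w = k then f w else \<zero>\<^bsub>N\<^esub>)"
  shows "tlift_pow R M N k f \<in> linear_maps R T N"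
  unfolding tlift_pow_def by (rule tlift_linear[OF assms])

lemma tlift_pow_tens:
  assumes "module R N" "multilinear R M N (\<lambda>w. if length w = k then f w else \<zero>\<^bsub>N\<^esub>)"
    "set w \<subseteq> carrier M"
  shows "tlift_pow R M N k f (tens R M w) = (if length w = k then f w else \<zero>\<^bsub>N\<^esub>)"
  unfolding tlift_pow_def by (rule tlift_tens[OF assms])

lemma bilinear_multilinear:
  assumes N: "module R N" and f: "bilinear R M N f"
  shows "multilinear R M N (\<lambda>w. if length w = 2 then f (w ! 0) (w ! 1) else \<zero>\<^bsub>N\<^esub>)"
proof (rule multilinear_powI[OF N])
  fix w assume "set w \<subseteq> carrier M" "length w = 2"
  then show "f (w ! 0) (w ! 1) \<in> carrier N"
    by (intro bilinear_closed[OF f]) (auto simp: subset_iff)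
next
  fix u v assume *: "set u \<subseteq> carrier M" "set v \<subseteq> carrier M" "2 = Suc (length u + length v)"
  then consider y where "u = []" "v = [y]" | y where "u = [y]" "v = []"
    by (cases u; cases v) auto
  then show "(\<lambda>x. f ((u @ x # v) ! 0) ((u @ x # v) ! 1)) \<in> linear_maps R M N"
    using f * by cases (auto simp: bilinear_def)
qed

lemma tlift2_linear:
  "\<lbrakk>module R N; bilinear R M N f\<rbrakk> \<Longrightarrow> tlift2 R M N f \<in> linear_maps R T N"
  unfolding tlift2_def by (intro tlift_pow_linear bilinear_multilinear)

lemma tlift2_tens:
  "\<lbrakk>module R N; bilinear R M N f; set w \<subseteq> carrier M\<rbrakk>
    \<Longrightarrow> tlift2 R M N f (tens R M w) = (if length w = 2 then f (w ! 0) (w ! 1) else \<zero>\<^bsub>N\<^esub>)"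
  unfolding tlift2_def by (intro tlift_pow_tens bilinear_multilinear)

text \<open>A linear map can be moved under the lift and evaluated on elementary tensors. Composites
  of maps on second tensor powers are computed by applying this in both directions.\<close>

lemma linear_tlift2:
  assumes N: "module R N" and P: "module R P" and f: "bilinear R M N f"
    and G: "G \<in> linear_maps R N P"
    and eq: "\<And>a b. \<lbrakk>a \<in> carrier M; b \<in> carrier M\<rbrakk> \<Longrightarrow> G (f a b) = g a b" and X: "X \<in> carrier T"
  shows "G (tlift2 R M N f X) = tlift2 R M P g X"
proof -
  have g: "bilinear R M P g"
    using bilinear_cong[OF bilinear_comp[OF f G] module_axioms eq] .
  show ?thesis
    by (rule TA_linear_eqI[OF P linear_maps_comp[OF tlift2_linear[OF N f] G]
          tlift2_linear[OF P g] _ X])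
      (auto simp: tlift2_tens[OF N f] tlift2_tens[OF P g] linear_maps_zero[OF N P G] subset_iff
        intro!: eq)
qed

lemma tlift2_mult_bilinear:
  assumes "tensor_algebra R M'" "f \<in> linear_maps R M (TA R M')" "g \<in> linear_maps R M (TA R M')"
  shows "bilinear R M (TA R M') (\<lambda>a b. f a \<otimes>\<^bsub>TA R M'\<^esub> g b)"
proof -
  interpret M': tensor_algebra R M' by fact
  show ?thesis
    unfolding bilinear_def
    by (auto intro!: linear_maps_comp[OF assms(2) M'.TA_mult_r] linear_maps_comp[OF assms(3) M'.TA_mult_l]
        intro: linear_maps_closed[OF assms(2)] linear_maps_closed[OF assms(3)])
qed

lemma mult_maps_multilinear:
  assumes "tensor_algebra R M'" "set fs \<subseteq> linear_maps R M (TA R M')"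
  shows "multilinear R M (TA R M') (\<lambda>w. if length w = length fs
    then foldr (mult (TA R M')) (map2 (\<lambda>f v. f v) fs w) \<one>\<^bsub>TA R M'\<^esub> else \<zero>\<^bsub>TA R M'\<^esub>)"
proof -
  interpret M': tensor_algebra R M' by fact
  let ?p = "\<lambda>fs w. foldr (mult (TA R M')) (map2 (\<lambda>f v. f v) fs w) \<one>\<^bsub>TA R M'\<^esub>"
  have c: "?p fs w \<in> carrier (TA R M')"
    if "set fs \<subseteq> linear_maps R M (TA R M')" "set w \<subseteq> carrier M"
    for fs :: "('m \<Rightarrow> _) list" and w
    using that
  proof (induction fs arbitrary: w)
    case (Cons f fs)
    then show ?case by (cases w) (auto intro: linear_maps_closed[of f])
  qed simp
  show ?thesis
  proof (rule multilinear_powI[OF M'.TA_module])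
    show "?p fs w \<in> carrier (TA R M')" if "set w \<subseteq> carrier M" for w
      using that assms(2) by (intro c)
    fix u v assume "set u \<subseteq> carrier M" "set v \<subseteq> carrier M" "length fs = Suc (length u + length v)"
    then show "(\<lambda>x. ?p fs (u @ x # v)) \<in> linear_maps R M (TA R M')"
      using assms(2)
    proof (induction u arbitrary: fs)
      case Nil
      then obtain f fs' where fs: "fs = f # fs'" by (cases fs) auto
      then show ?case using Nil by (auto intro!: linear_maps_comp[OF _ M'.TA_mult_r] c)
    next
      case (Cons a u)
      then obtain f fs' where fs: "fs = f # fs'" by (cases fs) auto
      have f: "f a \<in> carrier (TA R M')"
        using Cons.prems fs by (auto intro: linear_maps_closed)
      have "(\<lambda>x. ?p fs' (u @ x # v)) \<in> linear_maps R M (TA R M')"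
        using Cons fs by auto
      then show ?case using fs linear_maps_comp[OF _ M'.TA_mult_l[OF f]] by simp
    qed
  qed
qed

lemma mult_maps_linear:
  assumes "tensor_algebra R M'" "set fs \<subseteq> linear_maps R M (TA R M')"
  shows "mult_maps R M M' fs \<in> linear_maps R T (TA R M')"
  unfolding mult_maps_def
  by (rule tlift_pow_linear[OF tensor_algebra.TA_module[OF assms(1)] mult_maps_multilinear[OF assms]])

lemma mult_maps_tens:
  assumes "tensor_algebra R M'" "set fs \<subseteq> linear_maps R M (TA R M')" "set w \<subseteq> carrier M"
  shows "mult_maps R M M' fs (tens R M w) = (if length w = length fs
    then foldr (mult (TA R M')) (map2 (\<lambda>f v. f v) fs w) \<one>\<^bsub>TA R M'\<^esub> else \<zero>\<^bsub>TA R M'\<^esub>)"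
  unfolding mult_maps_def
  by (rule tlift_pow_tens[OF tensor_algebra.TA_module[OF assms(1)] mult_maps_multilinear[OF assms(1,2)] assms(3)])

text \<open>The two ways of bracketing a threefold product of maps. They match the two sides of
  coassociativity, where \<open>Z\<close> is the coproduct of one tensor factor and \<open>c\<close>
  is the other factor.\<close>

lemma mult_maps3:
  assumes M': "tensor_algebra R M'" and f: "f \<in> linear_maps R M (TA R M')"
    and g: "g \<in> linear_maps R M (TA R M')" and h: "h \<in> linear_maps R M (TA R M')"
    and Z: "Z \<in> carrier T" and c: "c \<in> carrier M"
  shows "mult_maps R M M' [f, g, h] (Z \<otimes>\<^bsub>T\<^esub> tens R M [c]) =
      tlift2 R M (TA R M') (\<lambda>a b. f a \<otimes>\<^bsub>TA R M'\<^esub> g b) Z \<otimes>\<^bsub>TA R M'\<^esub> h c" (is ?left)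
    and "mult_maps R M M' [f, g, h] (tens R M [c] \<otimes>\<^bsub>T\<^esub> Z) =
      f c \<otimes>\<^bsub>TA R M'\<^esub> tlift2 R M (TA R M') (\<lambda>a b. g a \<otimes>\<^bsub>TA R M'\<^esub> h b) Z" (is ?right)
proof -
  interpret M': tensor_algebra R M' by fact
  note fg = tlift2_mult_bilinear[OF M' f g] and gh = tlift2_mult_bilinear[OF M' g h]
  have fgh: "set [f, g, h] \<subseteq> linear_maps R M (TA R M')" using f g h by simp
  note G = mult_maps_linear[OF M' fgh]
  note cl = linear_maps_closed[OF f] linear_maps_closed[OF g] linear_maps_closed[OF h]
  note tens = mult_maps_tens[OF M' fgh] tlift2_tens[OF M'.TA_module fg] tlift2_tens[OF M'.TA_module gh]
  have tc: "tens R M [c] \<in> carrier T" using c by simp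
  show ?left
  proof (rule TA_linear_eqI[OF M'.TA_module linear_maps_comp[OF TA_mult_r[OF tc] G]
        linear_maps_comp[OF tlift2_linear[OF M'.TA_module fg] M'.TA_mult_r[OF cl(3)[OF c]]] _ Z])
    fix w assume w: "set w \<subseteq> carrier M"
    show "mult_maps R M M' [f, g, h] (tens R M w \<otimes>\<^bsub>T\<^esub> tens R M [c]) =
        tlift2 R M (TA R M') (\<lambda>a b. f a \<otimes>\<^bsub>TA R M'\<^esub> g b) (tens R M w) \<otimes>\<^bsub>TA R M'\<^esub> h c"
    \<comment> \<open>The threefold map sees only words of length three, so for other lengths of
      \<open>w\<close> both sides are zero.\<close>
    proof (cases "length w = 2")
      case True
      then obtain x y where "w = [x, y]" by (auto simp: length_Suc_conv numeral_2_eq_2)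
      then show ?thesis
        using w c cl by (simp add: tens M'.T.m_assoc flip: tens_append)
    next
      case False
      then show ?thesis
        using w c cl by (simp add: tens flip: tens_append)
    qed
  qed
  show ?right
  proof (rule TA_linear_eqI[OF M'.TA_module linear_maps_comp[OF TA_mult_l[OF tc] G]
        linear_maps_comp[OF tlift2_linear[OF M'.TA_module gh] M'.TA_mult_l[OF cl(1)[OF c]]] _ Z])
    fix w assume w: "set w \<subseteq> carrier M"
    show "mult_maps R M M' [f, g, h] (tens R M [c] \<otimes>\<^bsub>T\<^esub> tens R M w) =
        f c \<otimes>\<^bsub>TA R M'\<^esub> tlift2 R M (TA R M') (\<lambda>a b. g a \<otimes>\<^bsub>TA R M'\<^esub> h b) (tens R M w)"
    proof (cases "length w = 2")
      case True
      then obtain x y where "w = [x, y]" by (auto simp: length_Suc_conv numeral_2_eq_2)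
      then show ?thesis
        using w c cl by (simp add: tens flip: tens_append)
    next
      case False
      then show ?thesis
        using w c cl by (simp add: tens flip: tens_append)
    qed
  qed
qed

lemma tensor_maps_eq: "tensor_maps R M fs = mult_maps R M M fs"
  by (simp add: tensor_maps_def mult_maps_def)

lemmas tensor_maps_linear = mult_maps_linear[OF tensor_algebra_axioms, folded tensor_maps_eq]
lemmas tensor_maps_tens = mult_maps_tens[OF tensor_algebra_axioms, folded tensor_maps_eq]
lemmas tensor_maps3 = mult_maps3[OF tensor_algebra_axioms, folded tensor_maps_eq]

lemma tensor_maps_Cons:
  assumes "f \<in> linear_maps R M T" "set fs \<subseteq> linear_maps R M T" "a \<in> carrier M" "Y \<in> carrier T"
  shows "tensor_maps R M (f # fs) (tens R M [a] \<otimes>\<^bsub>T\<^esub> Y) = f a \<otimes>\<^bsub>T\<^esub> tensor_maps R M fs Y"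
proof (rule TA_linear_eqI[OF TA_module _ _ _ assms(4)])
  have f: "f a \<in> carrier T" using assms by (auto intro: linear_maps_closed)
  have ffs: "set (f # fs) \<subseteq> linear_maps R M T" using assms by simp
  show "(\<lambda>Y. tensor_maps R M (f # fs) (tens R M [a] \<otimes>\<^bsub>T\<^esub> Y)) \<in> linear_maps R T T"
    using assms by (intro linear_maps_comp[OF TA_mult_l tensor_maps_linear[OF ffs]]) auto
  show "(\<lambda>Y. f a \<otimes>\<^bsub>T\<^esub> tensor_maps R M fs Y) \<in> linear_maps R T T"
    using assms f by (intro linear_maps_comp[OF tensor_maps_linear TA_mult_l]) auto
  fix w assume w: "set w \<subseteq> carrier M"
  have "tensor_maps R M (f # fs) (tens R M (a # w)) = f a \<otimes>\<^bsub>T\<^esub> tensor_maps R M fs (tens R M w)"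
    using assms w f tensor_maps_tens[OF ffs, of "a # w"] tensor_maps_tens[OF assms(2) w] by simp
  then show "tensor_maps R M (f # fs) (tens R M [a] \<otimes>\<^bsub>T\<^esub> tens R M w) =
      f a \<otimes>\<^bsub>T\<^esub> tensor_maps R M fs (tens R M w)"
    using w assms(3) by (simp add: tens_Cons[of a w])
qed

lemma mult_bilinear:
  "\<lbrakk>f \<in> linear_maps R M T; g \<in> linear_maps R M T\<rbrakk> \<Longrightarrow> bilinear R M T (\<lambda>a b. f a \<otimes>\<^bsub>T\<^esub> g b)"
  by (rule tlift2_mult_bilinear[OF tensor_algebra_axioms])

lemma id_tensor_multilinear:
  assumes f: "f \<in> linear_maps R M T"
  shows "multilinear R M T (\<lambda>w. if length w = Suc m then tens R M (take m w) \<otimes>\<^bsub>T\<^esub> f (w ! m) else \<zero>\<^bsub>T\<^esub>)"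
proof (rule multilinear_powI[OF TA_module])
  fix w assume w: "set w \<subseteq> carrier M" "length w = Suc m"
  then have "w ! m \<in> carrier M" "set (take m w) \<subseteq> carrier M"
    using set_take_subset[of m w] by (auto simp: subset_iff)
  then show "tens R M (take m w) \<otimes>\<^bsub>T\<^esub> f (w ! m) \<in> carrier T"
    using linear_maps_closed[OF f] by simp
next
  fix u v assume uv: "set u \<subseteq> carrier M" "set v \<subseteq> carrier M" "Suc m = Suc (length u + length v)"
  show "(\<lambda>x. tens R M (take m (u @ x # v)) \<otimes>\<^bsub>T\<^esub> f ((u @ x # v) ! m)) \<in> linear_maps R M T"
  \<comment> \<open>Either the varied letter is the last one, on which \<open>f\<close> acts, or it
    lies in the prefix that is left alone.\<close>
  proof (cases v rule: rev_cases)
    case Nil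
    then show ?thesis
      using uv by (auto intro!: linear_maps_comp[OF f TA_mult_l])
  next
    case (snoc v' y)
    then have "take m (u @ x # v) = u @ x # v'" "(u @ x # v) ! m = y" for x
      using uv by (simp_all add: nth_append)
    then show ?thesis
      using uv snoc linear_maps_closed[OF f, of y]
      by (auto intro!: linear_maps_comp[OF tens_linear TA_mult_r])
  qed
qed

lemma id_tensor_linear: "f \<in> linear_maps R M T \<Longrightarrow> id_tensor R M m f \<in> linear_maps R T T"
  unfolding id_tensor_def by (intro tlift_pow_linear TA_module id_tensor_multilinear)

lemma id_tensor_tens:
  "\<lbrakk>f \<in> linear_maps R M T; set w \<subseteq> carrier M\<rbrakk> \<Longrightarrow> id_tensor R M m f (tens R M w) =
    (if length w = Suc m then tens R M (take m w) \<otimes>\<^bsub>T\<^esub> f (w ! m) else \<zero>\<^bsub>T\<^esub>)"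
  unfolding id_tensor_def by (intro tlift_pow_tens TA_module id_tensor_multilinear)

section \<open>Decomposition of T(M) by word length\<close>

lemma tens_pow_multilinear:
  "multilinear R M T (\<lambda>w. if length w = k then tens R M w else \<zero>\<^bsub>T\<^esub>)"
  by (rule multilinear_powI[OF TA_module]) (auto intro: tens_linear)

lemma tproj_linear: "tproj R M k \<in> linear_maps R T T"
  unfolding tproj_def by (rule tlift_pow_linear[OF TA_module tens_pow_multilinear])

lemma tproj_tens:
  "set w \<subseteq> carrier M \<Longrightarrow> tproj R M k (tens R M w) = (if length w = k then tens R M w else \<zero>\<^bsub>T\<^esub>)"
  unfolding tproj_def by (rule tlift_pow_tens[OF TA_module tens_pow_multilinear])

lemma tproj_closed: "X \<in> carrier T \<Longrightarrow> tproj R M k X \<in> carrier T"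
  by (rule linear_maps_closed[OF tproj_linear])

lemma tproj_tproj: "X \<in> carrier T \<Longrightarrow> tproj R M k (tproj R M k X) = tproj R M k X"
  by (rule TA_linear_eqI[OF TA_module linear_maps_comp[OF tproj_linear tproj_linear] tproj_linear])
    (auto simp: tproj_tens linear_maps_zero[OF TA_module TA_module tproj_linear])

text \<open>The right factor has pure length \<open>j\<close>, so the length of a product word
  determines the length of its left part.\<close>

lemma tproj_mult_r:
  assumes "X \<in> carrier T" "Y \<in> carrier T"
  shows "tproj R M (i + j) (X \<otimes>\<^bsub>T\<^esub> tproj R M j Y) = tproj R M i X \<otimes>\<^bsub>T\<^esub> tproj R M j Y"
proof -
  note z = linear_maps_zero[OF TA_module TA_module tproj_linear]
  have 1: "tproj R M (i + j) (tens R M w \<otimes>\<^bsub>T\<^esub> tproj R M j Y) = tproj R M i (tens R M w) \<otimes>\<^bsub>T\<^esub> tproj R M j Y"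
    if w: "set w \<subseteq> carrier M" for w
    by (rule TA_linear_eqI[OF TA_module
          linear_maps_comp[OF linear_maps_comp[OF tproj_linear TA_mult_l] tproj_linear]
          linear_maps_comp[OF tproj_linear TA_mult_l] _ assms(2)])
      (use w tens_append[of w] in \<open>auto simp: tproj_tens tproj_closed z simp flip: tens_append\<close>)
  show ?thesis
    by (rule TA_linear_eqI[OF TA_module linear_maps_comp[OF TA_mult_r tproj_linear]
          linear_maps_comp[OF tproj_linear TA_mult_r] 1 assms(1)])
      (auto simp: tproj_closed assms)
qed

lemma tproj_mult_l:
  assumes "X \<in> carrier T" "Y \<in> carrier T"
  shows "tproj R M (i + j) (tproj R M i X \<otimes>\<^bsub>T\<^esub> Y) = tproj R M i X \<otimes>\<^bsub>T\<^esub> tproj R M j Y"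
proof -
  note z = linear_maps_zero[OF TA_module TA_module tproj_linear]
  have 1: "tproj R M (i + j) (tproj R M i X \<otimes>\<^bsub>T\<^esub> tens R M w) = tproj R M i X \<otimes>\<^bsub>T\<^esub> tproj R M j (tens R M w)"
    if w: "set w \<subseteq> carrier M" for w
    by (rule TA_linear_eqI[OF TA_module
          linear_maps_comp[OF linear_maps_comp[OF tproj_linear TA_mult_r] tproj_linear]
          linear_maps_comp[OF tproj_linear TA_mult_r] _ assms(1)])
      (use w tens_append[of _ w] in \<open>auto simp: tproj_tens tproj_closed z simp flip: tens_append\<close>)
  show ?thesis
    by (rule TA_linear_eqI[OF TA_module linear_maps_comp[OF TA_mult_l tproj_linear]
          linear_maps_comp[OF tproj_linear TA_mult_l] 1 assms(2)])
      (auto simp: tproj_closed assms)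
qed

text \<open>Every element has only finitely many nonzero components. Phrased as stability of partial
  sums, this passes through an induction over the span by taking the maximum of two bounds.\<close>

lemma tproj_sum:
  assumes "X \<in> carrier T"
  shows "\<exists>n. \<forall>m\<ge>n. (\<Oplus>\<^bsub>T\<^esub> k\<in>{..m}. tproj R M k X) = X"
proof -
  have lin: "(\<lambda>X. \<Oplus>\<^bsub>T\<^esub> k\<in>{..m}. tproj R M k X) \<in> linear_maps R T T" for m
    by (rule linear_maps_finsum_fun[OF TA_module tproj_linear])
  have tens: "(\<Oplus>\<^bsub>T\<^esub> k\<in>{..m}. tproj R M k (tens R M w)) = tens R M w"
    if "set w \<subseteq> carrier M" "length w \<le> m" for m w
  proof -
    have "(\<Oplus>\<^bsub>T\<^esub> k\<in>{..m}. tproj R M k (tens R M w)) =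
        (\<Oplus>\<^bsub>T\<^esub> k\<in>{..m}. if length w = k then tens R M w else \<zero>\<^bsub>T\<^esub>)"
      using that by (intro T.finsum_cong') (auto simp: tproj_tens)
    also have "\<dots> = tens R M w"
      using that by (intro T.finsum_singleton[where f = "\<lambda>_. tens R M w"]) auto
    finally show ?thesis .
  qed
  have "X \<in> lspan R T (tens R M ` lists (carrier M))" using assms TA_lspan by simp
  then show ?thesis
  proof induction
    case zero
    show ?case using linear_maps_zero[OF TA_module TA_module lin] by blast
  next
    case (step r s X)
    then obtain n w where n: "\<And>m. m \<ge> n \<Longrightarrow> (\<Oplus>\<^bsub>T\<^esub> k\<in>{..m}. tproj R M k X) = X"
      and w: "s = tens R M w" "set w \<subseteq> carrier M" by (auto simp: subset_iff)
    have X: "X \<in> carrier T" using step(3) T.lspan_closed tens_subset by blast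
    have "(\<Oplus>\<^bsub>T\<^esub> k\<in>{..m}. tproj R M k (r \<odot>\<^bsub>T\<^esub> s \<oplus>\<^bsub>T\<^esub> X)) = r \<odot>\<^bsub>T\<^esub> s \<oplus>\<^bsub>T\<^esub> X"
      if "m \<ge> max n (length w)" for m
      using that step(1) w X n[of m] tens[of w m]
      by (simp add: linear_maps_add[OF lin] linear_maps_smult[OF lin])
    then show ?case by blast
  qed
qed

lemma tproj_sum_finite:
  assumes X: "X \<in> carrier T" and A: "finite A" and z: "\<And>k. k \<notin> A \<Longrightarrow> tproj R M k X = \<zero>\<^bsub>T\<^esub>"
  shows "X = (\<Oplus>\<^bsub>T\<^esub> k\<in>A. tproj R M k X)"
proof -
  obtain n where n: "\<And>m. m \<ge> n \<Longrightarrow> (\<Oplus>\<^bsub>T\<^esub> k\<in>{..m}. tproj R M k X) = X"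
    using tproj_sum[OF X] by blast
  obtain m where m: "m \<ge> n" "A \<subseteq> {..m}"
    using A by (metis atMost_iff finite_nat_set_iff_bounded_le max.bounded_iff max.cobounded1 subset_iff
        max.cobounded2 order.trans)
  have "(\<Oplus>\<^bsub>T\<^esub> k\<in>A. tproj R M k X) = (\<Oplus>\<^bsub>T\<^esub> k\<in>{..m}. tproj R M k X)"
    using m z X by (intro T.add.finprod_mono_neutral_cong_left) (auto simp: tproj_closed)
  then show ?thesis using n m by simp
qed

end

section \<open>Iterates of a coassociative map\<close>

lemma (in abelian_group) sg_closed [simp]: "x \<in> carrier G \<Longrightarrow> sg G k x \<in> carrier G"
  by (simp add: sg_def)

lemma (in abelian_group) sg_sg: "x \<in> carrier G \<Longrightarrow> sg G k (sg G l x) = sg G (k + l) x"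
  by (simp add: sg_def)

lemma (in abelian_group) sg_zero [simp]: "sg G k \<zero> = \<zero>"
  by (simp add: sg_def)

lemma (in ring) sg_mult:
  "\<lbrakk>x \<in> carrier R; y \<in> carrier R\<rbrakk> \<Longrightarrow> sg R k x \<otimes> sg R l y = sg R (k + l) (x \<otimes> y)"
  by (simp add: sg_def l_minus r_minus)

lemma sg_0: "sg G 0 x = x"
  by (simp add: sg_def)

lemma sg_linear: "module R M \<Longrightarrow> sg M k \<in> linear_maps R M M"
  unfolding sg_def
  by (rule linear_mapsI) (auto simp: module.smult_r_minus abelian_group.minus_add module_def
      dest: abelian_group.a_inv_closed)

lemma composition_all_ones:
  assumes "ns \<in> compositions s n" "\<And>k. k \<in> set ns \<Longrightarrow> \<not> 2 \<le> k"
  shows "s = n" "ns = replicate n 1"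
proof -
  have "k = 1" if "k \<in> set ns" for k
    using assms that by (force simp: compositions_def)
  then have "ns = replicate s 1"
    using assms(1) by (auto simp: compositions_def intro: replicate_eqI)
  moreover from this have "sum_list ns = s" by (simp add: sum_list_replicate)
  ultimately show "s = n" "ns = replicate n 1" using assms(1) by (auto simp: compositions_def)
qed

lemma finite_compositions: "finite (compositions s n)"
proof (rule finite_subset)
  show "compositions s n \<subseteq> {ns. set ns \<subseteq> {..n} \<and> length ns = s}"
    using member_le_sum_list by (fastforce simp: compositions_def)
  show "finite {ns. set ns \<subseteq> {..n} \<and> length ns = s}"
    by (rule finite_lists_length_eq) simp
qed

text \<open>The condition \<open>e_pow\<close> places the values of \<open>e\<close> in the second
  tensor power by means of the linear idempotent \<open>tproj\<close>; unlike membership in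
  \<open>tpow\<close> this is an equation that can be rewritten with.\<close>

locale coassociative_map = tensor_algebra R M for R :: "'r ring" (structure) and M :: "('r, 'm) gmodule" +
  fixes e :: "'m \<Rightarrow> ('m list \<Rightarrow> 'r) set"
  assumes e_linear: "e \<in> linear_maps R M T"
    and e_pow: "x \<in> carrier M \<Longrightarrow> tproj R M 2 (e x) = e x"
    and e_coassoc: "x \<in> carrier M \<Longrightarrow>
      tlift2 R M T (\<lambda>a b. e a \<otimes>\<^bsub>T\<^esub> tens R M [b]) (e x) =
      tlift2 R M T (\<lambda>a b. tens R M [a] \<otimes>\<^bsub>T\<^esub> e b) (e x)"
begin

text \<open>\<open>D n\<close> takes values in the tensor power with exponent \<open>n + 1\<close>.\<close>

primrec D :: "nat \<Rightarrow> 'm \<Rightarrow> ('m list \<Rightarrow> 'r) set" where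
  "D 0 x = tens R M [x]"
| "D (Suc n) x = tlift2 R M T (\<lambda>a b. tens R M [a] \<otimes>\<^bsub>T\<^esub> D n b) (e x)"

lemma e_closed [simp]: "x \<in> carrier M \<Longrightarrow> e x \<in> carrier T"
  by (rule linear_maps_closed[OF e_linear])

lemma D_linear: "D n \<in> linear_maps R M T"
proof (induction n)
  case 0
  then show ?case using tens_singleton_linear by simp
next
  case (Suc n)
  show ?case
    using linear_maps_comp[OF e_linear tlift2_linear[OF TA_module mult_bilinear[OF tens_singleton_linear Suc]]]
    by simp
qed

lemma D_closed [simp]: "x \<in> carrier M \<Longrightarrow> D n x \<in> carrier T"
  by (rule linear_maps_closed[OF D_linear])

text \<open>In the induction step the left factor is (1 \<otimes> D m) e, so the expression is (1
  \<otimes> D m \<otimes> D n)(e \<otimes> 1) e. Coassociativity replaces (e \<otimes> 1) e by (1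
  \<otimes> e) e, and the induction hypothesis applies to the last two factors.\<close>

lemma D_split: "x \<in> carrier M \<Longrightarrow>
  tlift2 R M T (\<lambda>a b. D m a \<otimes>\<^bsub>T\<^esub> D n b) (e x) = D (Suc (m + n)) x"
proof (induction m arbitrary: x)
  case 0
  then show ?case by simp
next
  case (Suc m)
  let ?G = "tensor_maps R M [\<lambda>x. tens R M [x], D m, D n]"
  note t = tens_singleton_linear
  have G: "?G \<in> linear_maps R T T"
    by (rule tensor_maps_linear) (auto simp: D_linear t)
  have "tlift2 R M T (\<lambda>a b. D (Suc m) a \<otimes>\<^bsub>T\<^esub> D n b) (e x) =
      ?G (tlift2 R M T (\<lambda>a b. e a \<otimes>\<^bsub>T\<^esub> tens R M [b]) (e x))"
    by (rule linear_tlift2[OF TA_module TA_module mult_bilinear[OF e_linear t] G, symmetric])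
      (use Suc.prems in \<open>simp_all add: tensor_maps3[OF t D_linear D_linear]\<close>)
  also have "\<dots> = ?G (tlift2 R M T (\<lambda>a b. tens R M [a] \<otimes>\<^bsub>T\<^esub> e b) (e x))"
    using Suc.prems by (simp add: e_coassoc)
  also have "\<dots> = tlift2 R M T (\<lambda>a b. tens R M [a] \<otimes>\<^bsub>T\<^esub> D (Suc (m + n)) b) (e x)"
    by (rule linear_tlift2[OF TA_module TA_module mult_bilinear[OF t e_linear] G])
      (use Suc.prems in \<open>simp_all add: tensor_maps3[OF t D_linear D_linear] Suc.IH del: D.simps\<close>)
  finally show ?case by simp
qed

text \<open>General coassociativity: iterated coproducts substituted into an iterated coproduct give
  a longer one. The first block is separated by \<open>D_split\<close>, and the exponents of the
  signs add up to the sum of \<open>ns\<close>.\<close>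

lemma tensor_maps_D:
  assumes "\<And>n. n \<in> set ns \<Longrightarrow> f n \<in> linear_maps R M T"
    and "\<And>n x. \<lbrakk>n \<in> set ns; x \<in> carrier M\<rbrakk> \<Longrightarrow> f n x = sg T (int n) (D (n - 1) x)"
    and "\<And>n. n \<in> set ns \<Longrightarrow> 1 \<le> n" and "ns \<noteq> []" "x \<in> carrier M"
  shows "tensor_maps R M (map f ns) (D (length ns - 1) x) =
    sg T (int (sum_list ns)) (D (sum_list ns - 1) x)"
  using assms
proof (induction ns arbitrary: x)
  case (Cons n ns)
  let ?s = "sum_list ns"
  have f: "f n \<in> linear_maps R M T" "set (map f ns) \<subseteq> linear_maps R M T"
    using Cons.prems(1) by auto
  show ?case
  proof (cases "ns = []")
    case True
    have fn: "f n x \<in> carrier T" using linear_maps_closed[OF f(1)] Cons.prems(5) .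
    have "tensor_maps R M [f n] (tens R M [x]) = f n x \<otimes>\<^bsub>T\<^esub> \<one>\<^bsub>T\<^esub>"
      using Cons.prems(5) f(1) by (subst tensor_maps_tens) auto
    then show ?thesis using True Cons.prems fn by simp
  next
    case False
    \<comment> \<open>Blocks with \<open>n\<close> and \<open>?s\<close> factors carry the indices
      \<open>n - 1\<close> and \<open>?s - 1\<close> of \<open>D\<close>; truncated subtraction is
      harmless as both numbers are positive.\<close>
    have split: "Suc ((n - 1) + (?s - 1)) = n + ?s - 1" if "1 \<le> n" "1 \<le> ?s"
      using that by simp
    have "1 \<le> hd ns" using False Cons.prems(3)[of "hd ns"] by simp
    then have s: "1 \<le> ?s" "1 \<le> n"
      using False Cons.prems(3)[of n] member_le_sum_list[of "hd ns" ns] by auto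
    obtain l where l: "length ns = Suc l" using False by (cases ns) auto
    have lin: "tensor_maps R M (f n # map f ns) \<in> linear_maps R T T"
      using f by (intro tensor_maps_linear) auto
    have IH: "tensor_maps R M (map f ns) (D l b) = sg T (int ?s) (D (?s - 1) b)"
      if "b \<in> carrier M" for b
      using Cons.IH[OF _ _ _ False that] Cons.prems(1-3) l by (simp del: D.simps)
    have "tensor_maps R M (f n # map f ns) (D (Suc l) x) =
      tlift2 R M T (\<lambda>a b. sg T (int (n + ?s)) (D (n - 1) a \<otimes>\<^bsub>T\<^esub> D (?s - 1) b)) (e x)"
      unfolding D.simps
      by (rule linear_tlift2[OF TA_module TA_module mult_bilinear[OF tens_singleton_linear D_linear] lin])
        (use Cons.prems(2,5) in \<open>simp_all add: tensor_maps_Cons[OF f] IH T.sg_mult\<close>)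
    also have "\<dots> = sg T (int (n + ?s)) (tlift2 R M T (\<lambda>a b. D (n - 1) a \<otimes>\<^bsub>T\<^esub> D (?s - 1) b) (e x))"
      by (rule linear_tlift2[OF TA_module TA_module mult_bilinear[OF D_linear D_linear]
            sg_linear[OF TA_module], symmetric]) (use Cons.prems(5) in simp_all)
    also have "\<dots> = sg T (int (n + ?s)) (D (n + ?s - 1) x)"
      using D_split[OF Cons.prems(5), of "n - 1" "?s - 1"] s
      by (simp only: split)
    finally show ?thesis using l by simp
  qed
qed simp

lemma id_tensor_mult:
  assumes g: "g \<in> linear_maps R M T" and u: "set u \<subseteq> carrier M" and Y: "Y \<in> carrier T"
  shows "id_tensor R M (Suc (length u)) g (tens R M u \<otimes>\<^bsub>T\<^esub> Y) =
    tens R M u \<otimes>\<^bsub>T\<^esub> tlift2 R M T (\<lambda>a b. tens R M [a] \<otimes>\<^bsub>T\<^esub> g b) Y"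
proof (rule TA_linear_eqI[OF TA_module _ _ _ Y])
  note b = mult_bilinear[OF tens_singleton_linear g]
  have tu: "tens R M u \<in> carrier T" using u by simp
  show "(\<lambda>Y. id_tensor R M (Suc (length u)) g (tens R M u \<otimes>\<^bsub>T\<^esub> Y)) \<in> linear_maps R T T"
    by (rule linear_maps_comp[OF TA_mult_l[OF tu] id_tensor_linear[OF g]])
  show "(\<lambda>Y. tens R M u \<otimes>\<^bsub>T\<^esub> tlift2 R M T (\<lambda>a b. tens R M [a] \<otimes>\<^bsub>T\<^esub> g b) Y) \<in> linear_maps R T T"
    by (rule linear_maps_comp[OF tlift2_linear[OF TA_module b] TA_mult_l[OF tu]])
  fix w assume w: "set w \<subseteq> carrier M"
  have *: "tens R M u \<otimes>\<^bsub>T\<^esub> tens R M w = tens R M (u @ w)" using u w by (simp add: tens_append)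
  show "id_tensor R M (Suc (length u)) g (tens R M u \<otimes>\<^bsub>T\<^esub> tens R M w) =
      tens R M u \<otimes>\<^bsub>T\<^esub> tlift2 R M T (\<lambda>a b. tens R M [a] \<otimes>\<^bsub>T\<^esub> g b) (tens R M w)"
  proof (cases "length w = 2")
    case True
    then obtain x y where xy: "w = [x, y]" by (auto simp: length_Suc_conv numeral_2_eq_2)
    then have "tens R M (u @ [x]) \<otimes>\<^bsub>T\<^esub> g y = tens R M u \<otimes>\<^bsub>T\<^esub> (tens R M [x] \<otimes>\<^bsub>T\<^esub> g y)"
      using u w linear_maps_closed[OF g, of y] by (simp add: tens_append T.m_assoc)
    then show ?thesis
      unfolding * using u w xy by (simp add: id_tensor_tens[OF g] tlift2_tens[OF TA_module b] nth_append)
  next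
    case False
    then show ?thesis
      unfolding * using u w by (simp add: id_tensor_tens[OF g] tlift2_tens[OF TA_module b])
  qed
qed

text \<open>This is the recursion D (k + 1) = (1 \<otimes> D k) e, applied to the last of m + 1
  tensor factors.\<close>

lemma id_tensor_comp_e:
  assumes X: "X \<in> carrier T"
  shows "id_tensor R M (Suc m) (D k) (id_tensor R M m e X) = id_tensor R M m (D (Suc k)) X"
proof (rule TA_linear_eqI[OF TA_module linear_maps_comp[OF id_tensor_linear[OF e_linear]
        id_tensor_linear[OF D_linear]] id_tensor_linear[OF D_linear] _ X])
  fix w assume w: "set w \<subseteq> carrier M"
  show "id_tensor R M (Suc m) (D k) (id_tensor R M m e (tens R M w)) = id_tensor R M m (D (Suc k)) (tens R M w)"
  proof (cases "length w = Suc m")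
    case True
    have u: "set (take m w) \<subseteq> carrier M" "length (take m w) = m" "w ! m \<in> carrier M"
      using w True set_take_subset[of m w] by (auto simp: subset_iff)
    then show ?thesis
      using True w id_tensor_mult[OF D_linear u(1) e_closed[OF u(3)], of k]
      by (simp add: id_tensor_tens[OF e_linear] id_tensor_tens[OF D_linear] del: D.simps)
        (simp add: True)
  next
    case False
    then show ?thesis
      using w by (simp add: id_tensor_tens[OF e_linear] id_tensor_tens[OF D_linear]
          linear_maps_zero[OF TA_module TA_module id_tensor_linear[OF D_linear]] del: D.simps)
  qed
qed

text \<open>A projection appears instead of the identity because \<open>id_tensor\<close> is
  extended by zero to words of other lengths.\<close>

lemma id_tensor_D0:
  assumes X: "X \<in> carrier T" shows "id_tensor R M m (D 0) X = tproj R M (Suc m) X"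
proof (rule TA_linear_eqI[OF TA_module id_tensor_linear[OF D_linear] tproj_linear _ X])
  fix w assume w: "set w \<subseteq> carrier M"
  show "id_tensor R M m (D 0) (tens R M w) = tproj R M (Suc m) (tens R M w)"
  proof (cases "length w = Suc m")
    case True
    then obtain u x where "w = u @ [x]" "length u = m" by (cases w rule: rev_cases) auto
    then show ?thesis
      using w id_tensor_tens[OF D_linear w, of m 0] tproj_tens[OF w, of "Suc m"]
      by (simp add: tens_append nth_append)
  next
    case False
    then show ?thesis using w by (simp add: id_tensor_tens[OF D_linear] tproj_tens)
  qed
qed

lemma tproj_id_tensor_e:
  assumes X: "X \<in> carrier T"
  shows "tproj R M (Suc (Suc m)) (id_tensor R M m e X) = id_tensor R M m e X"
proof (rule TA_linear_eqI[OF TA_module linear_maps_comp[OF id_tensor_linear[OF e_linear] tproj_linear]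
        id_tensor_linear[OF e_linear] _ X])
  fix w assume w: "set w \<subseteq> carrier M"
  show "tproj R M (Suc (Suc m)) (id_tensor R M m e (tens R M w)) = id_tensor R M m e (tens R M w)"
  proof (cases "length w = Suc m")
    case True
    have u: "set (take m w) \<subseteq> carrier M" "length (take m w) = m" "w ! m \<in> carrier M"
      using w True set_take_subset[of m w] by (auto simp: subset_iff)
    then show ?thesis
      using True w tproj_mult_l[OF tens_closed[OF u(1)] e_closed[OF u(3)], of m 2]
      by (simp add: id_tensor_tens[OF e_linear] tproj_tens e_pow)
  next
    case False
    then show ?thesis
      using w by (simp add: id_tensor_tens[OF e_linear] linear_maps_zero[OF TA_module TA_module tproj_linear])
  qed
qed

section \<open>The maps F^n when E^(k,1) vanishes for k >= 2\<close>

context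
  fixes E :: "nat \<Rightarrow> 'm \<Rightarrow> ('m list \<Rightarrow> 'r) set"
  assumes E_1: "E 1 = e" and E_ge2: "\<forall>k\<ge>2. \<forall>x\<in>carrier M. E k x = \<zero>\<^bsub>T\<^esub>"
begin

lemma E_ge2_zero: "\<lbrakk>2 \<le> k; x \<in> carrier M\<rbrakk> \<Longrightarrow> E k x = \<zero>\<^bsub>T\<^esub>"
  using E_ge2 by blast

lemma E_linear: "1 \<le> k \<Longrightarrow> E k \<in> linear_maps R M T"
  using E_1 E_ge2_zero e_linear linear_maps_cong[OF linear_maps_const_zero[OF TA_module] module_axioms, of "E k"]
  by (cases "k = 1") (auto simp del: One_nat_def)

lemma E_chain_closed: "\<lbrakk>X \<in> carrier T; \<forall>k\<in>set ks. 1 \<le> k\<rbrakk> \<Longrightarrow> E_chain R M E m ks X \<in> carrier T"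
  by (induction ks arbitrary: m X)
    (simp_all del: One_nat_def add: linear_maps_closed[OF id_tensor_linear[OF E_linear]])

lemma E_chain_zero: "\<forall>k\<in>set ks. 1 \<le> k \<Longrightarrow> E_chain R M E m ks \<zero>\<^bsub>T\<^esub> = \<zero>\<^bsub>T\<^esub>"
  by (induction ks arbitrary: m)
    (auto simp del: One_nat_def simp: linear_maps_zero[OF TA_module TA_module id_tensor_linear[OF E_linear]])

text \<open>One part >= 2 makes a link of the chain zero, and the later links, being linear, keep it
  zero.\<close>

lemma E_chain_vanish:
  assumes "X \<in> carrier T" "\<forall>k\<in>set ks. 1 \<le> k" "k \<in> set ks" "2 \<le> k"
  shows "E_chain R M E m ks X = \<zero>\<^bsub>T\<^esub>"
  using assms
proof (induction ks arbitrary: m X)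
  case (Cons k' ks)
  have k': "E k' \<in> linear_maps R M T" using Cons.prems by (intro E_linear) auto
  show ?case
  proof (cases "2 \<le> k'")
    case True
    have "id_tensor R M m (E k') X = \<zero>\<^bsub>T\<^esub>"
    proof (rule TA_linear_eqI[OF TA_module id_tensor_linear[OF k'] linear_maps_const_zero[OF TA_module] _ Cons.prems(1)])
      fix w assume w: "set w \<subseteq> carrier M"
      show "id_tensor R M m (E k') (tens R M w) = \<zero>\<^bsub>T\<^esub>"
        using w True set_take_subset[of m w]
        by (auto simp: id_tensor_tens[OF k'] E_ge2_zero subset_iff intro!: T.r_null tens_closed)
    qed
    then show ?thesis using Cons.prems E_chain_zero by simp
  next
    case False
    then have "k \<in> set ks" using Cons.prems by auto
    then show ?thesis
      using Cons.prems Cons.IH[of "id_tensor R M m (E k') X" "m + k'"]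
        linear_maps_closed[OF id_tensor_linear[OF k'] Cons.prems(1)] by simp
  qed
qed simp

text \<open>The condition on the length of \<open>X\<close> comes from the empty chain, which is the
  identity, while \<open>id_tensor R M m (D 0)\<close> is a projection.\<close>

lemma E_chain_ones:
  "\<lbrakk>X \<in> carrier T; tproj R M (Suc m) X = X\<rbrakk>
    \<Longrightarrow> E_chain R M E m (replicate k 1) X = id_tensor R M m (D k) X"
proof (induction k arbitrary: m X)
  case 0
  then show ?case using id_tensor_D0[of X m] by (simp del: D.simps)
next
  case (Suc k)
  have "E_chain R M E m (replicate (Suc k) 1) X = E_chain R M E (Suc m) (replicate k 1) (id_tensor R M m e X)"
    using E_1 by simp
  also have "\<dots> = id_tensor R M (Suc m) (D k) (id_tensor R M m e X)"
    using Suc.prems linear_maps_closed[OF id_tensor_linear[OF e_linear]]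
    by (intro Suc.IH) (auto simp: tproj_id_tensor_e)
  also have "\<dots> = id_tensor R M m (D (Suc k)) X"
    using Suc.prems by (intro id_tensor_comp_e)
  finally show ?case .
qed

text \<open>Only the composition of n - 1 into ones survives. It has s = n - 1 parts, so its sign
  (-1)^(s+1) equals (-1)^n; for n = 1 the sign is the one in F^1 = -Id.\<close>

lemma Fmap_eq:
  assumes n: "1 \<le> n" and x: "x \<in> carrier M"
  shows "Fmap R M E n x = sg T (int n) (D (n - 1) x)"
proof (cases "n = 1")
  case True
  then show ?thesis by (simp add: Fmap_def sg_def)
next
  case False
  let ?N = "n - 1"
  have N: "1 \<le> ?N" using n False by simp
  let ?c = "\<lambda>s ns. sg T (int s + 1) (E_chain R M E 0 ns (tens R M [x]))"
  have tx: "tens R M [x] \<in> carrier T" using x by simp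
  have "(\<Oplus>\<^bsub>T\<^esub> ns\<in>compositions s ?N. ?c s ns) =
      (if ?N = s then sg T (int n) (D ?N x) else \<zero>\<^bsub>T\<^esub>)" for s
  proof (cases "?N = s")
    case True
    have sub: "{replicate ?N 1} \<subseteq> compositions s ?N"
      using True by (auto simp: compositions_def sum_list_replicate)
    have "(\<Oplus>\<^bsub>T\<^esub> ns\<in>compositions s ?N. ?c s ns) = (\<Oplus>\<^bsub>T\<^esub> ns\<in>{replicate ?N 1}. ?c s ns)"
    proof (rule T.add.finprod_mono_neutral_cong_right[OF finite_compositions sub])
      fix ns assume ns: "ns \<in> compositions s ?N - {replicate ?N 1}"
      then obtain k where "k \<in> set ns" "2 \<le> k" using composition_all_ones(2)[of ns s ?N] by auto
      then show "?c s ns = \<zero>\<^bsub>T\<^esub>"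
        using ns E_chain_vanish[OF tx] by (auto simp: compositions_def)
    qed (auto simp: compositions_def tx E_chain_closed)
    also have "\<dots> = ?c s (replicate ?N 1)"
      using tx by (subst T.finsum_insert) (auto simp: E_chain_closed)
    also have "E_chain R M E 0 (replicate ?N 1) (tens R M [x]) = D ?N x"
      using x by (subst E_chain_ones) (auto simp: tproj_tens id_tensor_tens[OF D_linear] tens_Nil)
    finally have "(\<Oplus>\<^bsub>T\<^esub> ns\<in>compositions s ?N. ?c s ns) = sg T (int s + 1) (D ?N x)" .
    moreover have "int s + 1 = int n" using True n by linarith
    ultimately show ?thesis using True by metis
  next
    case False
    have "?c s ns = \<zero>\<^bsub>T\<^esub>" if ns: "ns \<in> compositions s ?N" for ns
    proof -
      obtain k where "k \<in> set ns" "2 \<le> k" using composition_all_ones(1)[of ns s ?N] False ns by auto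
      then show "?c s ns = \<zero>\<^bsub>T\<^esub>"
        using ns E_chain_vanish[OF tx] by (auto simp: compositions_def)
    qed
    then show ?thesis using False by (simp add: T.add.finprod_one_eqI)
  qed
  then have "Fmap R M E n x = (\<Oplus>\<^bsub>T\<^esub> s\<in>{1..?N}. if ?N = s then sg T (int n) (D ?N x) else \<zero>\<^bsub>T\<^esub>)"
    using False by (simp add: Fmap_def)
  also have "\<dots> = sg T (int n) (D ?N x)"
    using N x by (intro T.finsum_singleton[where f = "\<lambda>_. sg T (int n) (D ?N x)"]) auto
  finally show ?thesis .
qed

lemma Fmap_linear: "1 \<le> n \<Longrightarrow> Fmap R M E n \<in> linear_maps R M T"
  by (rule linear_maps_cong[OF linear_maps_comp[OF D_linear[of "n - 1"] sg_linear[OF TA_module]] module_axioms])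
    (simp add: Fmap_eq)

text \<open>The inner map F^s contributes (-1)^s, and the outer maps together contribute
  (-1)^n.\<close>

lemma tensor_maps_Fmap:
  assumes ns: "ns \<in> compositions s n" and s: "1 \<le> s" and x: "x \<in> carrier M"
  shows "tensor_maps R M (map (Fmap R M E) ns) (Fmap R M E s x) = sg T (int n + int s) (D (n - 1) x)"
proof -
  have ns': "ns \<noteq> []" "\<And>n. n \<in> set ns \<Longrightarrow> 1 \<le> n" "length ns = s" "sum_list ns = n"
    using ns s by (auto simp: compositions_def)
  have lin: "tensor_maps R M (map (Fmap R M E) ns) \<in> linear_maps R T T"
    using ns'(2) by (intro tensor_maps_linear) (auto intro: Fmap_linear)
  have "tensor_maps R M (map (Fmap R M E) ns) (Fmap R M E s x) =
      sg T (int s) (tensor_maps R M (map (Fmap R M E) ns) (D (s - 1) x))"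
    using s x by (simp add: Fmap_eq linear_maps_sg[OF TA_module TA_module lin])
  also have "tensor_maps R M (map (Fmap R M E) ns) (D (s - 1) x) = sg T (int n) (D (n - 1) x)"
    using tensor_maps_D[of ns "Fmap R M E" x] Fmap_linear Fmap_eq ns' x by simp
  finally show ?thesis using x by (simp add: T.sg_sg add.commute)
qed

end

end

section \<open>Homogeneous components\<close>

context graded_module
begin

lemma gpart_closed: "x \<in> gpart M n \<Longrightarrow> x \<in> carrier M"
  using submoduleE(1)[OF gpart_submodule] by blast

lemma gpart_zero [simp]: "\<zero>\<^bsub>M\<^esub> \<in> gpart M n"
  using subgroup.one_closed[OF submodule.axioms(1)[OF gpart_submodule]] by simp

text \<open>Components of a sum or a multiple may cancel, so a decomposition has to be recognised
  from a sum over more indices than its support.\<close>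

lemma hdecomp_superset:
  assumes "\<And>n. f n \<in> gpart M n" "finite A" "{n. f n \<noteq> \<zero>\<^bsub>M\<^esub>} \<subseteq> A"
  shows "hdecomp M (\<Oplus>\<^bsub>M\<^esub> n\<in>A. f n) f"
  unfolding hdecomp_def
proof (intro conjI allI)
  show "(\<Oplus>\<^bsub>M\<^esub> n\<in>A. f n) = (\<Oplus>\<^bsub>M\<^esub> n\<in>{n. f n \<noteq> \<zero>\<^bsub>M\<^esub>}. f n)"
    using assms gpart_closed by (intro M.add.finprod_mono_neutral_cong_right) auto
qed (use assms finite_subset in auto)

lemma hdecomp_hcomp: "x \<in> carrier M \<Longrightarrow> hdecomp M x (\<lambda>n. hcomp M n x)"
  using theI'[OF direct_sum] by (simp add: hcomp_def)

lemma hcomp_unique: "\<lbrakk>x \<in> carrier M; hdecomp M x f\<rbrakk> \<Longrightarrow> hcomp M n x = f n"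
  using direct_sum[of x] hdecomp_hcomp[of x] by metis

lemma hcomp_gpart: "x \<in> carrier M \<Longrightarrow> hcomp M n x \<in> gpart M n"
  using hdecomp_hcomp by (simp add: hdecomp_def)

lemma hcomp_closed [simp]: "x \<in> carrier M \<Longrightarrow> hcomp M n x \<in> carrier M"
  using hcomp_gpart gpart_closed by blast

lemma hcomp_finite: "x \<in> carrier M \<Longrightarrow> finite {n. hcomp M n x \<noteq> \<zero>\<^bsub>M\<^esub>}"
  using hdecomp_hcomp by (simp add: hdecomp_def)

lemma hcomp_sum:
  assumes x: "x \<in> carrier M" and A: "finite A" "{n. hcomp M n x \<noteq> \<zero>\<^bsub>M\<^esub>} \<subseteq> A"
  shows "x = (\<Oplus>\<^bsub>M\<^esub> n\<in>A. hcomp M n x)"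
proof -
  have "x = (\<Oplus>\<^bsub>M\<^esub> n\<in>{n. hcomp M n x \<noteq> \<zero>\<^bsub>M\<^esub>}. hcomp M n x)"
    using hdecomp_hcomp[OF x] by (simp add: hdecomp_def)
  also have "\<dots> = (\<Oplus>\<^bsub>M\<^esub> n\<in>A. hcomp M n x)"
    using A x by (intro M.add.finprod_mono_neutral_cong_left) auto
  finally show ?thesis .
qed

text \<open>Componentwise sums and multiples are again homogeneous decompositions, and
  decompositions are unique.\<close>

lemma hcomp_linear: "hcomp M n \<in> linear_maps R M M"
proof (rule linear_mapsI)
  note sub = submoduleE[OF gpart_submodule]
  fix x assume x: "x \<in> carrier M"
  then show "hcomp M n x \<in> carrier M" by simp
  {
    fix y assume y: "y \<in> carrier M"
    let ?A = "{n. hcomp M n x \<noteq> \<zero>\<^bsub>M\<^esub>} \<union> {n. hcomp M n y \<noteq> \<zero>\<^bsub>M\<^esub>}"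
    have A: "finite ?A" using x y by (simp add: hcomp_finite)
    have "x \<oplus>\<^bsub>M\<^esub> y = (\<Oplus>\<^bsub>M\<^esub> n\<in>?A. hcomp M n x) \<oplus>\<^bsub>M\<^esub> (\<Oplus>\<^bsub>M\<^esub> n\<in>?A. hcomp M n y)"
      using hcomp_sum[OF x A] hcomp_sum[OF y A] by auto
    also have "\<dots> = (\<Oplus>\<^bsub>M\<^esub> n\<in>?A. hcomp M n x \<oplus>\<^bsub>M\<^esub> hcomp M n y)"
      using x y by (intro M.finsum_addf[symmetric]) auto
    finally have eq: "x \<oplus>\<^bsub>M\<^esub> y = (\<Oplus>\<^bsub>M\<^esub> n\<in>?A. hcomp M n x \<oplus>\<^bsub>M\<^esub> hcomp M n y)" .
    have "hdecomp M (x \<oplus>\<^bsub>M\<^esub> y) (\<lambda>n. hcomp M n x \<oplus>\<^bsub>M\<^esub> hcomp M n y)"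
      unfolding eq using x y
      by (intro hdecomp_superset A sub(5) hcomp_gpart) auto
    then show "hcomp M n (x \<oplus>\<^bsub>M\<^esub> y) = hcomp M n x \<oplus>\<^bsub>M\<^esub> hcomp M n y"
      using x y by (intro hcomp_unique) auto
  next
    fix r assume r: "r \<in> carrier R"
    let ?A = "{n. hcomp M n x \<noteq> \<zero>\<^bsub>M\<^esub>}"
    have A: "finite ?A" using x by (simp add: hcomp_finite)
    have "r \<odot>\<^bsub>M\<^esub> x = r \<odot>\<^bsub>M\<^esub> (\<Oplus>\<^bsub>M\<^esub> n\<in>?A. hcomp M n x)"
      using hcomp_sum[OF x A] by auto
    also have "\<dots> = (\<Oplus>\<^bsub>M\<^esub> n\<in>?A. r \<odot>\<^bsub>M\<^esub> hcomp M n x)"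
      using x r A by (intro finsum_smult_ldistr) auto
    finally have eq: "r \<odot>\<^bsub>M\<^esub> x = (\<Oplus>\<^bsub>M\<^esub> n\<in>?A. r \<odot>\<^bsub>M\<^esub> hcomp M n x)" .
    have "hdecomp M (r \<odot>\<^bsub>M\<^esub> x) (\<lambda>n. r \<odot>\<^bsub>M\<^esub> hcomp M n x)"
      unfolding eq using x r
      by (intro hdecomp_superset A sub(4) hcomp_gpart) auto
    then show "hcomp M n (r \<odot>\<^bsub>M\<^esub> x) = r \<odot>\<^bsub>M\<^esub> hcomp M n x"
      using x r by (intro hcomp_unique) auto
  }
qed

lemma hcomp_homogeneous:
  assumes "x \<in> gpart M a" shows "hcomp M n x = (if n = a then x else \<zero>\<^bsub>M\<^esub>)"
proof -
  have x: "x \<in> carrier M" using assms gpart_closed by blast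
  have "hdecomp M (\<Oplus>\<^bsub>M\<^esub> n\<in>{a}. if n = a then x else \<zero>\<^bsub>M\<^esub>) (\<lambda>n. if n = a then x else \<zero>\<^bsub>M\<^esub>)"
    using assms by (intro hdecomp_superset) auto
  moreover have "(\<Oplus>\<^bsub>M\<^esub> n\<in>{a}. if n = a then x else \<zero>\<^bsub>M\<^esub>) = x" using x by simp
  ultimately have "hdecomp M x (\<lambda>n. if n = a then x else \<zero>\<^bsub>M\<^esub>)" by simp
  then show ?thesis by (rule hcomp_unique[OF x])
qed

lemma gparts_lspan: "x \<in> carrier M \<Longrightarrow> x \<in> lspan R M (\<Union>n. gpart M n)"
proof -
  assume x: "x \<in> carrier M"
  have sub: "(\<Union>n. gpart M n) \<subseteq> carrier M" using gpart_closed by blast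
  have "(\<Oplus>\<^bsub>M\<^esub> n\<in>{n. hcomp M n x \<noteq> \<zero>\<^bsub>M\<^esub>}. hcomp M n x) \<in> lspan R M (\<Union>n. gpart M n)"
    using x hcomp_gpart by (intro lspan_finsum[OF lspan_base[OF _ sub] sub]) blast
  then show ?thesis using hcomp_sum[OF x hcomp_finite[OF x]] by auto
qed

lemma graded_linear_eqI:
  assumes "module R N" "f \<in> linear_maps R M N" "g \<in> linear_maps R M N"
    and "\<And>n x. x \<in> gpart M n \<Longrightarrow> f x = g x" "x \<in> carrier M"
  shows "f x = g x"
  by (rule linear_maps_eq_on_lspan[OF module_axioms assms(1-3) _ _ gparts_lspan[OF assms(5)]])
    (use gpart_closed assms(4) in auto)

end

section \<open>Koszul signs of permutations\<close>

text \<open>The sign exponent of \<open>koszul_perm\<close> on its own: the sum of degree products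
  over the inversions of \<open>p\<close>.\<close>

definition koszul_exp :: "nat list \<Rightarrow> int list \<Rightarrow> int" where
  "koszul_exp p ds = (\<Sum>(i, j)\<in>{(i, j). i < j \<and> j < length p \<and> p ! j < p ! i}. ds ! (p ! i) * ds ! (p ! j))"

text \<open>In this form the sum can be cut at the boundary between two blocks of positions.\<close>

lemma koszul_exp_alt:
  "koszul_exp p ds =
    (\<Sum>j<length p. \<Sum>i<j. if p ! j < p ! i then ds ! (p ! i) * ds ! (p ! j) else 0)"
proof -
  let ?f = "\<lambda>j i. if p ! j < p ! i then ds ! (p ! i) * ds ! (p ! j) else 0"
  have "(\<Sum>j<length p. \<Sum>i<j. ?f j i) = (\<Sum>(j, i)\<in>(SIGMA j:{..<length p}. {..<j}). ?f j i)"
    by (rule sum.Sigma) auto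
  also have "\<dots> = (\<Sum>(j, i)\<in>{(j, i). i < j \<and> j < length p \<and> p ! j < p ! i}. ds ! (p ! i) * ds ! (p ! j))"
    by (rule sum.mono_neutral_cong_right)
      (auto split: if_splits)
  also have "\<dots> = koszul_exp p ds"
    unfolding koszul_exp_def
    by (rule sum.reindex_bij_witness[of _ "\<lambda>(i, j). (j, i)" "\<lambda>(i, j). (j, i)"]) auto
  finally show ?thesis by simp
qed

lemma sum_lessThan_add: "(\<Sum>j<m + n. f j) = (\<Sum>j<m. f j) + (\<Sum>j<n. f (m + j))"
  for f :: "nat \<Rightarrow> int"
  by (induction n) (auto simp: algebra_simps)

text \<open>Inversions within the shifted part are those of \<open>p\<close>, the trailing block is
  increasing, and each of its entries is smaller than every entry in front of it. The crossing pairs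
  therefore contribute all products of a degree in \<open>d1\<close> with a degree in
  \<open>d2\<close>.\<close>

lemma koszul_exp_swap:
  assumes p: "distinct p" "set p = {..<length p}" and ds: "length d1 = n" "length d2 = length p"
  shows "koszul_exp (map ((+) n) p @ [0..<n]) (d1 @ d2) = koszul_exp p d2 + sum_list d1 * sum_list d2"
proof -
  let ?m = "length p" and ?q = "map ((+) n) p @ [0..<n]"
  have q1: "?q ! i = n + p ! i" "(d1 @ d2) ! (n + p ! i) = d2 ! (p ! i)" if "i < ?m" for i
    using that ds by (auto simp: nth_append)
  have q2: "?q ! (?m + j) = j" "(d1 @ d2) ! j = d1 ! j" if "j < n" for j
    using that ds by (auto simp: nth_append)
  \<comment> \<open>Since \<open>p\<close> permutes the indices, permuting the degrees does not
    change their sum.\<close>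
  have "(\<Sum>i<?m. d2 ! (p ! i)) = (\<Sum>k\<in>(\<lambda>i. p ! i) ` {..<?m}. d2 ! k)"
    using p(1) by (subst sum.reindex) (auto simp: inj_on_nth)
  also have "(\<lambda>i. p ! i) ` {..<?m} = {..<?m}"
    using p(2) by (auto simp: set_conv_nth image_def)
  also have "(\<Sum>k<?m. d2 ! k) = sum_list d2"
    using ds by (simp add: sum_list_sum_nth atLeast0LessThan)
  finally have s2: "(\<Sum>i<?m. d2 ! (p ! i)) = sum_list d2" .
  have "koszul_exp ?q (d1 @ d2) =
    (\<Sum>j<?m. \<Sum>i<j. if ?q ! j < ?q ! i then (d1 @ d2) ! (?q ! i) * (d1 @ d2) ! (?q ! j) else 0) +
    (\<Sum>j<n. \<Sum>i<?m + j. if ?q ! (?m + j) < ?q ! i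
      then (d1 @ d2) ! (?q ! i) * (d1 @ d2) ! (?q ! (?m + j)) else 0)"
    unfolding koszul_exp_alt by (simp add: sum_lessThan_add del: map_append nth_map)
  also have "(\<Sum>j<?m. \<Sum>i<j. if ?q ! j < ?q ! i then (d1 @ d2) ! (?q ! i) * (d1 @ d2) ! (?q ! j) else 0)
      = koszul_exp p d2"
    unfolding koszul_exp_alt by (intro sum.cong refl) (use q1 in auto)
  also have "(\<Sum>j<n. \<Sum>i<?m + j. if ?q ! (?m + j) < ?q ! i
      then (d1 @ d2) ! (?q ! i) * (d1 @ d2) ! (?q ! (?m + j)) else 0) = (\<Sum>j<n. sum_list d2 * d1 ! j)"
  proof (intro sum.cong refl)
    fix j assume "j \<in> {..<n}"
    then have j: "j < n" by simp
    have "(\<Sum>i<?m. if ?q ! (?m + j) < ?q ! i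
        then (d1 @ d2) ! (?q ! i) * (d1 @ d2) ! (?q ! (?m + j)) else 0) = (\<Sum>i<?m. d2 ! (p ! i) * d1 ! j)"
      using q1 q2[OF j] j by (intro sum.cong) auto
    moreover have "(\<Sum>i<j. if ?q ! (?m + j) < ?q ! (?m + i)
        then (d1 @ d2) ! (?q ! (?m + i)) * (d1 @ d2) ! (?q ! (?m + j)) else 0) = 0"
      using q2 j by (intro sum.neutral) auto
    ultimately show "(\<Sum>i<?m + j. if ?q ! (?m + j) < ?q ! i
        then (d1 @ d2) ! (?q ! i) * (d1 @ d2) ! (?q ! (?m + j)) else 0) = sum_list d2 * d1 ! j"
      unfolding sum_lessThan_add by (simp add: s2 flip: sum_distrib_right)
  qed
  also have "\<dots> = sum_list d1 * sum_list d2"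
    using ds by (simp add: sum_list_sum_nth[of d1] atLeast0LessThan mult.commute flip: sum_distrib_left)
  finally show ?thesis .
qed

lemma koszul_exp_upt: "koszul_exp [0..<n] ds = 0"
  unfolding koszul_exp_alt by (intro sum.neutral ballI) auto

section \<open>Block reversals as permutations\<close>

definition reversal :: "nat list \<Rightarrow> nat list" where
  "reversal ns = concat (rev (blocks ns [0..<sum_list ns]))"

lemma blocks_map: "blocks ns (map f xs) = map (map f) (blocks ns xs)"
  by (induction ns arbitrary: xs) (auto simp: take_map drop_map)

text \<open>The first block ends up last, behind the reversal of the others. This brings block
  reversals into the form treated by \<open>koszul_exp_swap\<close>.\<close>

lemma reversal_Cons: "reversal (n # ns) = map ((+) n) (reversal ns) @ [0..<n]"
proof -
  have "[n..<n + sum_list ns] = map ((+) n) [0..<sum_list ns]"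
    by (rule nth_equalityI) auto
  then show ?thesis
    by (simp add: reversal_def take_upt drop_upt blocks_map rev_map map_concat)
qed

lemma reversal_permutation:
  "length (reversal ns) = sum_list ns" "distinct (reversal ns)" "set (reversal ns) = {..<sum_list ns}"
proof -
  have "length (reversal ns) = sum_list ns \<and> distinct (reversal ns) \<and> set (reversal ns) = {..<sum_list ns}"
  proof (induction ns)
    case Nil
    then show ?case by (simp add: reversal_def)
  next
    case (Cons n ns)
    then have "set (reversal (n # ns)) = (+) n ` {..<sum_list ns} \<union> {..<n}"
      by (auto simp: reversal_Cons)
    also have "\<dots> = {..<sum_list (n # ns)}"
      by (auto simp: lessThan_atLeast0)
    finally show ?case using Cons by (auto simp: reversal_Cons distinct_map)
  qed
  then show "length (reversal ns) = sum_list ns" "distinct (reversal ns)" "set (reversal ns) = {..<sum_list ns}"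
    by auto
qed

section \<open>The action of signed permutations on T(M)\<close>

locale graded_tensor_algebra = tensor_algebra R M + graded_module R M
  for R :: "'r ring" (structure) and M :: "('r, 'm) gmodule"
begin

lemma tens_zero:
  assumes "set w \<subseteq> carrier M" "\<zero>\<^bsub>M\<^esub> \<in> set w" shows "tens R M w = \<zero>\<^bsub>T\<^esub>"
proof -
  obtain u v where "w = u @ \<zero>\<^bsub>M\<^esub> # v" using assms(2) by (meson split_list)
  then show ?thesis
    using assms(1) linear_maps_zero[OF module_axioms TA_module tens_linear[of u v]] by simp
qed

lemma homogeneous_closed: "list_all2 (\<lambda>x k. x \<in> gpart M k) w ds \<Longrightarrow> set w \<subseteq> carrier M"
  by (induction rule: list_all2_induct) (auto dest: gpart_closed)

context
  fixes p :: "nat list"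
  assumes p: "distinct p" "set p = {..<length p}"
begin

text \<open>The summand of \<open>koszul_perm\<close> for a fixed list of degrees. For fixed
  \<open>ds\<close> it is linear in each letter, while the set of degrees summed over depends on the
  word.\<close>

definition koszul_term :: "int list \<Rightarrow> 'm list \<Rightarrow> ('m list \<Rightarrow> 'r) set" where
  "koszul_term ds w = sg T (koszul_exp p ds) (tens R M (map (\<lambda>i. hcomp M (ds ! i) (w ! i)) p))"

definition koszul_word :: "'m list \<Rightarrow> ('m list \<Rightarrow> 'r) set" where
  "koszul_word w = (\<Oplus>\<^bsub>T\<^esub> ds\<in>{ds. length ds = length w \<and>
     (\<forall>i<length w. hcomp M (ds ! i) (w ! i) \<noteq> \<zero>\<^bsub>M\<^esub>)}. koszul_term ds w)"

lemma koszul_perm_eq: "koszul_perm R M p = tlift_pow R M T (length p) koszul_word"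
  unfolding koszul_perm_def koszul_word_def koszul_term_def koszul_exp_def ..

lemma koszul_term_entries:
  assumes "set w \<subseteq> carrier M" "length w = length p"
  shows "set (map (\<lambda>i. hcomp M (ds ! i) (w ! i)) p) \<subseteq> carrier M"
  using assms p(2) by (auto simp: subset_iff)

text \<open>As \<open>p\<close> is a permutation, the varied position occurs in it exactly once, so
  \<open>x\<close> enters through exactly one letter of the permuted word.\<close>

lemma koszul_term_linear:
  assumes u: "set u \<subseteq> carrier M" and v: "set v \<subseteq> carrier M" and l: "length p = Suc (length u + length v)"
  shows "(\<lambda>x. koszul_term ds (u @ x # v)) \<in> linear_maps R M T"
proof -
  have "length u \<in> set p" using p(2) l by simp
  then obtain p1 p2 where p12: "p = p1 @ length u # p2" by (meson split_list)
  have n: "length u \<notin> set p1" "length u \<notin> set p2" using p(1) p12 by auto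
  let ?h = "\<lambda>x i. hcomp M (ds ! i) ((u @ x # v) ! i)"
  \<comment> \<open>The other entries do not depend on \<open>x\<close>, so zero serves as a
    placeholder for it.\<close>
  let ?u = "map (?h \<zero>\<^bsub>M\<^esub>) p1" and ?v = "map (?h \<zero>\<^bsub>M\<^esub>) p2"
  have eq: "map (?h x) p = ?u @ hcomp M (ds ! length u) x # ?v" for x
    using n by (auto simp: p12 nth_append nth_Cons' intro!: arg_cong[where f = "hcomp M _"])
  have "set (map (?h \<zero>\<^bsub>M\<^esub>) p) \<subseteq> carrier M"
    using u v l by (intro koszul_term_entries) auto
  then have uv: "set ?u \<subseteq> carrier M" "set ?v \<subseteq> carrier M" by (auto simp: p12)
  show ?thesis
    unfolding koszul_term_def eq
    by (rule linear_maps_comp[OF linear_maps_comp[OF hcomp_linear tens_linear[OF uv]] sg_linear[OF TA_module]])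
qed

lemma koszul_term_closed:
  "\<lbrakk>set w \<subseteq> carrier M; length w = length p\<rbrakk> \<Longrightarrow> koszul_term ds w \<in> carrier T"
  unfolding koszul_term_def using koszul_term_entries by simp

text \<open>The index set in \<open>koszul_word\<close> varies with the word, which is the obstacle
  to multilinearity. Passing to all degree lists over a finite set \<open>J\<close> only adds
  tensors with a zero factor, and one \<open>J\<close> can serve several words.\<close>

lemma koszul_word_superset:
  assumes w: "set w \<subseteq> carrier M" "length w = length p" and J: "finite J"
    "\<And>x k. \<lbrakk>x \<in> set w; hcomp M k x \<noteq> \<zero>\<^bsub>M\<^esub>\<rbrakk> \<Longrightarrow> k \<in> J"
  shows "koszul_word w = (\<Oplus>\<^bsub>T\<^esub> ds\<in>{ds. set ds \<subseteq> J \<and> length ds = length p}. koszul_term ds w)"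
  unfolding koszul_word_def
proof (rule T.add.finprod_mono_neutral_cong_left)
  show "finite {ds. set ds \<subseteq> J \<and> length ds = length p}"
    by (rule finite_lists_length_eq[OF J(1)])
  show "{ds. length ds = length w \<and> (\<forall>i<length w. hcomp M (ds ! i) (w ! i) \<noteq> \<zero>\<^bsub>M\<^esub>)} \<subseteq>
      {ds. set ds \<subseteq> J \<and> length ds = length p}"
  proof safe
    fix ds k assume ds: "length ds = length w" "\<forall>i<length w. hcomp M (ds ! i) (w ! i) \<noteq> \<zero>\<^bsub>M\<^esub>"
    {
      assume "k \<in> set ds"
      then obtain i where i: "i < length w" "ds ! i = k" using ds(1) by (metis in_set_conv_nth)
      then show "k \<in> J" using ds(2) J(2)[of "w ! i" k] by auto
    }
    show "length ds = length p" using ds(1) w(2) by simp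
  qed
  fix ds assume "ds \<in> {ds. set ds \<subseteq> J \<and> length ds = length p} -
      {ds. length ds = length w \<and> (\<forall>i<length w. hcomp M (ds ! i) (w ! i) \<noteq> \<zero>\<^bsub>M\<^esub>)}"
  then obtain i where "i < length p" "hcomp M (ds ! i) (w ! i) = \<zero>\<^bsub>M\<^esub>" using w(2) by auto
  then have "\<zero>\<^bsub>M\<^esub> \<in> set (map (\<lambda>i. hcomp M (ds ! i) (w ! i)) p)"
    unfolding set_map p(2) by (intro image_eqI[of _ _ i]) simp_all
  then show "koszul_term ds w = \<zero>\<^bsub>T\<^esub>"
    unfolding koszul_term_def using koszul_term_entries[OF w] by (simp add: tens_zero)
qed (simp_all add: w koszul_term_closed)

lemma koszul_word_multilinear:
  "multilinear R M T (\<lambda>w. if length w = length p then koszul_word w else \<zero>\<^bsub>T\<^esub>)"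
proof (rule multilinear_powI[OF TA_module])
  show "koszul_word w \<in> carrier T" if "set w \<subseteq> carrier M" "length w = length p" for w
    unfolding koszul_word_def using that koszul_term_closed by (intro T.finsum_closed) auto
next
  fix u v assume uv: "set u \<subseteq> carrier M" "set v \<subseteq> carrier M" "length p = Suc (length u + length v)"
  define S where "S J x = (\<Oplus>\<^bsub>T\<^esub> ds\<in>{ds. set ds \<subseteq> J \<and> length ds = length p}. koszul_term ds (u @ x # v))" for J x
  have lin: "S J \<in> linear_maps R M T" for J
    unfolding S_def by (intro linear_maps_finsum_fun TA_module koszul_term_linear uv)
  have word: "koszul_word (u @ x # v) = S J x"
    if "x \<in> carrier M" "finite J" "\<And>x k. \<lbrakk>x \<in> set u \<union> set v; hcomp M k x \<noteq> \<zero>\<^bsub>M\<^esub>\<rbrakk> \<Longrightarrow> k \<in> J"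
      "\<And>k. hcomp M k x \<noteq> \<zero>\<^bsub>M\<^esub> \<Longrightarrow> k \<in> J" for J x
    unfolding S_def using that uv by (intro koszul_word_superset) auto
  define J0 where "J0 = (\<Union>x\<in>set u \<union> set v. {k. hcomp M k x \<noteq> \<zero>\<^bsub>M\<^esub>})"
  have J0: "finite J0" unfolding J0_def using uv by (auto intro!: hcomp_finite)
  let ?J = "\<lambda>x. {k. hcomp M k x \<noteq> \<zero>\<^bsub>M\<^esub>}"
  show "(\<lambda>x. koszul_word (u @ x # v)) \<in> linear_maps R M T"
  proof (rule linear_mapsI)
    fix x assume x: "x \<in> carrier M"
    have "koszul_word (u @ x # v) = S (J0 \<union> ?J x) x"
      using x J0 hcomp_finite[OF x] by (intro word) (auto simp: J0_def)
    then show "koszul_word (u @ x # v) \<in> carrier T" using linear_maps_closed[OF lin x] by simp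
    {
      fix y assume y: "y \<in> carrier M"
      \<comment> \<open>One set of degrees for \<open>x\<close>, \<open>y\<close>, their sum and the
        fixed letters.\<close>
      let ?K = "J0 \<union> ?J x \<union> ?J y"
      have K: "finite ?K" using J0 x y by (simp add: hcomp_finite)
      have xy: "k \<in> ?K" if "hcomp M k (x \<oplus>\<^bsub>M\<^esub> y) \<noteq> \<zero>\<^bsub>M\<^esub>" for k
        using that x y by (auto simp: linear_maps_add[OF hcomp_linear])
      have "koszul_word (u @ (x \<oplus>\<^bsub>M\<^esub> y) # v) = S ?K (x \<oplus>\<^bsub>M\<^esub> y)"
        using x y K xy by (intro word) (auto simp: J0_def)
      also have "\<dots> = S ?K x \<oplus>\<^bsub>T\<^esub> S ?K y" by (rule linear_maps_add[OF lin x y])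
      also have "S ?K x = koszul_word (u @ x # v)" using x K by (intro word[symmetric]) (auto simp: J0_def)
      also have "S ?K y = koszul_word (u @ y # v)" using y K by (intro word[symmetric]) (auto simp: J0_def)
      finally show "koszul_word (u @ (x \<oplus>\<^bsub>M\<^esub> y) # v) =
        koszul_word (u @ x # v) \<oplus>\<^bsub>T\<^esub> koszul_word (u @ y # v)" .
    next
      fix r assume r: "r \<in> carrier R"
      let ?K = "J0 \<union> ?J x"
      have K: "finite ?K" using J0 x by (simp add: hcomp_finite)
      have rx: "k \<in> ?K" if "hcomp M k (r \<odot>\<^bsub>M\<^esub> x) \<noteq> \<zero>\<^bsub>M\<^esub>" for k
        using that x r by (auto simp: linear_maps_smult[OF hcomp_linear])
      have "koszul_word (u @ (r \<odot>\<^bsub>M\<^esub> x) # v) = S ?K (r \<odot>\<^bsub>M\<^esub> x)"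
        using x r K rx by (intro word) (auto simp: J0_def)
      also have "\<dots> = r \<odot>\<^bsub>T\<^esub> S ?K x" by (rule linear_maps_smult[OF lin r x])
      also have "S ?K x = koszul_word (u @ x # v)" using x K by (intro word[symmetric]) (auto simp: J0_def)
      finally show "koszul_word (u @ (r \<odot>\<^bsub>M\<^esub> x) # v) = r \<odot>\<^bsub>T\<^esub> koszul_word (u @ x # v)" .
    }
  qed
qed

lemma koszul_perm_linear: "koszul_perm R M p \<in> linear_maps R T T"
  unfolding koszul_perm_eq by (rule tlift_pow_linear[OF TA_module koszul_word_multilinear])

lemma koszul_perm_tens:
  assumes w: "list_all2 (\<lambda>x k. x \<in> gpart M k) w ds" "length w = length p"
  shows "koszul_perm R M p (tens R M w) = sg T (koszul_exp p ds) (tens R M (map ((!) w) p))"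
proof -
  have l: "length ds = length w" using w(1) by (simp add: list_all2_lengthD)
  have g: "w ! i \<in> gpart M (ds ! i)" if "i < length w" for i
    using w(1) that by (rule list_all2_nthD)
  note wc = homogeneous_closed[OF w(1)]
  have h: "hcomp M k (w ! i) = (if k = ds ! i then w ! i else \<zero>\<^bsub>M\<^esub>)" if "i < length w" for i k
    using hcomp_homogeneous[OF g[OF that]] .
  have m: "map (\<lambda>i. hcomp M (ds ! i) (w ! i)) p = map ((!) w) p"
    by (rule map_cong[OF refl]) (use p(2) w(2) h in simp)
  have e: "set (map ((!) w) p) \<subseteq> carrier M" using koszul_term_entries[OF wc w(2), of ds] m by simp
  have "koszul_perm R M p (tens R M w) = koszul_word w"
    unfolding koszul_perm_eq using tlift_pow_tens[OF TA_module koszul_word_multilinear wc] w(2) by simp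
  also have "\<dots> = sg T (koszul_exp p ds) (tens R M (map ((!) w) p))"
  \<comment> \<open>A zero factor is homogeneous of every degree and empties the index set of the
    sum; the right side is then zero as well. Without zero factors \<open>ds\<close> is the only
    index.\<close>
  proof (cases "\<exists>i<length w. w ! i = \<zero>\<^bsub>M\<^esub>")
    case True
    then obtain i where i: "i < length w" "w ! i = \<zero>\<^bsub>M\<^esub>" by blast
    have hz: "hcomp M k (w ! i) = \<zero>\<^bsub>M\<^esub>" for k using h[OF i(1)] i(2) by simp
    have "{ds. length ds = length w \<and> (\<forall>i<length w. hcomp M (ds ! i) (w ! i) \<noteq> \<zero>\<^bsub>M\<^esub>)} = {}"
      using hz i(1) by auto
    moreover have "\<zero>\<^bsub>M\<^esub> \<in> set (map ((!) w) p)"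
      unfolding set_map p(2) using i w(2) by (intro image_eqI[of _ _ i]) simp_all
    ultimately show ?thesis
      unfolding koszul_word_def using tens_zero[OF e] by (simp only: T.finsum_empty T.sg_zero)
  next
    case False
    then have "length es = length w \<and> (\<forall>i<length w. hcomp M (es ! i) (w ! i) \<noteq> \<zero>\<^bsub>M\<^esub>) \<longleftrightarrow> es = ds" for es
      unfolding list_eq_iff_nth_eq using h l False by auto
    then show ?thesis
      using koszul_term_closed[OF wc w(2)] e by (simp add: koszul_word_def koszul_term_def m)
  qed
  finally show ?thesis .
qed

end

text \<open>The span of this set serves as the part of degree \<open>a\<close> in the
  \<open>n\<close>-th tensor power.\<close>

definition htens :: "nat \<Rightarrow> int \<Rightarrow> ('m list \<Rightarrow> 'r) set set" where
  "htens n a = {tens R M w |w. \<exists>ds. list_all2 (\<lambda>x k. x \<in> gpart M k) w ds \<and> sum_list ds = a \<and> length w = n}"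

lemma htens_subset: "htens n a \<subseteq> carrier T"
  by (auto simp: htens_def dest: homogeneous_closed)

lemma htens_mult:
  assumes "X \<in> htens m a" "Y \<in> htens n b" shows "X \<otimes>\<^bsub>T\<^esub> Y \<in> htens (m + n) (a + b)"
proof -
  obtain u d1 v d2 where "X = tens R M u" "Y = tens R M v" "length u = m" "length v = n"
    "list_all2 (\<lambda>x k. x \<in> gpart M k) u d1" "list_all2 (\<lambda>x k. x \<in> gpart M k) v d2"
    "sum_list d1 = a" "sum_list d2 = b"
    using assms by (auto simp: htens_def)
  then show ?thesis
    unfolding htens_def
    by (auto simp: homogeneous_closed tens_append intro!: exI[of _ "u @ v"] exI[of _ "d1 @ d2"] list_all2_appendI)
qed

text \<open>The sign for moving the first block past the rest depends only on the two total degrees.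
  It is therefore constant on the spans, and the formula extends from homogeneous words by
  linearity, first in \<open>Y\<close> and then in \<open>X\<close>.\<close>

lemma koszul_reversal_Cons:
  assumes X: "X \<in> lspan R T (htens n a)" and Y: "Y \<in> lspan R T (htens (sum_list ns) b)"
  shows "koszul_perm R M (reversal (n # ns)) (X \<otimes>\<^bsub>T\<^esub> Y) =
    sg T (a * b) (koszul_perm R M (reversal ns) Y \<otimes>\<^bsub>T\<^esub> X)"
proof -
  note perm = reversal_permutation(2,3)[unfolded reversal_permutation(1)[symmetric]]
  note K = koszul_perm_linear[OF perm, of "n # ns"] and K' = koszul_perm_linear[OF perm, of ns]
  have 1: "koszul_perm R M (reversal (n # ns)) (tens R M u \<otimes>\<^bsub>T\<^esub> tens R M v) =
      sg T (a * b) (koszul_perm R M (reversal ns) (tens R M v) \<otimes>\<^bsub>T\<^esub> tens R M u)"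
    if u: "list_all2 (\<lambda>x k. x \<in> gpart M k) u d1" "sum_list d1 = a" "length u = n"
      and v: "list_all2 (\<lambda>x k. x \<in> gpart M k) v d2" "sum_list d2 = b" "length v = sum_list ns"
    for u v d1 d2
  proof -
    note uc = homogeneous_closed[OF u(1)] and vc = homogeneous_closed[OF v(1)]
    have uv: "list_all2 (\<lambda>x k. x \<in> gpart M k) (u @ v) (d1 @ d2)"
      using u v by (intro list_all2_appendI)
    have l: "length d1 = n" "length d2 = sum_list ns"
      using u v by (simp_all add: list_all2_lengthD[symmetric])
    have rv: "set (map ((!) v) (reversal ns)) \<subseteq> carrier M"
      using vc v(3) reversal_permutation(3)[of ns] by (auto simp: subset_iff)
    have "koszul_perm R M (reversal (n # ns)) (tens R M (u @ v)) =
        sg T (koszul_exp (reversal (n # ns)) (d1 @ d2)) (tens R M (map ((!) (u @ v)) (reversal (n # ns))))"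
      using u(3) v(3) by (intro koszul_perm_tens[OF perm uv]) (simp add: reversal_permutation(1))
    also have "koszul_exp (reversal (n # ns)) (d1 @ d2) = koszul_exp (reversal ns) d2 + a * b"
      using koszul_exp_swap[OF perm(1,2)[of ns], of d1 n d2] l u(2) v(2)
      by (simp add: reversal_permutation(1) reversal_Cons)
    also have "map ((!) (u @ v)) (reversal (n # ns)) = map ((!) v) (reversal ns) @ u"
      using u(3) by (auto simp: reversal_Cons nth_append intro!: nth_equalityI)
    also have "tens R M (map ((!) v) (reversal ns) @ u) =
        tens R M (map ((!) v) (reversal ns)) \<otimes>\<^bsub>T\<^esub> tens R M u"
      by (rule tens_append[OF rv uc])
    also have "sg T (koszul_exp (reversal ns) d2 + a * b)
        (tens R M (map ((!) v) (reversal ns)) \<otimes>\<^bsub>T\<^esub> tens R M u) =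
      sg T (a * b) (sg T (koszul_exp (reversal ns) d2) (tens R M (map ((!) v) (reversal ns)))
        \<otimes>\<^bsub>T\<^esub> sg T 0 (tens R M u))"
      using rv uc by (simp add: T.sg_mult T.sg_sg add.commute del: map_eq_conv)
    also have "sg T (koszul_exp (reversal ns) d2) (tens R M (map ((!) v) (reversal ns))) =
        koszul_perm R M (reversal ns) (tens R M v)"
      using koszul_perm_tens[OF perm v(1)] v(3) by (simp add: reversal_permutation(1))
    finally show ?thesis using uc vc by (simp add: tens_append sg_0)
  qed
  have Yc: "Y \<in> carrier T" using T.lspan_closed[OF Y htens_subset] .
  have 2: "koszul_perm R M (reversal (n # ns)) (tens R M u \<otimes>\<^bsub>T\<^esub> Y) =
      sg T (a * b) (koszul_perm R M (reversal ns) Y \<otimes>\<^bsub>T\<^esub> tens R M u)"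
    if u: "list_all2 (\<lambda>x k. x \<in> gpart M k) u d1" "sum_list d1 = a" "length u = n" for u d1
  proof (rule linear_maps_eq_on_lspan[OF TA_module TA_module _ _ htens_subset _ Y])
    have uc: "tens R M u \<in> carrier T" using homogeneous_closed[OF u(1)] by simp
    show "(\<lambda>Y. koszul_perm R M (reversal (n # ns)) (tens R M u \<otimes>\<^bsub>T\<^esub> Y)) \<in> linear_maps R T T"
      by (rule linear_maps_comp[OF TA_mult_l[OF uc] K])
    show "(\<lambda>Y. sg T (a * b) (koszul_perm R M (reversal ns) Y \<otimes>\<^bsub>T\<^esub> tens R M u)) \<in> linear_maps R T T"
      by (rule linear_maps_comp[OF linear_maps_comp[OF K' TA_mult_r[OF uc]] sg_linear[OF TA_module]])
  qed (use 1 u in \<open>auto simp: htens_def\<close>)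
  show ?thesis
  proof (rule linear_maps_eq_on_lspan[OF TA_module TA_module _ _ htens_subset _ X])
    show "(\<lambda>X. koszul_perm R M (reversal (n # ns)) (X \<otimes>\<^bsub>T\<^esub> Y)) \<in> linear_maps R T T"
      by (rule linear_maps_comp[OF TA_mult_r[OF Yc] K])
    show "(\<lambda>X. sg T (a * b) (koszul_perm R M (reversal ns) Y \<otimes>\<^bsub>T\<^esub> X)) \<in> linear_maps R T T"
      by (rule linear_maps_comp[OF TA_mult_l[OF linear_maps_closed[OF K' Yc]] sg_linear[OF TA_module]])
  qed (use 2 in \<open>auto simp: htens_def\<close>)
qed

text \<open>The identity permutation has no inversions. \<open>koszul_perm\<close> is zero on words
  of any other length, hence the restriction to tensors of length \<open>n\<close>.\<close>

lemma koszul_identity: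
  assumes "X \<in> lspan R T (htens n a)" shows "koszul_perm R M [0..<n] X = X"
proof (rule linear_maps_eq_on_lspan[OF TA_module TA_module _ linear_maps_id htens_subset _ assms])
  have p: "distinct [0..<n]" "set [0..<n] = {..<length [0..<n]}" by auto
  show "koszul_perm R M [0..<n] \<in> linear_maps R T T" by (rule koszul_perm_linear[OF p])
  fix s assume "s \<in> htens n a"
  then obtain w ds where w: "s = tens R M w" "list_all2 (\<lambda>x k. x \<in> gpart M k) w ds" "length w = n"
    by (auto simp: htens_def)
  have "map ((!) w) [0..<n] = w" using map_nth[of w] w(3) by simp
  then show "koszul_perm R M [0..<n] s = s"
    using koszul_perm_tens[OF p w(2)] w(3) by (simp add: w(1) koszul_exp_upt sg_0)
qed

end

text \<open>Subtracting one from each part leaves lists of \<open>s\<close> natural numbers with sum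
  n - s, which \<open>card_length_sum_list\<close> counts.\<close>

lemma card_compositions:
  assumes "1 \<le> s" "s \<le> n" shows "card (compositions s n) = (n - 1) choose (n - s)"
proof -
  have suc: "sum_list (map Suc l) = sum_list l + length l" for l
    by (induction l) auto
  have "compositions s n = map Suc ` {l. length l = s \<and> sum_list l = n - s}"
  proof (intro equalityI subsetI)
    fix ns assume ns: "ns \<in> compositions s n"
    then have 1: "ns = map Suc (map (\<lambda>k. k - 1) ns)"
      by (auto simp: compositions_def intro!: map_idI[symmetric])
    moreover have "sum_list (map (\<lambda>k. k - 1) ns) = n - s"
      using ns suc[of "map (\<lambda>k. k - 1) ns"] 1 by (auto simp: compositions_def)
    ultimately show "ns \<in> map Suc ` {l. length l = s \<and> sum_list l = n - s}"
      using ns by (auto simp: compositions_def intro!: image_eqI[of ns "map Suc" "map (\<lambda>k. k - 1) ns"])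
  qed (use assms in \<open>auto simp: compositions_def suc\<close>)
  moreover have "inj_on (map Suc) A" for A by (auto simp: inj_on_def)
  ultimately have "card (compositions s n) = card {l. length l = s \<and> sum_list l = n - s}"
    by (simp add: card_image)
  also have "\<dots> = (n - 1) choose (n - s)"
    using assms by (simp add: card_length_sum_list)
  finally show ?thesis .
qed

text \<open>With i = n - s the sum becomes the binomial expansion of (1 - 1)^(n-1), whose exponent
  is positive.\<close>

lemma alternating_compositions:
  assumes "2 \<le> n"
  shows "(\<Sum>s\<in>{1..n}. int (card (compositions s n)) * (if even (int n + int s) then 1 else - 1)) = 0"
proof -
  have "(\<Sum>s\<in>{1..n}. int (card (compositions s n)) * (if even (int n + int s) then 1 else - 1)) =
      (\<Sum>i\<le>n - 1. (-1) ^ i * int ((n - 1) choose i))"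
  proof (rule sum.reindex_bij_witness[of _ "\<lambda>i. n - i" "\<lambda>s. n - s"])
    fix s assume s: "s \<in> {1..n}"
    have "even (n - s) \<longleftrightarrow> even (int n + int s)" using s by (simp add: even_diff_nat)
    then show "(-1) ^ (n - s) * int ((n - 1) choose (n - s)) =
        int (card (compositions s n)) * (if even (int n + int s) then 1 else - 1)"
      using s card_compositions[of s n] by auto
  qed (use assms in auto)
  also have "\<dots> = 0" using assms choose_alternating_sum[of "n - 1", where 'a = int] by simp
  finally show ?thesis .
qed

lemma (in abelian_group) finsum_add_pow:
  assumes "finite A" "x \<in> carrier G"
  shows "(\<Oplus>a\<in>A. add_pow G (c a :: int) x) = add_pow G (\<Sum>a\<in>A. c a) x"
  using assms(1)
proof induction
  case (insert a A)
  then show ?case using assms(2) by (simp add: add.int_pow_mult)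
qed (simp add: add_pow_def)

text \<open>With signs read as integer multiples, a signed sum of copies of one element is a single
  multiple with an integer coefficient.\<close>

lemma (in abelian_group) sg_add_pow:
  assumes "x \<in> carrier G" shows "sg G k x = add_pow G (if even k then 1 else - 1 :: int) x"
  using assms by (simp add: sg_def add.int_pow_neg)

section \<open>Vanishing of the obstructions\<close>

text \<open>The condition \<open>e_graded\<close> lets every iterate of \<open>e\<close> inherit the
  degree of its argument, on which the Koszul signs depend.\<close>

locale graded_coassociative_map = graded_tensor_algebra R M + coassociative_map R M e
  for R :: "'r ring" (structure) and M :: "('r, 'm) gmodule" and e +
  assumes e_graded: "x \<in> gpart M a \<Longrightarrow> e x \<in> lspan R T (htens 2 a)"
begin

lemma D_graded: "x \<in> gpart M a \<Longrightarrow> D n x \<in> lspan R T (htens (Suc n) a)"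
proof (induction n arbitrary: x a)
  case 0
  then have "tens R M [x] \<in> htens 1 a"
    by (auto simp: htens_def intro!: exI[of _ "[x]"] exI[of _ "[a]"])
  then show ?case using T.lspan_base[OF _ htens_subset] by simp
next
  case (Suc n)
  note b = mult_bilinear[OF tens_singleton_linear D_linear]
  have "tlift2 R M T (\<lambda>a b. tens R M [a] \<otimes>\<^bsub>T\<^esub> D n b) (e x) \<in> lspan R T (htens (Suc (Suc n)) a)"
  proof (rule linear_maps_lspan[OF TA_module TA_module tlift2_linear[OF TA_module b] htens_subset _
        htens_subset e_graded[OF Suc.prems]])
    fix s assume "s \<in> htens 2 a"
    then obtain v w k l where s: "s = tens R M [v, w]" "v \<in> gpart M k" "w \<in> gpart M l" "k + l = a"
      by (auto simp: htens_def length_Suc_conv numeral_2_eq_2 list_all2_Cons1)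
    have vw: "v \<in> carrier M" "w \<in> carrier M" using s gpart_closed by auto
    have v: "tens R M [v] \<in> htens 1 k"
      using s(2) by (auto simp: htens_def intro!: exI[of _ "[v]"] exI[of _ "[k]"])
    have "tens R M [v] \<otimes>\<^bsub>T\<^esub> D n w \<in> lspan R T (htens (Suc (Suc n)) a)"
      by (rule linear_maps_lspan[OF TA_module TA_module TA_mult_l htens_subset _
            htens_subset Suc.IH[OF s(3)]])
        (use vw htens_mult[OF v] s(4) in \<open>auto intro!: T.lspan_base[OF _ htens_subset]\<close>)
    then show "tlift2 R M T (\<lambda>a b. tens R M [a] \<otimes>\<^bsub>T\<^esub> D n b) s \<in> lspan R T (htens (Suc (Suc n)) a)"
      using vw s(1) by (simp add: tlift2_tens[OF TA_module b])
  qed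
  then show ?case by simp
qed

lemma reversal_11: "reversal [1, 1] = [1, 0]"
  by (simp add: reversal_def upt_rec)

text \<open>The same iterate has two splittings, with the first block in front and with it behind.
  Reversing the blocks turns one into the other up to an exchange of the two factors of
  \<open>e x\<close>, and this exchange is undone by cocommutativity.\<close>

lemma D_reversal:
  assumes cocomm: "\<And>x. x \<in> carrier M \<Longrightarrow> koszul_perm R M [1, 0] (e x) = e x"
    and "ns \<noteq> []" "\<And>n. n \<in> set ns \<Longrightarrow> 1 \<le> n" "x \<in> carrier M"
  shows "koszul_perm R M (reversal ns) (D (sum_list ns - 1) x) = D (sum_list ns - 1) x"
  using assms(2-)
proof (induction ns arbitrary: x)
  case (Cons n ns)
  note perm = reversal_permutation(2,3)[unfolded reversal_permutation(1)[symmetric]]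
  note K = koszul_perm_linear[OF perm]
  let ?s = "sum_list ns"
  have "koszul_perm R M (reversal (n # ns)) (D (n + ?s - 1) x) = D (n + ?s - 1) x"
  \<comment> \<open>The sign of a block exchange is known only for homogeneous arguments, which
    suffice by linearity.\<close>
  proof (rule graded_linear_eqI[OF TA_module linear_maps_comp[OF D_linear K] D_linear _ Cons.prems(3)])
    fix a x assume x: "x \<in> gpart M a"
    then have xc: "x \<in> carrier M" by (rule gpart_closed)
    show "koszul_perm R M (reversal (n # ns)) (D (n + ?s - 1) x) = D (n + ?s - 1) x"
    proof (cases "ns = []")
      case True
      have "reversal [n] = [0..<n]" by (simp add: reversal_def)
      moreover have "D (n - 1) x \<in> lspan R T (htens n a)"
        using D_graded[OF x, of "n - 1"] Cons.prems(2)[of n] by simp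
      ultimately show ?thesis using True koszul_identity by simp
    next
      case False
      have "1 \<le> hd ns" using False Cons.prems(2)[of "hd ns"] by simp
      then have s: "1 \<le> ?s" "1 \<le> n"
        using False Cons.prems(2)[of n] member_le_sum_list[of "hd ns" ns] by auto
      have idx: "Suc ((n - 1) + (?s - 1)) = n + ?s - 1" "Suc ((?s - 1) + (n - 1)) = n + ?s - 1"
        using s by auto
      have split: "D (n + ?s - 1) x = tlift2 R M T (\<lambda>a b. D (n - 1) a \<otimes>\<^bsub>T\<^esub> D (?s - 1) b) (e x)"
        and split': "D (n + ?s - 1) x = tlift2 R M T (\<lambda>a b. D (?s - 1) a \<otimes>\<^bsub>T\<^esub> D (n - 1) b) (e x)"
        using D_split[OF xc, of "n - 1" "?s - 1"] D_split[OF xc, of "?s - 1" "n - 1"]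
        unfolding idx by simp_all
      have s1: "Suc (n - 1) = n" "Suc (?s - 1) = ?s" using s by auto
      note b = mult_bilinear[OF D_linear[of "n - 1"] D_linear[of "?s - 1"]]
        and b' = mult_bilinear[OF D_linear[of "?s - 1"] D_linear[of "n - 1"]]
      note p10 = perm[of "[1, 1]", unfolded reversal_11]
      \<comment> \<open>Reversing the blocks afterwards agrees with exchanging the two factors
        beforehand. The signs coincide because the iterates preserve degree, and the remaining
        blocks are handled by the induction hypothesis.\<close>
      have "koszul_perm R M (reversal (n # ns)) (tlift2 R M T (\<lambda>a b. D (n - 1) a \<otimes>\<^bsub>T\<^esub> D (?s - 1) b) (e x)) =
          tlift2 R M T (\<lambda>a b. D (?s - 1) a \<otimes>\<^bsub>T\<^esub> D (n - 1) b) (koszul_perm R M [1, 0] (e x))"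
      proof (rule linear_maps_eq_on_lspan[OF TA_module TA_module
            linear_maps_comp[OF tlift2_linear[OF TA_module b] K]
            linear_maps_comp[OF koszul_perm_linear[OF p10] tlift2_linear[OF TA_module b']]
            htens_subset _ e_graded[OF x]])
        fix z assume "z \<in> htens 2 a"
        then obtain v w k l where z: "z = tens R M [v, w]" "v \<in> gpart M k" "w \<in> gpart M l" "k + l = a"
          by (auto simp: htens_def length_Suc_conv numeral_2_eq_2 list_all2_Cons1)
        have vw: "v \<in> carrier M" "w \<in> carrier M" using z gpart_closed by auto
        have "koszul_perm R M (reversal (n # ns)) (D (n - 1) v \<otimes>\<^bsub>T\<^esub> D (?s - 1) w) =
            sg T (k * l) (koszul_perm R M (reversal ns) (D (?s - 1) w) \<otimes>\<^bsub>T\<^esub> D (n - 1) v)"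
          using D_graded[OF z(2), of "n - 1"] D_graded[OF z(3), of "?s - 1"] unfolding s1
          by (rule koszul_reversal_Cons)
        also have "koszul_perm R M (reversal ns) (D (?s - 1) w) = D (?s - 1) w"
          using False Cons.prems(2) vw by (intro Cons.IH) auto
        finally have 1: "koszul_perm R M (reversal (n # ns)) (D (n - 1) v \<otimes>\<^bsub>T\<^esub> D (?s - 1) w) =
            sg T (k * l) (D (?s - 1) w \<otimes>\<^bsub>T\<^esub> D (n - 1) v)" .
        have "koszul_exp [1, 0] [k, l] = k * l"
          by (simp add: koszul_exp_alt numeral_2_eq_2 lessThan_Suc mult.commute)
        then have 2: "koszul_perm R M [1, 0] (tens R M [v, w]) = sg T (k * l) (tens R M [w, v])"
          using koszul_perm_tens[OF p10, of "[v, w]" "[k, l]"] z(2,3) by simp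
        have t: "tlift2 R M T (\<lambda>a b. D (n - 1) a \<otimes>\<^bsub>T\<^esub> D (?s - 1) b) (tens R M [v, w]) =
            D (n - 1) v \<otimes>\<^bsub>T\<^esub> D (?s - 1) w"
          using tlift2_tens[OF TA_module b, of "[v, w]"] vw by simp
        have t': "tlift2 R M T (\<lambda>a b. D (?s - 1) a \<otimes>\<^bsub>T\<^esub> D (n - 1) b) (tens R M [w, v]) =
            D (?s - 1) w \<otimes>\<^bsub>T\<^esub> D (n - 1) v"
          using tlift2_tens[OF TA_module b', of "[w, v]"] vw by simp
        have wv: "tens R M [w, v] \<in> carrier T" using vw by simp
        note sg = linear_maps_sg[OF TA_module TA_module tlift2_linear[OF TA_module b'] wv]
        show "koszul_perm R M (reversal (n # ns)) (tlift2 R M T (\<lambda>a b. D (n - 1) a \<otimes>\<^bsub>T\<^esub> D (?s - 1) b) z) =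
            tlift2 R M T (\<lambda>a b. D (?s - 1) a \<otimes>\<^bsub>T\<^esub> D (n - 1) b) (koszul_perm R M [1, 0] z)"
          using 1 unfolding z(1) 2 sg t t' .
      qed
      then show ?thesis using cocomm[OF xc] split split' by simp
    qed
  qed
  then show ?case by simp
qed simp

lemma obstruction_eq_zero:
  assumes E: "E 1 = e" "\<forall>k\<ge>2. \<forall>x\<in>carrier M. E k x = \<zero>\<^bsub>T\<^esub>"
    and cocomm: "\<And>x. x \<in> carrier M \<Longrightarrow> koszul_perm R M [1, 0] (e x) = e x"
    and n: "2 \<le> n" and x: "x \<in> carrier M"
  shows "obstruction R M E n x = \<zero>\<^bsub>T\<^esub>"
proof -
  note perm = reversal_permutation(2,3)[unfolded reversal_permutation(1)[symmetric]]
  let ?y = "D (n - 1) x"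
  have y: "?y \<in> carrier T" using x by simp
  let ?c = "\<lambda>s. if even (int n + int s) then 1 else - 1 :: int"
  have summand: "block_reversal R M ns (tensor_maps R M (map (Fmap R M E) ns) (Fmap R M E s x)) =
      add_pow T (?c s) ?y" if s: "1 \<le> s" and ns: "ns \<in> compositions s n" for s ns
  proof -
    have ns': "ns \<noteq> []" "\<And>k. k \<in> set ns \<Longrightarrow> 1 \<le> k" "sum_list ns = n"
      using s ns by (auto simp: compositions_def)
    have "block_reversal R M ns (tensor_maps R M (map (Fmap R M E) ns) (Fmap R M E s x)) =
        koszul_perm R M (reversal ns) (sg T (int n + int s) ?y)"
      using tensor_maps_Fmap[OF E ns s x] by (simp add: block_reversal_def reversal_def)
    also have "\<dots> = sg T (int n + int s) (koszul_perm R M (reversal ns) ?y)"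
      by (rule linear_maps_sg[OF TA_module TA_module koszul_perm_linear[OF perm] y])
    also have "koszul_perm R M (reversal ns) ?y = ?y"
      using D_reversal[OF cocomm ns'(1,2) x] ns'(3) by simp
    finally show ?thesis using T.sg_add_pow[OF y] by simp
  qed
  have inner: "(\<Oplus>\<^bsub>T\<^esub> ns\<in>compositions s n.
      block_reversal R M ns (tensor_maps R M (map (Fmap R M E) ns) (Fmap R M E s x))) =
      add_pow T (int (card (compositions s n)) * ?c s) ?y" if s: "1 \<le> s" for s
  proof -
    have "(\<Oplus>\<^bsub>T\<^esub> ns\<in>compositions s n.
        block_reversal R M ns (tensor_maps R M (map (Fmap R M E) ns) (Fmap R M E s x))) =
        (\<Oplus>\<^bsub>T\<^esub> ns\<in>compositions s n. add_pow T (?c s) ?y)"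
      using summand[OF s] y by (intro T.finsum_cong') auto
    also have "\<dots> = add_pow T (\<Sum>ns\<in>compositions s n. ?c s) ?y"
      by (rule T.finsum_add_pow[OF finite_compositions y])
    finally show ?thesis by simp
  qed
  have "obstruction R M E n x =
      (\<Oplus>\<^bsub>T\<^esub> s\<in>{1..n}. add_pow T (int (card (compositions s n)) * ?c s) ?y)"
    unfolding obstruction_def using inner y by (intro T.finsum_cong') auto
  also have "\<dots> = add_pow T (\<Sum>s\<in>{1..n}. int (card (compositions s n)) * ?c s) ?y"
    by (rule T.finsum_add_pow[OF finite_atLeastAtMost y])
  also have "\<dots> = \<zero>\<^bsub>T\<^esub>"
    using alternating_compositions[OF n] by (simp add: add_pow_def)
  finally show ?thesis .
qed

text \<open>The composition [2] contributes F^2 F^1 = -e, and [1, 1] contributes the exchange of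
  (F^1 \<otimes> F^1) F^2 = e.\<close>

lemma obstruction_2:
  assumes E: "E 1 = e" "\<forall>k\<ge>2. \<forall>x\<in>carrier M. E k x = \<zero>\<^bsub>T\<^esub>"
    and x: "x \<in> carrier M"
  shows "obstruction R M E 2 x = koszul_perm R M [1, 0] (e x) \<ominus>\<^bsub>T\<^esub> e x"
proof -
  note perm = reversal_permutation(2,3)[unfolded reversal_permutation(1)[symmetric]]
  \<comment> \<open>By its recursion \<open>D 1 x\<close> is the projection of \<open>e x\<close> to
    word length two. This is read off from the rules for \<open>id_tensor\<close> with m = 0, and
    \<open>e_pow\<close> removes the projection.\<close>
  have D1: "D 1 x = e x"
  proof -
    have "id_tensor R M (Suc 0) (D 0) (id_tensor R M 0 e (tens R M [x])) = id_tensor R M 0 (D 1) (tens R M [x])"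
      using x id_tensor_comp_e[of "tens R M [x]" 0 0] by simp
    moreover have "id_tensor R M 0 f (tens R M [x]) = f x" if "f \<in> linear_maps R M T" for f
      using x linear_maps_closed[OF that x] by (simp add: id_tensor_tens[OF that] tens_Nil)
    ultimately have "id_tensor R M (Suc 0) (D 0) (e x) = D 1 x"
      using e_linear D_linear by metis
    moreover have "id_tensor R M (Suc 0) (D 0) (e x) = e x"
      using id_tensor_D0[of "e x" 1] e_pow[OF x] x by (simp add: numeral_2_eq_2 del: D.simps)
    ultimately show ?thesis by simp
  qed
  have c1: "compositions 1 2 = {[2]}" and c2: "compositions 2 2 = {[1, 1]}"
    by (auto simp: compositions_def length_Suc_conv numeral_2_eq_2)
  have r2: "koszul_perm R M (reversal [2]) (e x) = e x"
  proof (rule graded_linear_eqI[OF TA_module linear_maps_comp[OF e_linear koszul_perm_linear[OF perm]] e_linear _ x])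
    fix a y assume "y \<in> gpart M a"
    then have "koszul_perm R M [0..<2] (e y) = e y" by (intro koszul_identity e_graded)
    then show "koszul_perm R M (reversal [2]) (e y) = e y" by (simp add: reversal_def)
  qed
  have t1: "block_reversal R M [2] (tensor_maps R M (map (Fmap R M E) [2]) (Fmap R M E 1 x)) = \<ominus>\<^bsub>T\<^esub> e x"
  proof -
    have "tensor_maps R M (map (Fmap R M E) [2]) (Fmap R M E 1 x) = \<ominus>\<^bsub>T\<^esub> e x"
      using tensor_maps_Fmap[OF E, of "[2]" 1 2 x] c1 x D1 by (simp add: sg_def)
    then show ?thesis
      using linear_maps_a_inv[OF TA_module TA_module koszul_perm_linear[OF perm], of "e x" "[2]"] r2 x
      by (simp add: block_reversal_def reversal_def)
  qed
  have t2: "block_reversal R M [1, 1] (tensor_maps R M (map (Fmap R M E) [1, 1]) (Fmap R M E 2 x)) =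
      koszul_perm R M [1, 0] (e x)"
  proof -
    have "tensor_maps R M (map (Fmap R M E) [1, 1]) (Fmap R M E 2 x) = e x"
      using tensor_maps_Fmap[OF E, of "[1, 1]" 2 2 x] c2 x D1 by (simp add: sg_def)
    then show ?thesis
      using reversal_11 by (simp add: block_reversal_def reversal_def)
  qed
  have p10: "koszul_perm R M [1, 0] (e x) \<in> carrier T"
    using linear_maps_closed[OF koszul_perm_linear[OF perm[of "[1, 1]"]], of "e x"] x
    unfolding reversal_11 by simp
  have "{1..2} = {1, 2 :: nat}" by auto
  then have "obstruction R M E 2 x = \<ominus>\<^bsub>T\<^esub> e x \<oplus>\<^bsub>T\<^esub> koszul_perm R M [1, 0] (e x)"
    unfolding obstruction_def using c1 c2 t1 t2 p10 x by simp
  then show ?thesis using p10 x by (simp add: a_minus_def T.a_comm)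
qed

end

section \<open>The desuspension\<close>

lemma ground_module: "cring R \<Longrightarrow> module R (ground R)"
proof -
  assume R: "cring R"
  interpret cring R by fact
  show ?thesis
    by (rule moduleI[OF R])
      (auto simp: ground_def l_distr r_distr m_assoc a_ac intro!: abelian_groupI intro: add.l_inv_ex)
qed

text \<open>The counit enters the desuspension as a functional of degree 0 with a graded
  kernel.\<close>

locale graded_functional = graded_module R C for R :: "'r ring" and C :: "('r, 'c) gmodule" +
  fixes \<epsilon> :: "'c \<Rightarrow> 'r"
  assumes \<epsilon>_degree: "\<epsilon> \<in> deg_map R C (ground R) 0"
begin

abbreviation V where "V \<equiv> desusp R C \<epsilon>"

lemma \<epsilon>_linear: "\<epsilon> \<in> linear_maps R C (ground R)"
  using \<epsilon>_degree by (simp add: deg_map_def lin_map_eq_linear_maps)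

lemma ground: "module R (ground R)"
  using ground_module R.is_cring .

lemma \<epsilon>_simps:
  "x \<in> carrier C \<Longrightarrow> \<epsilon> x \<in> carrier R"
  "\<lbrakk>x \<in> carrier C; y \<in> carrier C\<rbrakk> \<Longrightarrow> \<epsilon> (x \<oplus>\<^bsub>C\<^esub> y) = \<epsilon> x \<oplus>\<^bsub>R\<^esub> \<epsilon> y"
  "\<lbrakk>r \<in> carrier R; x \<in> carrier C\<rbrakk> \<Longrightarrow> \<epsilon> (r \<odot>\<^bsub>C\<^esub> x) = r \<otimes>\<^bsub>R\<^esub> \<epsilon> x"
  "\<epsilon> \<zero>\<^bsub>C\<^esub> = \<zero>\<^bsub>R\<^esub>"
  using linear_maps_closed[OF \<epsilon>_linear] linear_maps_add[OF \<epsilon>_linear] linear_maps_smult[OF \<epsilon>_linear]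
    linear_maps_zero[OF module_axioms ground \<epsilon>_linear] by (auto simp: ground_def)

text \<open>\<open>ground R\<close> is concentrated in degree 0, so \<epsilon> kills the components
  of nonzero degree, and its value on the remaining one is \<epsilon> x = 0. Hence the kernel is a
  graded submodule.\<close>

lemma \<epsilon>_hcomp:
  assumes x: "x \<in> carrier C" "\<epsilon> x = \<zero>\<^bsub>R\<^esub>" shows "\<epsilon> (hcomp C n x) = \<zero>\<^bsub>R\<^esub>"
proof -
  interpret G: module R "ground R" by (rule ground)
  have nz: "\<epsilon> (hcomp C k x) = \<zero>\<^bsub>R\<^esub>" if "k \<noteq> 0" for k
    using \<epsilon>_degree hcomp_gpart[OF x(1), of k] that by (force simp: deg_map_def ground_def)
  \<comment> \<open>The index 0 is included so that the sum can be cut down to it even when the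
    component of degree 0 is zero.\<close>
  let ?A = "insert 0 {n. hcomp C n x \<noteq> \<zero>\<^bsub>C\<^esub>}"
  have A: "finite ?A" using hcomp_finite[OF x(1)] by simp
  have c: "\<epsilon> (hcomp C k x) \<in> carrier (ground R)" for k
    using x(1) by (intro linear_maps_closed[OF \<epsilon>_linear]) simp
  have "\<epsilon> x = \<epsilon> (\<Oplus>\<^bsub>C\<^esub> k\<in>?A. hcomp C k x)" 
    by (rule arg_cong[where f = \<epsilon>, OF hcomp_sum[OF x(1) A]]) auto
  also have "\<dots> = (\<Oplus>\<^bsub>ground R\<^esub> k\<in>?A. \<epsilon> (hcomp C k x))"
    using x by (intro linear_maps_finsum[OF module_axioms ground \<epsilon>_linear]) auto
  also have "\<dots> = (\<Oplus>\<^bsub>ground R\<^esub> k\<in>{0}. \<epsilon> (hcomp C k x))"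
    using A nz c by (intro G.add.finprod_mono_neutral_cong_right) (auto simp: ground_def)
  also have "\<dots> = \<epsilon> (hcomp C 0 x)" using c by simp
  finally show ?thesis using nz x(2) by (cases "n = 0") auto
qed

lemma desusp_simps:
  "carrier V = {x \<in> carrier C. \<epsilon> x = \<zero>\<^bsub>R\<^esub>}" "\<zero>\<^bsub>V\<^esub> = \<zero>\<^bsub>C\<^esub>" "x \<oplus>\<^bsub>V\<^esub> y = x \<oplus>\<^bsub>C\<^esub> y"
  "r \<odot>\<^bsub>V\<^esub> x = r \<odot>\<^bsub>C\<^esub> x" "gpart V n = {x \<in> gpart C (n + 1). \<epsilon> x = \<zero>\<^bsub>R\<^esub>}"
  by (simp_all add: desusp_def)

lemma a_inv_eq_smult: "x \<in> carrier C \<Longrightarrow> \<ominus>\<^bsub>C\<^esub> x = (\<ominus>\<^bsub>R\<^esub> \<one>\<^bsub>R\<^esub>) \<odot>\<^bsub>C\<^esub> x"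
  by (simp add: smult_l_minus)

lemma \<epsilon>_a_inv: "\<lbrakk>x \<in> carrier C; \<epsilon> x = \<zero>\<^bsub>R\<^esub>\<rbrakk> \<Longrightarrow> \<epsilon> (\<ominus>\<^bsub>C\<^esub> x) = \<zero>\<^bsub>R\<^esub>"
  by (simp add: a_inv_eq_smult \<epsilon>_simps)

lemma desusp_module: "module R V"
proof (rule moduleI[OF R.is_cring])
  show "abelian_group V"
  proof (rule abelian_groupI)
    fix x assume "x \<in> carrier V"
    then show "\<exists>y\<in>carrier V. y \<oplus>\<^bsub>V\<^esub> x = \<zero>\<^bsub>V\<^esub>"
      by (intro bexI[of _ "\<ominus>\<^bsub>C\<^esub> x"]) (auto simp: desusp_simps \<epsilon>_a_inv M.l_neg)
  qed (auto simp: desusp_simps \<epsilon>_simps M.a_ac)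
qed (auto simp: desusp_simps \<epsilon>_simps smult_l_distr smult_r_distr smult_assoc1)

interpretation V: module R V
  by (rule desusp_module)

lemma desusp_finsum: "f \<in> A \<rightarrow> carrier V \<Longrightarrow> (\<Oplus>\<^bsub>V\<^esub> i\<in>A. f i) = (\<Oplus>\<^bsub>C\<^esub> i\<in>A. f i)"
proof (induction A rule: infinite_finite_induct)
  case (insert a A)
  then have "f a \<in> carrier C" "f \<in> A \<rightarrow> carrier C" by (auto simp: desusp_simps)
  then show ?case
    using insert by (simp add: desusp_simps(3))
qed (simp_all add: desusp_simps(2))

text \<open>The index shift is that of s^(-1). Existence and uniqueness of decompositions carry over
  from \<open>C\<close> through this equivalence.\<close>

lemma desusp_hdecomp:
  "hdecomp V x f \<longleftrightarrow> hdecomp C x (\<lambda>k. f (k - 1)) \<and> (\<forall>n. \<epsilon> (f n) = \<zero>\<^bsub>R\<^esub>)"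
\<comment> \<open>Sums in \<open>V\<close> and in \<open>C\<close> can be compared only for families
  in the kernel; for the other families both sides fail.\<close>
proof (cases "\<forall>n. f n \<in> gpart C (n + 1) \<and> \<epsilon> (f n) = \<zero>\<^bsub>R\<^esub>")
  case True
  have fV: "f n \<in> carrier V" for n
    using True gpart_closed by (auto simp: desusp_simps)
  have supp: "{k. f (k - 1) \<noteq> \<zero>\<^bsub>C\<^esub>} = (\<lambda>n. n + 1) ` {n. f n \<noteq> \<zero>\<^bsub>C\<^esub>}"
    by (auto simp: image_iff intro!: exI[of _ "k - 1" for k :: int])
  have fin: "finite {k. f (k - 1) \<noteq> \<zero>\<^bsub>C\<^esub>} \<longleftrightarrow> finite {n. f n \<noteq> \<zero>\<^bsub>C\<^esub>}"
    unfolding supp by (rule finite_image_iff) (simp add: inj_on_def)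
  have "(\<Oplus>\<^bsub>C\<^esub> k\<in>{k. f (k - 1) \<noteq> \<zero>\<^bsub>C\<^esub>}. f (k - 1)) = (\<Oplus>\<^bsub>C\<^esub> n\<in>{n. f n \<noteq> \<zero>\<^bsub>C\<^esub>}. f n)"
    unfolding supp using fV by (subst M.finsum_reindex) (auto simp: desusp_simps inj_on_def)
  also have "\<dots> = (\<Oplus>\<^bsub>V\<^esub> n\<in>{n. f n \<noteq> \<zero>\<^bsub>C\<^esub>}. f n)"
    using fV by (intro desusp_finsum[symmetric]) auto
  finally have sum: "(\<Oplus>\<^bsub>C\<^esub> k\<in>{k. f (k - 1) \<noteq> \<zero>\<^bsub>C\<^esub>}. f (k - 1)) = (\<Oplus>\<^bsub>V\<^esub> n\<in>{n. f n \<noteq> \<zero>\<^bsub>C\<^esub>}. f n)" .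
  have g: "f (k - 1) \<in> gpart C k" for k using True[rule_format, of "k - 1"] by simp
  show ?thesis
    unfolding hdecomp_def desusp_simps(2) fin sum using True g by (auto simp: desusp_simps(5))
next
  case False
  then obtain n where n: "f n \<notin> gpart C (n + 1) \<or> \<epsilon> (f n) \<noteq> \<zero>\<^bsub>R\<^esub>" by blast
  have "f (n + 1 - 1) \<in> gpart C (n + 1)" if "hdecomp C x (\<lambda>k. f (k - 1))"
    using that unfolding hdecomp_def by blast
  moreover have "f n \<in> gpart V n" if "hdecomp V x f"
    using that unfolding hdecomp_def by blast
  ultimately show ?thesis using n by (auto simp: desusp_simps)
qed

lemma desusp_graded: "graded_module R V"
proof (intro graded_module.intro graded_module_axioms.intro)
  show "module R V" by (rule desusp_module)
  fix n
  note sub = submoduleE[OF gpart_submodule]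
  have inv: "\<ominus>\<^bsub>V\<^esub> a = \<ominus>\<^bsub>C\<^esub> a" if "a \<in> carrier V" for a
    using that by (intro V.minus_equality) (auto simp: desusp_simps \<epsilon>_a_inv M.l_neg)
  show "submodule (gpart V n) R V"
  proof (rule V.submoduleI)
    fix a assume a: "a \<in> gpart V n"
    then have "a \<in> carrier V" using gpart_closed by (auto simp: desusp_simps)
    then show "\<ominus>\<^bsub>V\<^esub> a \<in> gpart V n"
      using a sub(3)[of a "n + 1"] gpart_closed by (auto simp: inv desusp_simps \<epsilon>_a_inv)
  qed (auto simp: desusp_simps \<epsilon>_simps gpart_closed intro: sub)
next
  fix x assume "x \<in> carrier V"
  then have x: "x \<in> carrier C" "\<epsilon> x = \<zero>\<^bsub>R\<^esub>" by (auto simp: desusp_simps)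
  show "\<exists>!f. hdecomp V x f"
  proof (rule ex1I)
    show "hdecomp V x (\<lambda>n. hcomp C (n + 1) x)"
      unfolding desusp_hdecomp using hdecomp_hcomp[OF x(1)] \<epsilon>_hcomp[OF x] by simp
    fix f assume "hdecomp V x f"
    then have f: "hcomp C k x = f (k - 1)" for k
      unfolding desusp_hdecomp using hcomp_unique[OF x(1)] by blast
    show "f = (\<lambda>n. hcomp C (n + 1) x)" by (simp add: f)
  qed
qed

end

section \<open>The binary component of a coproduct on a tensor algebra\<close>

definition word_degree :: "('r, 'm) gmodule \<Rightarrow> 'm list \<Rightarrow> int \<Rightarrow> bool" where
  "word_degree M w n \<longleftrightarrow> (\<exists>ds. list_all2 (\<lambda>x k. x \<in> gpart M k) w ds \<and> sum_list ds = n)"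

context tensor_algebra
begin

text \<open>Homogeneity in \<open>TA\<close> provides one representative supported on words of total
  degree \<open>n\<close>, and the class of that representative is a combination of the
  corresponding tensors.\<close>

lemma gpart_TA_lspan:
  assumes "X \<in> gpart T n"
  shows "X \<in> lspan R T {tens R M w |w. set w \<subseteq> carrier M \<and> word_degree M w n}"
proof -
  obtain p q where "p \<in> X" "X = cls q" "q \<in> carrier F" and p: "\<And>w. p w \<noteq> \<zero> \<Longrightarrow> word_degree M w n"
    using assms TA_carrier by (auto simp: TA_def Let_def word_degree_def)
  then have pF: "p \<in> carrier F" and X: "X = cls p" using cls_memD[of p q] by auto
  let ?W = "{w. set w \<subseteq> carrier M \<and> word_degree M w n}"
  have "p \<in> lspan R F (word R ` ?W)"
    using pF p by (intro free.free_alg_lspan_support) (auto dest: free.free_alg_lists)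
  then show ?thesis
    unfolding X
    by (rule linear_maps_lspan[OF free.free_alg_module TA_module cls_linear _ _ _, rotated -1])
      (auto simp: tens_eq_cls[symmetric] intro!: T.lspan_base)
qed

lemma tens_gpart_TA:
  assumes "set w \<subseteq> carrier M" "word_degree M w n"
  shows "tens R M w \<in> gpart T n"
proof -
  have "word R w \<in> tens R M w" using assms(1) by (simp add: tens_eq_cls cls_self)
  moreover have "tens R M w \<in> carrier T" using assms(1) by simp
  moreover have "\<forall>v. word R w v \<noteq> \<zero> \<longrightarrow> word_degree M v n"
    using assms(2) by (simp add: word_def)
  ultimately show ?thesis by (auto simp: TA_def Let_def word_degree_def)
qed

end

lemma (in tensor_algebra) tensor_algebra_TA: "tensor_algebra R T"
  by (rule tensor_algebra.intro[OF TA_module])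

text \<open>The values of \<open>nabla\<close> lie in T(T(M)), which keeps the tensor sign of the
  coproduct apart from the concatenation product of T(M).\<close>

locale TA_coproduct = graded_tensor_algebra R M for R :: "'r ring" (structure) and M :: "('r, 'm) gmodule" +
  fixes nabla :: "('m list \<Rightarrow> 'r) set \<Rightarrow> (('m list \<Rightarrow> 'r) set list \<Rightarrow> 'r) set"
  assumes nabla_degree: "nabla \<in> deg_map R T (TA R T) 0"
    and nabla_coassoc: "X \<in> carrier T \<Longrightarrow>
      tlift2 R T (TA R T) (\<lambda>a b. nabla a \<otimes>\<^bsub>TA R T\<^esub> tens R T [b]) (nabla X) =
      tlift2 R T (TA R T) (\<lambda>a b. tens R T [a] \<otimes>\<^bsub>TA R T\<^esub> nabla b) (nabla X)"
    and nabla_one: "nabla \<one>\<^bsub>T\<^esub> = tens R T [\<one>\<^bsub>T\<^esub>, \<one>\<^bsub>T\<^esub>]"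
begin

interpretation A: tensor_algebra R T
  by (rule tensor_algebra_TA)

abbreviation pr where "pr \<equiv> tproj R M 1"

text \<open>The projection of T(M) \<otimes> T(M) onto M \<otimes> M, with the result read as a
  tensor of length two in T(M).\<close>

definition \<phi> where "\<phi> = tlift2 R T T (\<lambda>a b. pr a \<otimes>\<^bsub>T\<^esub> pr b)"

text \<open>The extension of \<open>E\<^sup>1\<^sup>,\<^sup>1\<close> from \<open>M\<close> to \<open>T(M)\<close>.\<close>

definition nabla11 where "nabla11 X = \<phi> (nabla X)"

lemma TT_bilinear:
  "\<lbrakk>f \<in> linear_maps R T T; g \<in> linear_maps R T T\<rbrakk> \<Longrightarrow> bilinear R T T (\<lambda>a b. f a \<otimes>\<^bsub>T\<^esub> g b)"
  by (rule A.tlift2_mult_bilinear[OF tensor_algebra_axioms])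

lemma Ecomp_11: "Ecomp R M nabla 1 1 x = nabla11 (tens R M [x])"
  by (simp add: Ecomp_def nabla11_def \<phi>_def)

lemma nabla_linear: "nabla \<in> linear_maps R T A.T"
  using nabla_degree by (simp add: deg_map_def lin_map_eq_linear_maps)

lemma nabla_closed: "X \<in> carrier T \<Longrightarrow> nabla X \<in> carrier A.T"
  by (rule linear_maps_closed[OF nabla_linear])

lemma \<phi>_linear: "\<phi> \<in> linear_maps R A.T T"
  unfolding \<phi>_def by (rule A.tlift2_linear[OF TA_module TT_bilinear[OF tproj_linear tproj_linear]])

lemma nabla11_linear: "nabla11 \<in> linear_maps R T T"
  using linear_maps_comp[OF nabla_linear \<phi>_linear] by (simp add: nabla11_def[abs_def])

lemma nabla11_closed: "X \<in> carrier T \<Longrightarrow> nabla11 X \<in> carrier T"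
  by (rule linear_maps_closed[OF nabla11_linear])

lemma nabla11_one: "nabla11 (tens R M []) = \<zero>\<^bsub>T\<^esub>"
proof -
  have "pr \<one>\<^bsub>T\<^esub> = \<zero>\<^bsub>T\<^esub>" using tproj_tens[of "[]" 1] by (simp add: tens_Nil)
  then show ?thesis
    by (simp add: nabla11_def tens_Nil nabla_one \<phi>_def
        A.tlift2_tens[OF TA_module TT_bilinear[OF tproj_linear tproj_linear]])
qed

text \<open>When one factor has length one, the length of the concatenation determines the length of
  the other. All E^(i,1)(x) thus become the length components of one element of T(M), and likewise
  all E^(1,i)(x).\<close>

lemma Ecomp_eq_tproj:
  assumes x: "x \<in> carrier M"
  shows "Ecomp R M nabla i 1 x =
      tproj R M (i + 1) (tlift2 R T T (\<lambda>a b. a \<otimes>\<^bsub>T\<^esub> pr b) (nabla (tens R M [x])))"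
    and "Ecomp R M nabla 1 i x =
      tproj R M (1 + i) (tlift2 R T T (\<lambda>a b. pr a \<otimes>\<^bsub>T\<^esub> b) (nabla (tens R M [x])))"
proof -
  have Z: "nabla (tens R M [x]) \<in> carrier A.T" using x nabla_closed by simp
  show "Ecomp R M nabla i 1 x =
      tproj R M (i + 1) (tlift2 R T T (\<lambda>a b. a \<otimes>\<^bsub>T\<^esub> pr b) (nabla (tens R M [x])))"
    unfolding Ecomp_def
    by (rule A.linear_tlift2[OF TA_module TA_module TT_bilinear[OF linear_maps_id tproj_linear] tproj_linear _ Z, symmetric])
      (rule tproj_mult_r)
  show "Ecomp R M nabla 1 i x =
      tproj R M (1 + i) (tlift2 R T T (\<lambda>a b. pr a \<otimes>\<^bsub>T\<^esub> b) (nabla (tens R M [x])))"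
    unfolding Ecomp_def
    by (rule A.linear_tlift2[OF TA_module TA_module TT_bilinear[OF tproj_linear linear_maps_id] tproj_linear _ Z, symmetric])
      (rule tproj_mult_l)
qed

text \<open>Meant for \<open>nabla11_left\<close> and \<open>nabla11_right\<close>, which kill words
  with fewer than two letters since \<open>nabla11\<close> kills the unit. The bound on
  \<open>Y\<close> expresses the vanishing of the higher components of the coproduct.\<close>

lemma linear_low_degree:
  assumes G: "G \<in> linear_maps R T T" and Y: "Y \<in> carrier T"
    and low: "\<And>w. \<lbrakk>set w \<subseteq> carrier M; length w < 2\<rbrakk> \<Longrightarrow> G (tens R M w) = \<zero>\<^bsub>T\<^esub>"
    and high: "\<And>k. 2 < k \<Longrightarrow> tproj R M k Y = \<zero>\<^bsub>T\<^esub>"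
  shows "G Y = G (tproj R M 2 Y)"
proof -
  have *: "G (tproj R M k Y) = \<zero>\<^bsub>T\<^esub>" if "k < 2" for k
    by (rule TA_linear_eqI[OF TA_module linear_maps_comp[OF tproj_linear G] linear_maps_const_zero[OF TA_module] _ Y])
      (use that low in \<open>auto simp: tproj_tens linear_maps_zero[OF TA_module TA_module G]\<close>)
  have "Y = (\<Oplus>\<^bsub>T\<^esub> k\<in>{..2}. tproj R M k Y)"
    by (rule tproj_sum_finite[OF Y]) (simp_all add: high)
  then have "G Y = G (\<Oplus>\<^bsub>T\<^esub> k\<in>{..2}. tproj R M k Y)" by simp
  also have "\<dots> = (\<Oplus>\<^bsub>T\<^esub> k\<in>{..2}. G (tproj R M k Y))"
    using Y tproj_closed by (intro linear_maps_finsum[OF TA_module TA_module G]) auto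
  also have "\<dots> = (\<Oplus>\<^bsub>T\<^esub> k\<in>{2}. G (tproj R M k Y))"
    using * Y tproj_closed linear_maps_closed[OF G]
    by (intro T.add.finprod_mono_neutral_cong_right) auto
  also have "\<dots> = G (tproj R M 2 Y)" using Y tproj_closed linear_maps_closed[OF G] by simp
  finally show ?thesis .
qed

text \<open>
  \<open>nabla11 \<otimes> 1\<close> and \<open>1 \<otimes> nabla11\<close> as maps on \<open>T(M)\<close>, with the last, respectively the first, letter of a
  word as the separate tensor factor; the concatenation \<open>T(M) \<otimes> M \<rightarrow> T(M)\<close> is injective, so nothing
  is lost by not working in \<open>T(M) \<otimes> M\<close>.
\<close>

definition nabla11_left where
  "nabla11_left = tlift R M T (\<lambda>w. if w = [] then \<zero>\<^bsub>T\<^esub> else nabla11 (tens R M (butlast w)) \<otimes>\<^bsub>T\<^esub> tens R M [last w])"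

definition nabla11_right where
  "nabla11_right = tlift R M T (\<lambda>w. if w = [] then \<zero>\<^bsub>T\<^esub> else tens R M [hd w] \<otimes>\<^bsub>T\<^esub> nabla11 (tens R M (tl w)))"

lemma nabla11_left_multilinear: "multilinear R M T
  (\<lambda>w. if w = [] then \<zero>\<^bsub>T\<^esub> else nabla11 (tens R M (butlast w)) \<otimes>\<^bsub>T\<^esub> tens R M [last w])"
  unfolding multilinear_def
proof (intro conjI ballI)
  show "(\<lambda>w. if w = [] then \<zero>\<^bsub>T\<^esub> else nabla11 (tens R M (butlast w)) \<otimes>\<^bsub>T\<^esub> tens R M [last w])
      \<in> lists (carrier M) \<rightarrow> carrier T"
  proof
    fix w assume "w \<in> lists (carrier M)"
    then show "(if w = [] then \<zero>\<^bsub>T\<^esub> else nabla11 (tens R M (butlast w)) \<otimes>\<^bsub>T\<^esub> tens R M [last w]) \<in> carrier T"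
      by (cases w rule: rev_cases) (auto simp: subset_iff intro!: T.m_closed nabla11_closed)
  qed
  fix u v assume uv: "u \<in> lists (carrier M)" "v \<in> lists (carrier M)"
  show "(\<lambda>x. if u @ x # v = [] then \<zero>\<^bsub>T\<^esub>
      else nabla11 (tens R M (butlast (u @ x # v))) \<otimes>\<^bsub>T\<^esub> tens R M [last (u @ x # v)]) \<in> linear_maps R M T"
  proof (cases v rule: rev_cases)
    case Nil
    then show ?thesis
      using uv by (auto simp: subset_iff intro!: linear_maps_comp[OF tens_singleton_linear TA_mult_l] nabla11_closed)
  next
    case (snoc v' y)
    have "butlast (u @ x # v) = u @ x # v'" "last (u @ x # v) = y" for x
      by (simp_all add: snoc butlast_append)
    then show ?thesis
      using uv snoc by (auto simp: subset_iff
          intro!: linear_maps_comp[OF linear_maps_comp[OF tens_linear nabla11_linear] TA_mult_r])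
  qed
qed

lemma nabla11_right_multilinear: "multilinear R M T
  (\<lambda>w. if w = [] then \<zero>\<^bsub>T\<^esub> else tens R M [hd w] \<otimes>\<^bsub>T\<^esub> nabla11 (tens R M (tl w)))"
  unfolding multilinear_def
proof (intro conjI ballI)
  show "(\<lambda>w. if w = [] then \<zero>\<^bsub>T\<^esub> else tens R M [hd w] \<otimes>\<^bsub>T\<^esub> nabla11 (tens R M (tl w)))
      \<in> lists (carrier M) \<rightarrow> carrier T"
  proof
    fix w assume "w \<in> lists (carrier M)"
    then show "(if w = [] then \<zero>\<^bsub>T\<^esub> else tens R M [hd w] \<otimes>\<^bsub>T\<^esub> nabla11 (tens R M (tl w))) \<in> carrier T"
      by (cases w) (auto simp: subset_iff intro!: T.m_closed nabla11_closed)
  qed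
  fix u v assume uv: "u \<in> lists (carrier M)" "v \<in> lists (carrier M)"
  show "(\<lambda>x. if u @ x # v = [] then \<zero>\<^bsub>T\<^esub>
      else tens R M [hd (u @ x # v)] \<otimes>\<^bsub>T\<^esub> nabla11 (tens R M (tl (u @ x # v)))) \<in> linear_maps R M T"
  proof (cases u)
    case Nil
    then show ?thesis
      using uv by (auto simp: subset_iff intro!: linear_maps_comp[OF tens_singleton_linear TA_mult_r] nabla11_closed)
  next
    case (Cons y u')
    then show ?thesis
      using uv by (auto simp: subset_iff
          intro!: linear_maps_comp[OF linear_maps_comp[OF tens_linear nabla11_linear] TA_mult_l])
  qed
qed

lemmas nabla11_left_linear = tlift_linear[OF TA_module nabla11_left_multilinear, folded nabla11_left_def]
lemmas nabla11_left_tens = tlift_tens[OF TA_module nabla11_left_multilinear, folded nabla11_left_def]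
lemmas nabla11_right_linear = tlift_linear[OF TA_module nabla11_right_multilinear, folded nabla11_right_def]
lemmas nabla11_right_tens = tlift_tens[OF TA_module nabla11_right_multilinear, folded nabla11_right_def]

text \<open>The factor \<open>pr b\<close> has length one, so it is exactly the last letter that
  \<open>nabla11_left\<close> separates from the concatenated word.\<close>

lemma nabla11_left_mult:
  assumes a: "a \<in> carrier T" and b: "b \<in> carrier T"
  shows "nabla11_left (a \<otimes>\<^bsub>T\<^esub> pr b) = nabla11 a \<otimes>\<^bsub>T\<^esub> pr b"
proof -
  have 1: "nabla11_left (tens R M u \<otimes>\<^bsub>T\<^esub> pr b) = nabla11 (tens R M u) \<otimes>\<^bsub>T\<^esub> pr b" if u: "set u \<subseteq> carrier M" for u
  proof (rule TA_linear_eqI[OF TA_module _ _ _ b])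
    have uc: "tens R M u \<in> carrier T" using u by simp
    show "(\<lambda>b. nabla11_left (tens R M u \<otimes>\<^bsub>T\<^esub> pr b)) \<in> linear_maps R T T"
      by (rule linear_maps_comp[OF linear_maps_comp[OF tproj_linear TA_mult_l[OF uc]] nabla11_left_linear])
    show "(\<lambda>b. nabla11 (tens R M u) \<otimes>\<^bsub>T\<^esub> pr b) \<in> linear_maps R T T"
      by (rule linear_maps_comp[OF tproj_linear TA_mult_l[OF nabla11_closed[OF uc]]])
    fix w assume w: "set w \<subseteq> carrier M"
    show "nabla11_left (tens R M u \<otimes>\<^bsub>T\<^esub> pr (tens R M w)) = nabla11 (tens R M u) \<otimes>\<^bsub>T\<^esub> pr (tens R M w)"
    proof (cases "length w = 1")
      case True
      then obtain y where "w = [y]" by (auto simp: length_Suc_conv)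
      then show ?thesis using u w by (simp add: tproj_tens nabla11_left_tens flip: tens_append)
    next
      case False
      then show ?thesis
        using w uc nabla11_closed[OF uc] linear_maps_zero[OF TA_module TA_module nabla11_left_linear]
        by (simp add: tproj_tens)
    qed
  qed
  show ?thesis
    by (rule TA_linear_eqI[OF TA_module linear_maps_comp[OF TA_mult_r nabla11_left_linear]
          linear_maps_comp[OF nabla11_linear TA_mult_r] 1 a]) (auto simp: tproj_closed b)
qed

lemma nabla11_right_mult:
  assumes a: "a \<in> carrier T" and b: "b \<in> carrier T"
  shows "nabla11_right (pr a \<otimes>\<^bsub>T\<^esub> b) = pr a \<otimes>\<^bsub>T\<^esub> nabla11 b"
proof -
  have 1: "nabla11_right (pr a \<otimes>\<^bsub>T\<^esub> tens R M u) = pr a \<otimes>\<^bsub>T\<^esub> nabla11 (tens R M u)" if u: "set u \<subseteq> carrier M" for u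
  proof (rule TA_linear_eqI[OF TA_module _ _ _ a])
    have uc: "tens R M u \<in> carrier T" using u by simp
    show "(\<lambda>a. nabla11_right (pr a \<otimes>\<^bsub>T\<^esub> tens R M u)) \<in> linear_maps R T T"
      by (rule linear_maps_comp[OF linear_maps_comp[OF tproj_linear TA_mult_r[OF uc]] nabla11_right_linear])
    show "(\<lambda>a. pr a \<otimes>\<^bsub>T\<^esub> nabla11 (tens R M u)) \<in> linear_maps R T T"
      by (rule linear_maps_comp[OF tproj_linear TA_mult_r[OF nabla11_closed[OF uc]]])
    fix w assume w: "set w \<subseteq> carrier M"
    show "nabla11_right (pr (tens R M w) \<otimes>\<^bsub>T\<^esub> tens R M u) = pr (tens R M w) \<otimes>\<^bsub>T\<^esub> nabla11 (tens R M u)"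
    proof (cases "length w = 1")
      case True
      then obtain y where "w = [y]" by (auto simp: length_Suc_conv)
      then show ?thesis using u w by (simp add: tproj_tens nabla11_right_tens flip: tens_append)
    next
      case False
      then show ?thesis
        using w uc nabla11_closed[OF uc] linear_maps_zero[OF TA_module TA_module nabla11_right_linear]
        by (simp add: tproj_tens)
    qed
  qed
  show ?thesis
    by (rule TA_linear_eqI[OF TA_module linear_maps_comp[OF TA_mult_l nabla11_right_linear]
          linear_maps_comp[OF nabla11_linear TA_mult_l] 1 b]) (auto simp: tproj_closed a)
qed

lemma nabla11_left_low: "\<lbrakk>set w \<subseteq> carrier M; length w < 2\<rbrakk> \<Longrightarrow> nabla11_left (tens R M w) = \<zero>\<^bsub>T\<^esub>"
  by (cases w) (auto simp: nabla11_left_tens nabla11_one)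

lemma nabla11_right_low: "\<lbrakk>set w \<subseteq> carrier M; length w < 2\<rbrakk> \<Longrightarrow> nabla11_right (tens R M w) = \<zero>\<^bsub>T\<^esub>"
  by (cases w) (auto simp: nabla11_right_tens nabla11_one)

lemma e_linear: "Ecomp R M nabla 1 1 \<in> linear_maps R M T"
proof -
  have "Ecomp R M nabla 1 1 = (\<lambda>x. nabla11 (tens R M [x]))" by (rule ext) (rule Ecomp_11)
  then show ?thesis using linear_maps_comp[OF tens_singleton_linear nabla11_linear] by metis
qed

lemma nabla11_left_square:
  assumes Y: "Y \<in> carrier T"
  shows "nabla11_left (tproj R M 2 Y) = tlift2 R M T (\<lambda>a b. Ecomp R M nabla 1 1 a \<otimes>\<^bsub>T\<^esub> tens R M [b]) (tproj R M 2 Y)"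
proof -
  note b = mult_bilinear[OF e_linear tens_singleton_linear]
  show ?thesis
  proof (rule TA_linear_eqI[OF TA_module linear_maps_comp[OF tproj_linear nabla11_left_linear]
        linear_maps_comp[OF tproj_linear tlift2_linear[OF TA_module b]] _ Y])
    fix w assume w: "set w \<subseteq> carrier M"
    show "nabla11_left (tproj R M 2 (tens R M w)) =
        tlift2 R M T (\<lambda>a b. Ecomp R M nabla 1 1 a \<otimes>\<^bsub>T\<^esub> tens R M [b]) (tproj R M 2 (tens R M w))"
    proof (cases "length w = 2")
      case True
      then obtain x y where "w = [x, y]" by (auto simp: length_Suc_conv numeral_2_eq_2)
      then show ?thesis
        using w tlift2_tens[OF TA_module b, of "[x, y]"]
        by (simp add: tproj_tens nabla11_left_tens Ecomp_11 del: One_nat_def)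
    next
      case False
      then show ?thesis
        using w by (simp add: tproj_tens linear_maps_zero[OF TA_module TA_module nabla11_left_linear]
            linear_maps_zero[OF TA_module TA_module tlift2_linear[OF TA_module b]] del: One_nat_def)
    qed
  qed
qed

lemma nabla11_right_square:
  assumes Y: "Y \<in> carrier T"
  shows "nabla11_right (tproj R M 2 Y) = tlift2 R M T (\<lambda>a b. tens R M [a] \<otimes>\<^bsub>T\<^esub> Ecomp R M nabla 1 1 b) (tproj R M 2 Y)"
proof -
  note b = mult_bilinear[OF tens_singleton_linear e_linear]
  show ?thesis
  proof (rule TA_linear_eqI[OF TA_module linear_maps_comp[OF tproj_linear nabla11_right_linear]
        linear_maps_comp[OF tproj_linear tlift2_linear[OF TA_module b]] _ Y])
    fix w assume w: "set w \<subseteq> carrier M"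
    show "nabla11_right (tproj R M 2 (tens R M w)) =
        tlift2 R M T (\<lambda>a b. tens R M [a] \<otimes>\<^bsub>T\<^esub> Ecomp R M nabla 1 1 b) (tproj R M 2 (tens R M w))"
    proof (cases "length w = 2")
      case True
      then obtain x y where "w = [x, y]" by (auto simp: length_Suc_conv numeral_2_eq_2)
      then show ?thesis
        using w tlift2_tens[OF TA_module b, of "[x, y]"]
        by (simp add: tproj_tens nabla11_right_tens Ecomp_11 del: One_nat_def)
    next
      case False
      then show ?thesis
        using w by (simp add: tproj_tens linear_maps_zero[OF TA_module TA_module nabla11_right_linear]
            linear_maps_zero[OF TA_module TA_module tlift2_linear[OF TA_module b]] del: One_nat_def)
    qed
  qed
qed

lemma e_pow: "x \<in> carrier M \<Longrightarrow> tproj R M 2 (Ecomp R M nabla 1 1 x) = Ecomp R M nabla 1 1 x"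
proof -
  assume x: "x \<in> carrier M"
  have "tlift2 R T T (\<lambda>a b. a \<otimes>\<^bsub>T\<^esub> pr b) (nabla (tens R M [x])) \<in> carrier T"
    using x by (intro linear_maps_closed[OF A.tlift2_linear[OF TA_module TT_bilinear[OF linear_maps_id tproj_linear]]]
        nabla_closed) simp
  then show ?thesis
    using Ecomp_eq_tproj(1)[OF x, of 1] tproj_tproj by (simp add: numeral_2_eq_2)
qed

text \<open>Applying pr \<otimes> pr \<otimes> pr to coassociativity of \<open>nabla\<close> equates
  \<open>nabla11_left Y\<close> with \<open>nabla11_right Y'\<close>. By
  \<open>linear_low_degree\<close> each of these depends only on a length two component, which is
  e(x) in both cases.\<close>

lemma e_coassoc:
  assumes l: "\<And>k x. \<lbrakk>2 \<le> k; x \<in> carrier M\<rbrakk> \<Longrightarrow> Ecomp R M nabla k 1 x = \<zero>\<^bsub>T\<^esub>"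
    and r: "\<And>k x. \<lbrakk>2 \<le> k; x \<in> carrier M\<rbrakk> \<Longrightarrow> Ecomp R M nabla 1 k x = \<zero>\<^bsub>T\<^esub>"
    and x: "x \<in> carrier M"
  shows "tlift2 R M T (\<lambda>a b. Ecomp R M nabla 1 1 a \<otimes>\<^bsub>T\<^esub> tens R M [b]) (Ecomp R M nabla 1 1 x) =
      tlift2 R M T (\<lambda>a b. tens R M [a] \<otimes>\<^bsub>T\<^esub> Ecomp R M nabla 1 1 b) (Ecomp R M nabla 1 1 x)"
proof -
  let ?Z = "nabla (tens R M [x])"
  have tx: "tens R M [x] \<in> carrier T" using x by simp
  have Z: "?Z \<in> carrier A.T" using nabla_closed[OF tx] .
  let ?G = "mult_maps R T M [pr, pr, pr]"
  note bl = TT_bilinear[OF linear_maps_id tproj_linear] and br = TT_bilinear[OF tproj_linear linear_maps_id]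
  have G: "?G \<in> linear_maps R A.T T"
    by (rule A.mult_maps_linear[OF tensor_algebra_axioms]) (simp add: tproj_linear)
  \<comment> \<open>The component of length k + 1 of \<open>Y\<close> is E^(k,1)(x), that of
    \<open>Y'\<close> is E^(1,k)(x). The two elements have the same component in length two.\<close>
  define Y where "Y = tlift2 R T T (\<lambda>a b. a \<otimes>\<^bsub>T\<^esub> pr b) ?Z"
  define Y' where "Y' = tlift2 R T T (\<lambda>a b. pr a \<otimes>\<^bsub>T\<^esub> b) ?Z"
  have Yc: "Y \<in> carrier T" "Y' \<in> carrier T"
    unfolding Y_def Y'_def
    by (rule linear_maps_closed[OF A.tlift2_linear[OF TA_module bl] Z],
        rule linear_maps_closed[OF A.tlift2_linear[OF TA_module br] Z])
  have Y2: "tproj R M 2 Y = Ecomp R M nabla 1 1 x" "tproj R M 2 Y' = Ecomp R M nabla 1 1 x"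
    using Ecomp_eq_tproj[OF x, of 1] by (simp_all add: Y_def Y'_def numeral_2_eq_2)
  have Yh: "tproj R M k Y = \<zero>\<^bsub>T\<^esub>" "tproj R M k Y' = \<zero>\<^bsub>T\<^esub>" if "2 < k" for k
    using Ecomp_eq_tproj[OF x, of "k - 1"] l[of "k - 1" x] r[of "k - 1" x] x that
    by (simp_all add: Y_def Y'_def)
  have "nabla11_left Y = tlift2 R T T (\<lambda>a b. nabla11 a \<otimes>\<^bsub>T\<^esub> pr b) ?Z"
    unfolding Y_def
    by (rule A.linear_tlift2[OF TA_module TA_module bl nabla11_left_linear _ Z]) (rule nabla11_left_mult)
  also have "\<dots> = ?G (tlift2 R T A.T (\<lambda>a b. nabla a \<otimes>\<^bsub>A.T\<^esub> tens R T [b]) ?Z)"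
    by (rule A.linear_tlift2[OF A.TA_module TA_module
          A.tlift2_mult_bilinear[OF A.tensor_algebra_axioms nabla_linear A.tens_singleton_linear] G _ Z, symmetric])
      (simp add: A.mult_maps3[OF tensor_algebra_axioms tproj_linear tproj_linear tproj_linear] nabla_closed
        nabla11_def \<phi>_def)
  also have "\<dots> = ?G (tlift2 R T A.T (\<lambda>a b. tens R T [a] \<otimes>\<^bsub>A.T\<^esub> nabla b) ?Z)"
    by (simp add: nabla_coassoc[OF tx])
  also have "\<dots> = tlift2 R T T (\<lambda>a b. pr a \<otimes>\<^bsub>T\<^esub> nabla11 b) ?Z"
    by (rule A.linear_tlift2[OF A.TA_module TA_module
          A.tlift2_mult_bilinear[OF A.tensor_algebra_axioms A.tens_singleton_linear nabla_linear] G _ Z])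
      (simp add: A.mult_maps3[OF tensor_algebra_axioms tproj_linear tproj_linear tproj_linear] nabla_closed
        nabla11_def \<phi>_def)
  also have "\<dots> = nabla11_right Y'"
    unfolding Y'_def
    by (rule A.linear_tlift2[OF TA_module TA_module br nabla11_right_linear _ Z, symmetric]) (rule nabla11_right_mult)
  finally have "nabla11_left (tproj R M 2 Y) = nabla11_right (tproj R M 2 Y')"
    using linear_low_degree[OF nabla11_left_linear Yc(1) nabla11_left_low Yh(1)]
      linear_low_degree[OF nabla11_right_linear Yc(2) nabla11_right_low Yh(2)] by simp
  then show ?thesis
    using nabla11_left_square[OF Yc(1)] nabla11_right_square[OF Yc(2)] unfolding Y2 by metis
qed

lemma pr_graded: "X \<in> gpart T k \<Longrightarrow> pr X \<in> lspan R T (htens 1 k)"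
proof (rule linear_maps_lspan[OF TA_module TA_module tproj_linear _ _ htens_subset gpart_TA_lspan])
  fix s assume "s \<in> {tens R M w |w. set w \<subseteq> carrier M \<and> word_degree M w k}"
  then obtain w where w: "s = tens R M w" "set w \<subseteq> carrier M" "word_degree M w k" by auto
  show "pr s \<in> lspan R T (htens 1 k)"
  proof (cases "length w = 1")
    case True
    then have "s \<in> htens 1 k" using w by (auto simp: htens_def word_degree_def)
    then show ?thesis using w True T.lspan_base[OF _ htens_subset] by (simp add: tproj_tens)
  next
    case False
    then show ?thesis using w by (simp add: tproj_tens lspan.zero)
  qed
qed auto

lemma lspan_htens_mult:
  assumes X: "X \<in> lspan R T (htens m a)" and Y: "Y \<in> lspan R T (htens n b)"
  shows "X \<otimes>\<^bsub>T\<^esub> Y \<in> lspan R T (htens (m + n) (a + b))"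
proof (rule linear_maps_lspan[OF TA_module TA_module TA_mult_r htens_subset _ htens_subset X])
  show "Y \<in> carrier T" using T.lspan_closed[OF Y htens_subset] .
  fix s assume s: "s \<in> htens m a"
  then have sc: "s \<in> carrier T" using htens_subset by auto
  show "s \<otimes>\<^bsub>T\<^esub> Y \<in> lspan R T (htens (m + n) (a + b))"
    by (rule linear_maps_lspan[OF TA_module TA_module TA_mult_l[OF sc] htens_subset _ htens_subset Y])
      (auto intro!: T.lspan_base[OF _ htens_subset] htens_mult[OF s])
qed

text \<open>\<open>nabla\<close> has degree 0 for the total grading of T(T(M)), so the degrees of
  the two factors add up to that of \<open>x\<close>, and projecting each factor to length one
  preserves its degree.\<close>

lemma e_graded: "x \<in> gpart M a \<Longrightarrow> Ecomp R M nabla 1 1 x \<in> lspan R T (htens 2 a)"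
proof -
  assume x: "x \<in> gpart M a"
  have "word_degree M [x] a" using x by (auto simp: word_degree_def intro!: exI[of _ "[a]"])
  then have "tens R M [x] \<in> gpart T a" using x gpart_closed by (intro tens_gpart_TA) auto
  then have Z: "nabla (tens R M [x]) \<in> gpart A.T a" using nabla_degree by (force simp: deg_map_def)
  have "\<phi> (nabla (tens R M [x])) \<in> lspan R T (htens 2 a)"
  proof (rule linear_maps_lspan[OF A.TA_module TA_module \<phi>_linear _ _ htens_subset A.gpart_TA_lspan[OF Z]])
    fix s assume "s \<in> {tens R T w |w. set w \<subseteq> carrier T \<and> word_degree T w a}"
    then obtain w where w: "s = tens R T w" "set w \<subseteq> carrier T" "word_degree T w a" by auto
    note tens = A.tlift2_tens[OF TA_module TT_bilinear[OF tproj_linear[of 1] tproj_linear[of 1]] w(2), folded \<phi>_def]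
    show "\<phi> s \<in> lspan R T (htens 2 a)"
    proof (cases "length w = 2")
      case True
      then obtain X Y k l where "w = [X, Y]" "X \<in> gpart T k" "Y \<in> gpart T l" "k + l = a"
        using w(3) by (auto simp: word_degree_def length_Suc_conv numeral_2_eq_2 list_all2_Cons1)
      then show ?thesis
        using lspan_htens_mult[OF pr_graded pr_graded, of X k Y l] tens w(1) by (simp add: numeral_2_eq_2)
    next
      case False
      then show ?thesis using tens w(1) by (simp add: lspan.zero)
    qed
  qed auto
  then show ?thesis by (simp add: Ecomp_11 nabla11_def del: One_nat_def)
qed

lemma graded_coassociative_map_Ecomp:
  assumes "\<And>k x. \<lbrakk>2 \<le> k; x \<in> carrier M\<rbrakk> \<Longrightarrow> Ecomp R M nabla k 1 x = \<zero>\<^bsub>T\<^esub>"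
    and "\<And>k x. \<lbrakk>2 \<le> k; x \<in> carrier M\<rbrakk> \<Longrightarrow> Ecomp R M nabla 1 k x = \<zero>\<^bsub>T\<^esub>"
  shows "graded_coassociative_map R M (Ecomp R M nabla 1 1)"
  by (intro graded_coassociative_map.intro graded_tensor_algebra_axioms coassociative_map.intro
      tensor_algebra_axioms coassociative_map_axioms.intro graded_coassociative_map_axioms.intro
      e_linear e_pow e_coassoc assms e_graded)

end

theorem proposition4p5:
  fixes R :: "'r ring" and C :: "('r, 'c) gmodule"
    and d :: "'c \<Rightarrow> 'c" and \<Delta> :: "'c \<Rightarrow> ('c list \<Rightarrow> 'r) set" and \<epsilon> :: "'c \<Rightarrow> 'r" and u :: 'c
    and nabla :: "('c list \<Rightarrow> 'r) set \<Rightarrow> (('c list \<Rightarrow> 'r) set list \<Rightarrow> 'r) set"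
    and V :: "('r, 'c) gmodule" and E :: "nat \<Rightarrow> 'c \<Rightarrow> ('c list \<Rightarrow> 'r) set"
  assumes "homotopy_G_coalgebra R C d \<Delta> \<epsilon> u nabla"
    and "V = desusp R C \<epsilon>"
    and "E = (\<lambda>k. Ecomp R V nabla k 1)"
    and "\<forall>k\<ge>2. \<forall>x\<in>carrier V. E k x = \<zero>\<^bsub>TA R V\<^esub>"
  shows "((\<forall>x\<in>carrier V. obstruction R V E 2 x = \<zero>\<^bsub>TA R V\<^esub>) \<longleftrightarrow>
          (\<forall>x\<in>carrier V. E 1 x \<ominus>\<^bsub>TA R V\<^esub> koszul_perm R V [1, 0] (E 1 x) = \<zero>\<^bsub>TA R V\<^esub>)) \<and>
         ((\<forall>x\<in>carrier V. obstruction R V E 2 x = \<zero>\<^bsub>TA R V\<^esub>) \<longrightarrow>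
          (\<forall>n\<ge>2. \<forall>x\<in>carrier V. obstruction R V E n x = \<zero>\<^bsub>TA R V\<^esub>))"
proof -
  interpret H: homotopy_G_coalgebra R C d \<Delta> \<epsilon> u nabla by fact
  have "graded_functional R C \<epsilon>"
    by (intro graded_functional.intro graded_functional_axioms.intro H.graded_module_axioms H.counit_degree)
  then have graded: "graded_module R V"
    unfolding assms(2) by (rule graded_functional.desusp_graded)
  obtain \<eta> where "dg_bialgebra R (TA R V) (cobar_d R C d \<Delta> \<epsilon> u) nabla \<eta>"
    using H.cobar_bialgebra assms(2) by blast
  then have bialg: "dg_coalgebra R (TA R V) (cobar_d R C d \<Delta> \<epsilon> u) nabla \<eta>"
    and one: "nabla \<one>\<^bsub>TA R V\<^esub> = tens R (TA R V) [\<one>\<^bsub>TA R V\<^esub>, \<one>\<^bsub>TA R V\<^esub>]"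
    by (rule dg_bialgebra.axioms(2), rule dg_bialgebra.coproduct_one)
  interpret V: TA_coproduct R V nabla
    by (intro TA_coproduct.intro TA_coproduct_axioms.intro graded_tensor_algebra.intro tensor_algebra.intro
        graded graded_module.axioms(1)[OF graded] dg_coalgebra.coproduct_degree[OF bialg]
        dg_coalgebra.coassoc[OF bialg] one)
  have E_1: "E 1 = Ecomp R V nabla 1 1" by (simp add: assms(3))
  \<comment> \<open>The components E^(k,1) vanish by the assumption of the theorem, and the
    components E^(1,k) by \<open>E_vanish\<close> with i = 1.\<close>
  interpret V: graded_coassociative_map R V "E 1"
    unfolding E_1 using assms(3,4) H.E_vanish[folded assms(2)]
    by (intro V.graded_coassociative_map_Ecomp) auto
  let ?T = "TA R V" and ?\<tau> = "koszul_perm R V [1, 0]"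
  have \<tau>: "?\<tau> (E 1 x) \<in> carrier ?T" if "x \<in> carrier V" for x
  proof (rule linear_maps_closed[OF V.koszul_perm_linear])
    show "E 1 x \<in> carrier ?T" by (rule V.e_closed[OF that])
  qed auto
  have minus: "a \<ominus>\<^bsub>?T\<^esub> b = \<zero>\<^bsub>?T\<^esub> \<longleftrightarrow> a = b" if "a \<in> carrier ?T" "b \<in> carrier ?T" for a b
  proof
    assume "a \<ominus>\<^bsub>?T\<^esub> b = \<zero>\<^bsub>?T\<^esub>"
    moreover have "a = (a \<ominus>\<^bsub>?T\<^esub> b) \<oplus>\<^bsub>?T\<^esub> b"
      using that by (simp add: a_minus_def V.T.a_assoc V.T.l_neg)
    ultimately show "a = b" using that by simp
  qed (use that in \<open>simp add: a_minus_def V.T.r_neg\<close>)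
  have two: "obstruction R V E 2 x = \<zero>\<^bsub>?T\<^esub> \<longleftrightarrow> ?\<tau> (E 1 x) = E 1 x" if "x \<in> carrier V" for x
    unfolding V.obstruction_2[OF refl assms(4) that] by (rule minus[OF \<tau>[OF that] V.e_closed[OF that]])
  have comm: "E 1 x \<ominus>\<^bsub>?T\<^esub> ?\<tau> (E 1 x) = \<zero>\<^bsub>?T\<^esub> \<longleftrightarrow> ?\<tau> (E 1 x) = E 1 x" if "x \<in> carrier V" for x
    unfolding minus[OF V.e_closed[OF that] \<tau>[OF that]] by (rule eq_commute)
  show ?thesis
  proof (intro conjI impI allI ballI)
    show "(\<forall>x\<in>carrier V. obstruction R V E 2 x = \<zero>\<^bsub>?T\<^esub>) \<longleftrightarrow>
        (\<forall>x\<in>carrier V. E 1 x \<ominus>\<^bsub>?T\<^esub> ?\<tau> (E 1 x) = \<zero>\<^bsub>?T\<^esub>)"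
      by (intro ball_cong refl) (simp only: two comm)
    fix n :: nat and x assume O2: "\<forall>x\<in>carrier V. obstruction R V E 2 x = \<zero>\<^bsub>?T\<^esub>"
      and "2 \<le> n" "x \<in> carrier V"
    then show "obstruction R V E n x = \<zero>\<^bsub>?T\<^esub>"
      using two by (intro V.obstruction_eq_zero[OF refl assms(4)]) blast
  qed
qed

end
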